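(* Fix $\alpha\ge4$. If $(T_\alpha)$ holds with constants $\kappa_T,L_T$ (and some $c_T$), then $(\mathrm{BRIDGE}_\alpha)$ holds with $\kappa=\kappa_T/8$, $C=0$, for some $\delta_0,c_0$ depending only on $\alpha,\kappa_T,L_T$. Conversely, if $(\mathrm{BRIDGE}_\alpha)$ holds with constant $\kappa$ (and some $\delta_0,C,c_0$), then $(T_\alpha)$ holds with $\kappa_T=\kappa/32$, for some $L_T,c_T$. Hence, for each fixed $\alpha\ge4$, $(\mathrm{BRIDGE}_\alpha)\Longleftrightarrow(T_\alpha)$.
   Context: For $c>0$, $S_c$ is the positive trace-class integral operator on $L^2(0,c)$ with kernel $\frac{\sin(\pi(x-y))}{\pi(x-y)}$ (equal to $1$ for $x=y$); its eigenvalues are simple, $1>\lambda_0(c)>\lambda_1(c)>\cdots>0$. For $0<\delta<\tfrac12$, $L=\ln\frac1\delta$ and $D(\delta,c)=\#\{n:\delta<\lambda_n(c)\le\tfrac12\}$. For $\alpha\ge4$, $(T_\alpha)$ is the assertion: there exist $\kappa_T>0$, $L_T<\infty$, $c_T<\infty$ such that for all $c\ge c_T$ and all $u\in[L_T,\alpha\ln c]$, $$\ln\det\bigl(I+(e^u-1)S_c\bigr)\ge u\,c+\kappa_T\,u^2\ln c ,$$ with $\det$ the Fredholm determinant. For $\alpha\ge4$, $(\mathrm{BRIDGE}_\alpha)$ is the assertion: there exist $\delta_0\in(0,\tfrac12)$, $\kappa>0$, $C<\infty$, $c_0<\infty$ such that $$D(\delta,c)\ge\kappa\,L\,\ln\Bigl(\frac{\alpha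 c}{L}\Bigr)-C$$ for every $c\ge c_0$ and every $\delta$ with $c^{-\alpha}\le\delta\le\delta_0$. $\ln$ is the natural logarithm. *)

theory Defs
  imports "HOL-Analysis.Analysis" "Jordan_Normal_Form.Determinant"
begin

definition lborel_ivl :: "real \<Rightarrow> real measure" where
  "lborel_ivl c = restrict_space lborel {0<..<c}"

text \<open>
  Representatives of the elements of complex \<open>L\<^sup>2(0,c)\<close>; two of them denote the same element
  iff they agree almost everywhere, so all equations between them below are up to null sets.
\<close>

definition L2_ivl :: "real \<Rightarrow> (real \<Rightarrow> complex) set" where
  "L2_ivl c = {f \<in> borel_measurable (lborel_ivl c).
                 integrable (lborel_ivl c) (\<lambda>x. (cmod (f x))\<^sup>2)}"

definition sinc_kernel :: "real \<Rightarrow> real \<Rightarrow> real" where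
  "sinc_kernel x y = (if x = y then 1 else sin (pi * (x - y)) / (pi * (x - y)))"

definition sinc_op :: "real \<Rightarrow> (real \<Rightarrow> complex) \<Rightarrow> real \<Rightarrow> complex" where
  "sinc_op c f x = (LINT y|lborel_ivl c. complex_of_real (sinc_kernel x y) * f y)"

definition eigenspace :: "real \<Rightarrow> real \<Rightarrow> (real \<Rightarrow> complex) set" where
  "eigenspace c \<mu> =
     {f \<in> L2_ivl c. AE x in lborel_ivl c. sinc_op c f x = complex_of_real \<mu> * f x}"

definition is_eigenvalue :: "real \<Rightarrow> real \<Rightarrow> bool" where
  "is_eigenvalue c \<mu> \<longleftrightarrow> (\<exists>f \<in> eigenspace c \<mu>. \<not> (AE x in lborel_ivl c. f x = 0))"

text \<open>Linear independence of \<open>f 0, \<dots>, f (k - 1)\<close> as elements of \<open>L\<^sup>2(0,c)\<close>, i.e. modulo null functions.\<close>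

definition L2_independent :: "real \<Rightarrow> nat \<Rightarrow> (nat \<Rightarrow> real \<Rightarrow> complex) \<Rightarrow> bool" where
  "L2_independent c k f \<longleftrightarrow>
     (\<forall>a :: nat \<Rightarrow> complex.
        (AE x in lborel_ivl c. (\<Sum>i<k. a i * f i x) = 0) \<longrightarrow> (\<forall>i<k. a i = 0))"

text \<open>
  Multiplicity: the dimension of the eigenspace in \<open>L\<^sup>2(0,c)\<close>. The operator is compact, so for
  \<open>\<mu> > 0\<close> the set below is finite.
\<close>

definition eig_mult :: "real \<Rightarrow> real \<Rightarrow> nat" where
  "eig_mult c \<mu> = Sup {k. \<exists>f. (\<forall>i<k. f i \<in> eigenspace c \<mu>) \<and> L2_independent c k f}"

text \<open>
  The number of eigenvalues \<open>\<nu> \<ge> \<mu>\<close>, counted with multiplicity. For \<open>\<mu> > 0\<close> the sum is finite.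
\<close>

definition eig_count :: "real \<Rightarrow> real \<Rightarrow> nat" where
  "eig_count c \<mu> = (\<Sum>\<nu> | is_eigenvalue c \<nu> \<and> \<mu> \<le> \<nu>. eig_mult c \<nu>)"

text \<open>
  \<open>\<lambda>\<^sub>n(c)\<close>: the \<open>n\<close>-th largest positive eigenvalue (from \<open>n = 0\<close>), listed with multiplicity.
  As the eigenvalues are simple, counting with multiplicity does not change the list; that they
  are simple is not built into the definition. The element \<open>0\<close> only gives
  \<open>Sup\<close> a value if there were at most \<open>n\<close> positive eigenvalues, which does not happen for \<open>c > 0\<close>.
\<close>

definition eigval :: "real \<Rightarrow> nat \<Rightarrow> real" where
  "eigval c n = Sup (insert 0 {\<mu>. 0 < \<mu> \<and> n < eig_count c \<mu>})"

definition D_count :: "real \<Rightarrow> real \<Rightarrow> nat" where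
  "D_count \<delta> c = card {n. \<delta> < eigval c n \<and> eigval c n \<le> 1 / 2}"

text \<open>
  Fredholm's series for \<open>det (I + z K)\<close>, with \<open>K\<close> the integral operator with kernel \<open>k\<close> on \<open>L\<^sup>2(M)\<close>:
  the sum over \<open>n\<close> of \<open>z\<^sup>n / n!\<close> times the integral of \<open>det (k (x\<^sub>i) (x\<^sub>j))\<^sub>i\<^sub>,\<^sub>j\<^sub><\<^sub>n\<close> over \<open>M\<^sup>n\<close>.
\<close>

definition fredholm_det :: "'a measure \<Rightarrow> ('a \<Rightarrow> 'a \<Rightarrow> real) \<Rightarrow> real \<Rightarrow> real" where
  "fredholm_det M k z =
     (\<Sum>n. z ^ n / fact n *
        (LINT x|(\<Pi>\<^sub>M i\<in>{..<n}. M). Determinant.det (mat n n (\<lambda>(i, j). k (x i) (x j)))))"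

text \<open>\<open>det (I + z S\<^sub>c)\<close>\<close>

definition sinc_det :: "real \<Rightarrow> real \<Rightarrow> real" where
  "sinc_det c z = fredholm_det (lborel_ivl c) sinc_kernel z"

text \<open>
  The two assertions with their constants as arguments. The operator exists only for \<open>c > 0\<close>, hence
  this guard next to \<open>c \<ge> c\<^sub>T\<close> and \<open>c \<ge> c\<^sub>0\<close>.
\<close>

definition T_with :: "real \<Rightarrow> real \<Rightarrow> real \<Rightarrow> real \<Rightarrow> bool" where
  "T_with \<alpha> \<kappa>\<^sub>T L\<^sub>T c\<^sub>T \<longleftrightarrow> \<kappa>\<^sub>T > 0 \<and>
     (\<forall>c u. c > 0 \<and> c \<ge> c\<^sub>T \<and> L\<^sub>T \<le> u \<and> u \<le> \<alpha> * ln c \<longrightarrow>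
        ln (sinc_det c (exp u - 1)) \<ge> u * c + \<kappa>\<^sub>T * u\<^sup>2 * ln c)"

definition T_assertion :: "real \<Rightarrow> bool" where
  "T_assertion \<alpha> \<longleftrightarrow> (\<exists>\<kappa>\<^sub>T L\<^sub>T c\<^sub>T. T_with \<alpha> \<kappa>\<^sub>T L\<^sub>T c\<^sub>T)"

definition BRIDGE_with :: "real \<Rightarrow> real \<Rightarrow> real \<Rightarrow> real \<Rightarrow> real \<Rightarrow> bool" where
  "BRIDGE_with \<alpha> \<delta>\<^sub>0 \<kappa> C c\<^sub>0 \<longleftrightarrow> 0 < \<delta>\<^sub>0 \<and> \<delta>\<^sub>0 < 1 / 2 \<and> \<kappa> > 0 \<and>
     (\<forall>c \<delta>. c > 0 \<and> c \<ge> c\<^sub>0 \<and> c powr (- \<alpha>) \<le> \<delta> \<and> \<delta> \<le> \<delta>\<^sub>0 \<longrightarrow>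
        (let L = ln (1 / \<delta>)
         in real (D_count \<delta> c) \<ge> \<kappa> * L * ln (\<alpha> * c / L) - C))"

definition BRIDGE_assertion :: "real \<Rightarrow> bool" where
  "BRIDGE_assertion \<alpha> \<longleftrightarrow> (\<exists>\<delta>\<^sub>0 \<kappa> C c\<^sub>0. BRIDGE_with \<alpha> \<delta>\<^sub>0 \<kappa> C c\<^sub>0)"

end

theory Submission
  imports Defs "HOL-Probability.Sinc_Integral" "HOL-Complex_Analysis.Great_Picard"
begin

text \<open>
  Both assertions concern the eigenvalues \<open>\<lambda>\<^sub>n\<close> of \<open>S\<^sub>c\<close>. By Mercer's theorem
  \<open>\<Sum>\<^sub>n \<lambda>\<^sub>n = c\<close> and \<open>det (I + z S\<^sub>c) = \<Prod>\<^sub>n (1 + z \<lambda>\<^sub>n)\<close>, so \<open>ln det (I + (e\<^sup>u - 1) S\<^sub>c) - u c\<close> is the sum over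
  \<open>n\<close> of \<open>g (\<lambda>\<^sub>n)\<close>, where \<open>g (l) = ln (1 + (e\<^sup>u - 1) l) - u l\<close> is nonnegative on \<open>[0, 1]\<close>.

  Keeping only the eigenvalues in \<open>(e\<^sup>-\<^sup>u\<^sup>/\<^sup>2, 1/2]\<close>, where \<open>g \<ge> u/4\<close>, gives \<open>T\<close> from \<open>BRIDGE\<close>. Conversely, for
  \<open>u = L/2\<close> one has \<open>g \<le> 2 u \<lambda> (1 - \<lambda>)\<close> above \<open>1/2\<close>, \<open>g \<le> u\<close> on \<open>(\<delta>, 1/2]\<close> and \<open>g \<le> 2 \<delta>\<^sup>-\<^sup>1\<^sup>/\<^sup>2 \<lambda> (1 - \<lambda>)\<close> below \<open>\<delta>\<close>,
  so \<open>BRIDGE\<close> follows from \<open>T\<close> and the bound \<open>\<Sum> \<lambda> (1 - \<lambda>) = O (\<delta>\<^sup>1\<^sup>/\<^sup>2 ln c)\<close> over the eigenvalues with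
  \<open>\<lambda> (1 - \<lambda>) \<le> \<delta>\<close>.

  For that bound, \<open>S\<^sub>c - S\<^sub>c\<^sup>2 = A\<^sup>* A\<close>, where \<open>A\<close> has the kernel \<open>sin (\<pi> (x - y)) / (\<pi> (x - y))\<close> with \<open>y\<close> inside and
  \<open>x\<close> outside \<open>(0, c)\<close>. On a cell of \<open>x\<close> at distance \<open>s\<close> from the interval and of length \<open>(1 + s) / m\<close> the kernel is
  close to a kernel of rank two, and \<open>O (m ln c)\<close> cells in geometric progression suffice: \<open>A\<close> is within
  \<open>O (ln c / m\<^sup>2)\<close>, in squared Hilbert--Schmidt norm, of rank \<open>O (m ln c)\<close>. Take \<open>m \<approx> \<delta>\<^sup>-\<^sup>1\<^sup>/\<^sup>2\<close>.
\<close>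

section \<open>Spectral theorem for positive compact operators\<close>

text \<open>The obstacle is that \<delta> may be as small as a power of c. Small eigenvalues enter
  with the factor e^u, so the familiar bound O(ln c) for the sum of \<lambda> (1 - \<lambda>) is too
  weak for them; a bound decaying in \<delta> has to compensate. With m about \<delta>^(-1/2) the
  Hilbert--Schmidt remainder is O(\<delta> ln c), and \<delta> times the rank is O(\<delta>^(1/2) ln
  c), just what e^u = \<delta>^(-1/2) consumes. This is why u is L/2 and not L. All errors are then
  O(u ln c), one factor u short of the gain of order u^2 ln c, and a small
  \<open>\<delta>\<^sub>0\<close> absorbs them. The constant 1/8 consists of three halves: absorbing
  the errors, u = L/2, and ln (\<alpha> c / L) \<le> 2 ln c. The constant 1/32 is the 1/4 of the
  excess times three halves: L = u/2, ln (\<alpha> c / L) \<ge> (ln c) / 2, and absorbing C. The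
  eigenvalues are defined by counting in complex L^2, whereas the analysis runs on real bounded
  continuous functions; a separate argument identifies the two lists.\<close>

locale semi_inner =
  fixes ip :: "'a::real_vector \<Rightarrow> 'a \<Rightarrow> real"
  assumes ip_sym: "ip x y = ip y x"
    and ip_add_left: "ip (x + y) z = ip x z + ip y z"
    and ip_scale_left: "ip (r *\<^sub>R x) z = r * ip x z"
    and ip_nonneg: "0 \<le> ip x x"
begin

lemma ip_add_right: "ip z (x + y) = ip z x + ip z y"
  by (metis ip_add_left ip_sym)

lemma ip_scale_right: "ip z (r *\<^sub>R x) = r * ip z x"
  by (metis ip_scale_left ip_sym)

lemma ip_zero_left [simp]: "ip 0 z = 0"
  using ip_scale_left [of 0 0 z] by simp

lemma ip_zero_right [simp]: "ip z 0 = 0"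
  by (metis ip_zero_left ip_sym)

lemma ip_minus_left: "ip (- x) z = - ip x z"
  using ip_scale_left [of "-1" x z] by simp

lemma ip_minus_right: "ip z (- x) = - ip z x"
  by (metis ip_minus_left ip_sym)

lemma ip_diff_left: "ip (x - y) z = ip x z - ip y z"
  using ip_add_left [of x "- y" z] by (simp add: ip_minus_left)

lemma ip_diff_right: "ip z (x - y) = ip z x - ip z y"
  by (metis ip_diff_left ip_sym)

lemma ip_sum_left: "ip (sum f I) z = (\<Sum>i\<in>I. ip (f i) z)"
  by (induction I rule: infinite_finite_induct) (auto simp: ip_add_left)

lemma ip_sum_right: "ip z (sum f I) = (\<Sum>i\<in>I. ip z (f i))"
  by (induction I rule: infinite_finite_induct) (auto simp: ip_add_right)

lemmas ip_simps = ip_add_left ip_add_right ip_scale_left ip_scale_right ip_diff_left ip_diff_right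
  ip_minus_left ip_minus_right

lemma Cauchy_Schwarz: "(ip x y)\<^sup>2 \<le> ip x x * ip y y"
proof -
  have *: "0 \<le> a\<^sup>2 * ip x x + 2 * a * b * ip x y + b\<^sup>2 * ip y y" for a b
    using ip_nonneg [of "a *\<^sub>R x + b *\<^sub>R y"] ip_sym [of y x]
    by (simp add: ip_simps power2_eq_square algebra_simps)
  show ?thesis
  proof (cases "ip y y = 0")
    case True
    have "ip x y = 0"
    proof (rule ccontr)
      assume "ip x y \<noteq> 0"
      then show False
        \<comment> \<open>For null \<open>y\<close> the form is affine in \<open>b\<close>; this
          choice of \<open>b\<close> makes it equal to -1.\<close>
        using *[of 1 "- (ip x x + 1) / (2 * ip x y)"] True by (simp add: field_simps)
    qed
    then show ?thesis by (simp add: True)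
  next
    case False
    then have "0 < ip y y" using ip_nonneg [of y] by simp
    then show ?thesis
      using *[of "ip y y" "- ip x y"]
      by (simp add: power2_eq_square algebra_simps)
  qed
qed

lemma ip_eq_0_left: "ip x x = 0 \<Longrightarrow> ip x y = 0"
  using Cauchy_Schwarz [of x y] by simp

text \<open>The parallelogram law with one diagonal dropped; together with \<open>ip_diff_le\<close>
  it stands in for the triangle inequality, without square roots.\<close>

lemma ip_add_le: "ip (x + y) (x + y) \<le> 2 * ip x x + 2 * ip y y"
  using ip_nonneg [of "x - y"] ip_sym [of y x] by (simp add: ip_simps)

lemma ip_diff_le: "ip (x - y) (x - y) \<le> 2 * ip x x + 2 * ip y y"
  using ip_nonneg [of "x + y"] ip_sym [of y x] by (simp add: ip_simps)

lemma ip_tendsto_0_diff: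
  assumes "(\<lambda>n. ip (f n) (f n)) \<longlonglongrightarrow> 0" "(\<lambda>n. ip (g n) (g n)) \<longlonglongrightarrow> 0"
  shows "(\<lambda>n. ip (f n - g n) (f n - g n)) \<longlonglongrightarrow> 0"
proof (rule tendsto_sandwich [OF _ _ tendsto_const])
  show "(\<lambda>n. 2 * ip (f n) (f n) + 2 * ip (g n) (g n)) \<longlonglongrightarrow> 0"
    using tendsto_add [OF tendsto_mult_left [OF assms(1), of 2] tendsto_mult_left [OF assms(2), of 2]]
    by simp
qed (simp_all add: ip_diff_le ip_nonneg)

text \<open>The space need not be complete, nor the form definite. Compactness supplies the limits,
  and because \<open>A\<close> sends null vectors to 0 itself, an identity valid up to null vectors
  becomes exact after one application of \<open>A\<close>.\<close>

definition pos_compact :: "('a \<Rightarrow> 'a) \<Rightarrow> bool" where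
  "pos_compact A \<longleftrightarrow> linear A \<and> (\<forall>x y. ip (A x) y = ip x (A y)) \<and> (\<forall>x. 0 \<le> ip (A x) x) \<and>
     (\<forall>x. ip x x = 0 \<longrightarrow> A x = 0) \<and> (\<exists>B. \<forall>x. ip (A x) (A x) \<le> B * ip x x) \<and>
     (\<forall>X. (\<forall>n::nat. ip (X n) (X n) \<le> 1) \<longrightarrow>
        (\<exists>k y. strict_mono k \<and> (\<lambda>n. ip (A (X (k n)) - y) (A (X (k n)) - y)) \<longlonglongrightarrow> 0))"

lemma pos_compactD:
  assumes "pos_compact A"
  shows "linear A" "ip (A x) y = ip x (A y)" "0 \<le> ip (A x) x" "ip x x = 0 \<Longrightarrow> A x = 0"
  using assms unfolding pos_compact_def by blast+

lemma pos_compact_form: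
  assumes "pos_compact A"
  shows "semi_inner (\<lambda>x y. ip (A x) y)"
proof -
  note D = pos_compactD [OF assms]
  interpret A: linear A by (rule D(1))
  show ?thesis
    by unfold_locales (use D(2,3) in \<open>auto simp: A.add A.scaleR ip_simps ip_sym\<close>)
qed

text \<open>The dummy pair \<open>\<mu> = 0\<close>, \<open>g = 0\<close> lets the deflation run
  forever even if the positive eigenvalues are exhausted after finitely many steps.\<close>

definition top_eigen :: "('a \<Rightarrow> 'a) \<Rightarrow> real \<Rightarrow> 'a \<Rightarrow> bool" where
  "top_eigen A \<mu> g \<longleftrightarrow> 0 \<le> \<mu> \<and> A g = \<mu> *\<^sub>R g \<and> (\<forall>x. ip (A x) x \<le> \<mu> * ip x x) \<and>
     ip g g = (if \<mu> > 0 then 1 else 0) \<and> (\<mu> = 0 \<longrightarrow> g = 0)"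

text \<open>Along a maximizing sequence \<open>f n\<close> of the form on the unit ball,
  \<open>A (f n) - \<mu> *\<^sub>R f n\<close> tends to 0, while compactness makes
  \<open>A (f n)\<close> converge to some \<open>y\<close>. The eigenvector is \<open>A y\<close>
  rather than \<open>y\<close>, since the difference of \<open>\<mu> *\<^sub>R y\<close> and
  \<open>A y\<close> is only known to be null.\<close>

lemma top_eigen_exists:
  assumes "pos_compact A"
  shows "\<exists>\<mu> g. top_eigen A \<mu> g"
proof -
  note D = pos_compactD [OF assms]
  interpret A: linear A by (rule D(1))
  interpret F: semi_inner "\<lambda>x y. ip (A x) y" by (rule pos_compact_form [OF assms])
  obtain B where B: "\<And>x. ip (A x) (A x) \<le> B * ip x x"
    using assms unfolding pos_compact_def by blast
  define S where "S = (\<lambda>x. ip (A x) x) ` {x. ip x x \<le> 1}"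
  have S0: "0 \<in> S"
    unfolding S_def by (rule image_eqI [of _ _ 0]) (auto simp: A.zero)
  have bdd: "bdd_above S"
  proof (rule bdd_aboveI)
    fix s assume "s \<in> S"
    then obtain x where x: "s = ip (A x) x" "ip x x \<le> 1" by (auto simp: S_def)
    have "s\<^sup>2 \<le> ip (A x) (A x) * ip x x" unfolding x(1) by (rule Cauchy_Schwarz)
    also have "\<dots> \<le> ip (A x) (A x) * 1"
      by (rule mult_left_mono) (use x ip_nonneg in auto)
    also have "\<dots> \<le> B * ip x x" using B by simp
    also have "\<dots> \<le> \<bar>B\<bar> * 1"
      by (rule mult_mono) (use x ip_nonneg in auto)
    also have "\<dots> = \<bar>B\<bar>" by simp
    finally have "s\<^sup>2 \<le> \<bar>B\<bar>" .
    then show "s \<le> sqrt \<bar>B\<bar>" by (rule real_le_rsqrt)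
  qed
  define \<mu> where "\<mu> = Sup S"
  have \<mu>0: "0 \<le> \<mu>" unfolding \<mu>_def by (rule cSup_upper [OF S0 bdd])
  have le: "ip (A x) x \<le> \<mu> * ip x x" for x
  proof (cases "ip x x = 0")
    case True
    then show ?thesis using D(4) [of x] by simp
  next
    case False
    then have p: "0 < ip x x" using ip_nonneg [of x] by simp
    define r where "r = 1 / sqrt (ip x x)"
    have r2: "r * (r * ip x x) = 1" using p by (simp add: r_def field_simps)
    have "ip (A (r *\<^sub>R x)) (r *\<^sub>R x) \<in> S"
      unfolding S_def by (rule imageI) (simp add: ip_simps r2)
    then have "r * (r * ip (A x) x) \<le> \<mu>"
      unfolding \<mu>_def using cSup_upper [OF _ bdd] by (auto simp: A.scaleR ip_simps)
    then show ?thesis using p by (simp add: r_def field_simps)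
  qed
  show ?thesis
  proof (cases "\<mu> = 0")
    case True
    then show ?thesis using le by (intro exI[of _ 0] exI[of _ 0]) (auto simp: top_eigen_def A.zero)
  next
    case False
    with \<mu>0 have \<mu>: "0 < \<mu>" by simp
    have "\<exists>x. ip x x \<le> 1 \<and> \<mu> - 1 / real (Suc n) < ip (A x) x" for n
      using less_cSupD [of S "\<mu> - 1 / real (Suc n)"] S0 unfolding \<mu>_def S_def by fastforce
    then obtain X where X: "\<And>n. ip (X n) (X n) \<le> 1" "\<And>n. \<mu> - 1 / real (Suc n) < ip (A (X n)) (X n)"
      by metis
    then obtain k y where k: "strict_mono k"
      and y: "(\<lambda>n. ip (A (X (k n)) - y) (A (X (k n)) - y)) \<longlonglongrightarrow> 0"
      using assms unfolding pos_compact_def by metis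
    define f where "f = (\<lambda>n. X (k n))"
    define \<alpha> where "\<alpha> = (\<lambda>n. ip (A (f n)) (f n))"
    have f1: "ip (f n) (f n) \<le> 1" for n by (simp add: f_def X)
    have \<alpha>le: "\<alpha> n \<le> \<mu>" for n
      using order_trans [OF le mult_left_mono [OF f1 \<mu>0]] by (simp add: \<alpha>_def)
    have "(\<lambda>n. 1 / real (Suc n)) \<longlonglongrightarrow> 0"
      using LIMSEQ_inverse_real_of_nat by (simp add: inverse_eq_divide)
    from tendsto_diff [OF tendsto_const this, of \<mu>]
    have "(\<lambda>n. \<mu> - 1 / real (Suc (k n))) \<longlonglongrightarrow> \<mu>"
      using LIMSEQ_subseq_LIMSEQ [OF _ k, of "\<lambda>n. \<mu> - 1 / real (Suc n)"] by (simp add: o_def)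
    then have \<alpha>lim: "\<alpha> \<longlonglongrightarrow> \<mu>"
      by (rule tendsto_sandwich [rotated 2, OF _ tendsto_const])
         (use \<alpha>le less_imp_le [OF X(2)] in \<open>simp_all add: \<alpha>_def f_def\<close>)
    define d where "d = (\<lambda>n. A (f n) - \<mu> *\<^sub>R f n)"
    \<comment> \<open>Cauchy--Schwarz for the form of \<open>A\<close>, at \<open>f n\<close> and
      \<open>A (f n)\<close>, bounds \<open>ip (A (f n)) (A (f n))\<close> by
      \<open>\<mu> * \<alpha> n\<close>; expanding the square then leaves at most \<mu> \<alpha> - 2
      \<mu> \<alpha> + \<mu>^2.\<close>
    have d: "ip (d n) (d n) \<le> \<mu> * (\<mu> - \<alpha> n)" for n
    proof -
      have "(ip (A (f n)) (A (f n)))\<^sup>2 \<le> \<alpha> n * ip (A (A (f n))) (A (f n))"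
        unfolding \<alpha>_def by (rule F.Cauchy_Schwarz)
      also have "\<dots> \<le> \<alpha> n * (\<mu> * ip (A (f n)) (A (f n)))"
        by (rule mult_left_mono [OF le]) (use D(3) in \<open>simp add: \<alpha>_def\<close>)
      finally have "ip (A (f n)) (A (f n)) \<le> \<mu> * \<alpha> n"
        using ip_nonneg [of "A (f n)"] D(3) [of "f n"] \<mu>
        by (cases "ip (A (f n)) (A (f n)) = 0")
           (auto simp: \<alpha>_def power2_eq_square mult_ac)
      moreover have "\<mu>\<^sup>2 * ip (f n) (f n) \<le> \<mu>\<^sup>2 * 1"
        by (rule mult_left_mono [OF f1]) simp
      ultimately show ?thesis
        by (simp add: d_def ip_simps \<alpha>_def ip_sym [of "f n" "A (f n)"] power2_eq_square algebra_simps)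
    qed
    have "(\<lambda>n. \<mu> * (\<mu> - \<alpha> n)) \<longlonglongrightarrow> \<mu> * (\<mu> - \<mu>)"
      by (intro tendsto_intros \<alpha>lim)
    then have "(\<lambda>n. \<mu> * (\<mu> - \<alpha> n)) \<longlonglongrightarrow> 0" by simp
    then have dlim: "(\<lambda>n. ip (d n) (d n)) \<longlonglongrightarrow> 0"
      by (rule tendsto_sandwich [OF _ _ tendsto_const, rotated 2]) (simp_all add: ip_nonneg d)
    have e: "(\<lambda>n. ip (A (f n) - y) (A (f n) - y)) \<longlonglongrightarrow> 0" using y by (simp add: f_def)
    have h: "(\<lambda>n. ip (\<mu> *\<^sub>R f n - y) (\<mu> *\<^sub>R f n - y)) \<longlonglongrightarrow> 0"
      using ip_tendsto_0_diff [OF e dlim] by (simp add: d_def)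
    have "(\<lambda>n. B * ip (\<mu> *\<^sub>R f n - y) (\<mu> *\<^sub>R f n - y)) \<longlonglongrightarrow> 0"
      using tendsto_mult_left [OF h, of B] by simp
    then have Ah: "(\<lambda>n. ip (A (\<mu> *\<^sub>R f n - y)) (A (\<mu> *\<^sub>R f n - y))) \<longlonglongrightarrow> 0"
      by (rule tendsto_sandwich [OF _ _ tendsto_const, rotated 2]) (simp_all add: ip_nonneg B)
    have "(\<lambda>n. \<mu>\<^sup>2 * ip (A (f n) - y) (A (f n) - y)) \<longlonglongrightarrow> 0"
      using tendsto_mult_left [OF e, of "\<mu>\<^sup>2"] by simp
    moreover have "\<mu>\<^sup>2 * ip (A (f n) - y) (A (f n) - y)
        = ip (\<mu> *\<^sub>R (A (f n) - y)) (\<mu> *\<^sub>R (A (f n) - y))" for n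
      by (simp only: ip_scale_left ip_scale_right power2_eq_square mult.assoc)
    ultimately have e': "(\<lambda>n. ip (\<mu> *\<^sub>R (A (f n) - y)) (\<mu> *\<^sub>R (A (f n) - y))) \<longlonglongrightarrow> 0" by simp
    \<comment> \<open>The right side does not depend on \<open>n\<close>, and both terms on the left
      tend to 0 in the form.\<close>
    have eq: "A (\<mu> *\<^sub>R f n - y) - \<mu> *\<^sub>R (A (f n) - y) = \<mu> *\<^sub>R y - A y" for n
      by (simp add: A.diff A.scaleR algebra_simps)
    have z: "ip (\<mu> *\<^sub>R y - A y) (\<mu> *\<^sub>R y - A y) = 0"
      using ip_tendsto_0_diff [OF Ah e'] unfolding eq by (simp add: tendsto_const_iff)
    from D(4) [OF z] have Ag: "A (A y) = \<mu> *\<^sub>R A y" by (simp add: A.diff A.scaleR)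
    \<comment> \<open>Otherwise \<open>y\<close> would be null, and
      \<open>\<mu> *\<^sub>R f n\<close>, which tends to \<open>y\<close>, would tend to 0, against
      \<open>\<alpha> n\<close> tending to \<open>\<mu> > 0\<close>.\<close>
    have "ip (A y) (A y) \<noteq> 0"
    proof
      assume A0: "ip (A y) (A y) = 0"
      have "\<mu>\<^sup>2 * ip y y = ip ((\<mu> *\<^sub>R y - A y) + A y) ((\<mu> *\<^sub>R y - A y) + A y)"
        by (simp add: ip_simps power2_eq_square)
      also have "\<dots> \<le> 0"
        using ip_add_le [of "\<mu> *\<^sub>R y - A y" "A y"] z A0 by linarith
      finally have "ip y y = 0"
        using \<mu> ip_nonneg [of y] mult_pos_pos[of "\<mu>\<^sup>2" "ip y y"] by fastforce
      then have y0: "ip y w = 0" "ip w y = 0" for w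
        using ip_eq_0_left [of y w] ip_sym [of w y] by auto
      have "(\<lambda>n. \<mu>\<^sup>2 * ip (f n) (f n)) \<longlonglongrightarrow> 0"
        using h by (simp add: ip_simps y0 power2_eq_square mult.assoc)
      from tendsto_mult_left [OF this, of "1 / \<mu>"] \<mu> have "(\<lambda>n. \<mu> * ip (f n) (f n)) \<longlonglongrightarrow> 0"
        by (simp add: power2_eq_square)
      then have "\<mu> \<le> 0"
        using \<alpha>lim le [of "f _"] by (intro LIMSEQ_le [of \<alpha> \<mu> "\<lambda>n. \<mu> * ip (f n) (f n)" 0]) (auto simp: \<alpha>_def)
      with \<mu> show False by simp
    qed
    with ip_nonneg [of "A y"] have p: "0 < ip (A y) (A y)" by simp
    define g where "g = (1 / sqrt (ip (A y) (A y))) *\<^sub>R A y"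
    have "A g = \<mu> *\<^sub>R g" by (simp add: g_def A.scaleR Ag)
    moreover have "ip g g = 1" using p by (simp add: g_def ip_simps field_simps)
    ultimately show ?thesis using \<mu> le by (auto simp: top_eigen_def)
  qed
qed

text \<open>On an eigenvector \<open>g\<close> this is \<open>A\<close> minus its rank-one part at
  \<open>g\<close>. Written as \<open>A\<close> after a projection, it inherits boundedness and
  compactness at once.\<close>

definition deflate :: "('a \<Rightarrow> 'a) \<Rightarrow> 'a \<Rightarrow> 'a \<Rightarrow> 'a" where
  "deflate A g x = A (x - ip x g *\<^sub>R g)"

lemma pos_compact_deflate:
  assumes A: "pos_compact A" and g: "top_eigen A \<mu> g"
  shows "pos_compact (deflate A g)"
proof -
  note D = pos_compactD [OF A]
  interpret A: linear A by (rule D(1))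
  interpret F: semi_inner "\<lambda>x y. ip (A x) y" by (rule pos_compact_form [OF A])
  have Ag: "A g = \<mu> *\<^sub>R g" and \<mu>0: "0 \<le> \<mu>" using g by (auto simp: top_eigen_def)
  have eq: "deflate A g x = A x - (\<mu> * ip x g) *\<^sub>R g" for x
    by (simp add: deflate_def A.diff A.scaleR Ag)
  have P: "ip (x - ip x g *\<^sub>R g) (x - ip x g *\<^sub>R g) \<le> ip x x" for x
    using g by (auto simp: ip_simps top_eigen_def ip_sym [of g x] algebra_simps)
  \<comment> \<open>Cauchy--Schwarz for the form of \<open>A\<close> between \<open>x\<close> and
    \<open>g\<close>, where \<open>ip (A x) g = \<mu> * ip x g\<close>: the part removed is no
    larger than \<open>ip (A x) x\<close>.\<close>
  have nonneg: "0 \<le> ip (deflate A g x) x" for x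
  proof (cases "\<mu> = 0")
    case True
    then show ?thesis using D(3) [of x] by (simp add: eq)
  next
    case False
    then have "0 < \<mu>" "ip g g = 1" using g \<mu>0 by (auto simp: top_eigen_def)
    moreover have "(ip (A x) g)\<^sup>2 \<le> ip (A x) x * ip (A g) g" by (rule F.Cauchy_Schwarz)
    moreover have "ip (A x) g = \<mu> * ip x g" by (simp add: D(2) Ag ip_simps)
    ultimately have "\<mu> * (\<mu> * (ip x g)\<^sup>2) \<le> \<mu> * ip (A x) x"
      by (simp add: Ag ip_simps power2_eq_square algebra_simps)
    then show ?thesis using \<open>0 < \<mu>\<close>
      by (simp add: eq ip_simps ip_sym [of g x] power2_eq_square mult.assoc)
  qed
  show ?thesis unfolding pos_compact_def
  proof (intro conjI allI impI)
    show "linear (deflate A g)"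
      by (rule linearI) (auto simp: eq A.add A.scaleR ip_simps algebra_simps)
    show "ip (deflate A g x) y = ip x (deflate A g y)" for x y
      by (simp add: eq ip_simps D(2) ip_sym [of g y])
    show "deflate A g x = 0" if "ip x x = 0" for x
      using that P [of x] ip_nonneg [of "x - ip x g *\<^sub>R g"] D(4) by (simp add: deflate_def)
    obtain B where B: "\<And>x. ip (A x) (A x) \<le> B * ip x x"
      using A unfolding pos_compact_def by blast
    have "ip (deflate A g x) (deflate A g x) \<le> \<bar>B\<bar> * ip x x" for x
    proof -
      have "ip (deflate A g x) (deflate A g x) \<le> B * ip (x - ip x g *\<^sub>R g) (x - ip x g *\<^sub>R g)"
        unfolding deflate_def by (rule B)
      also have "\<dots> \<le> \<bar>B\<bar> * ip x x"
        by (rule mult_mono) (use P ip_nonneg in auto)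
      finally show ?thesis .
    qed
    then show "\<exists>B. \<forall>x. ip (deflate A g x) (deflate A g x) \<le> B * ip x x" by blast
    fix X :: "nat \<Rightarrow> 'a" assume X: "\<forall>n. ip (X n) (X n) \<le> 1"
    define Y where "Y = (\<lambda>n. X n - ip (X n) g *\<^sub>R g)"
    have "\<forall>n. ip (Y n) (Y n) \<le> 1" unfolding Y_def using P X by (meson order_trans)
    moreover have "\<forall>X. (\<forall>n::nat. ip (X n) (X n) \<le> 1) \<longrightarrow>
        (\<exists>k y. strict_mono k \<and> (\<lambda>n. ip (A (X (k n)) - y) (A (X (k n)) - y)) \<longlonglongrightarrow> 0)"
      using A unfolding pos_compact_def by (elim conjE) assumption
    ultimately show "\<exists>k y. strict_mono k \<and>
        (\<lambda>n. ip (deflate A g (X (k n)) - y) (deflate A g (X (k n)) - y)) \<longlonglongrightarrow> 0"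
      unfolding deflate_def Y_def by (elim allE [of _ "\<lambda>n. X n - ip (X n) g *\<^sub>R g"]) simp
  next
    show "0 \<le> ip (deflate A g x) x" for x by (rule nonneg)
  qed
qed

text \<open>Repeated deflation. The last clause bounds what is left of the form after
  \<open>n\<close> eigenvectors and takes the place of their completeness.\<close>

theorem spectral_pos_compact:
  assumes A: "pos_compact A"
  obtains ev \<phi> where "\<And>n. 0 \<le> ev n" "decseq ev" "\<And>n. A (\<phi> n) = ev n *\<^sub>R \<phi> n"
    "\<And>n m. ip (\<phi> n) (\<phi> m) = (if n = m \<and> 0 < ev n then 1 else 0)"
    "\<And>n. ev n = 0 \<Longrightarrow> \<phi> n = 0"
    "\<And>n x. ip (A x) x - (\<Sum>m<n. ev m * (ip x (\<phi> m))\<^sup>2) \<le> ev n * ip x x"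
proof -
  define sel where "sel = (\<lambda>A. SOME p. top_eigen A (fst p) (snd p))"
  have sel: "top_eigen A (fst (sel A)) (snd (sel A))" if "pos_compact A" for A
    unfolding sel_def by (rule someI_ex) (use top_eigen_exists [OF that] in auto)
  define T where "T = rec_nat A (\<lambda>_ B. deflate B (snd (sel B)))"
  define ev where "ev = (\<lambda>n. fst (sel (T n)))"
  define \<phi> where "\<phi> = (\<lambda>n. snd (sel (T n)))"
  have T0: "T 0 = A" by (simp add: T_def)
  have TS: "T (Suc n) x = T n (x - ip x (\<phi> n) *\<^sub>R \<phi> n)" for n x
    by (simp add: T_def \<phi>_def deflate_def)
  have T: "pos_compact (T n)" for n
    by (induction n) (auto simp: T_def A intro: pos_compact_deflate [OF _ sel])
  have te: "top_eigen (T n) (ev n) (\<phi> n)" for n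
    unfolding ev_def \<phi>_def by (rule sel [OF T])
  have lin: "linear (T n)" for n using T pos_compactD(1) by blast
  have sym: "ip (T n x) y = ip x (T n y)" for n x y using T pos_compactD(2) by blast
  have ev0: "0 \<le> ev n" and T\<phi>: "T n (\<phi> n) = ev n *\<^sub>R \<phi> n" and Tle: "ip (T n x) x \<le> ev n * ip x x"
    and norm1: "ip (\<phi> n) (\<phi> n) = (if 0 < ev n then 1 else 0)" and \<phi>0: "ev n = 0 \<Longrightarrow> \<phi> n = 0" for n x
    using te [of n] by (auto simp: top_eigen_def)
  have TSx: "T (Suc n) x = T n x - (ev n * ip x (\<phi> n)) *\<^sub>R \<phi> n" for n x
    by (simp add: TS linear_diff [OF lin] linear_scale [OF lin] T\<phi>)
  have Tform: "T n x = A x - (\<Sum>m<n. (ev m * ip x (\<phi> m)) *\<^sub>R \<phi> m)" for n x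
    by (induction n) (auto simp: T0 TSx algebra_simps)
  \<comment> \<open>Once \<open>T n\<close> annihilates \<open>\<phi> m\<close>, symmetry gives
    \<open>ev n * ip (\<phi> m) (\<phi> n) = 0\<close>; if \<open>ev n = 0\<close>, then
    \<open>\<phi> n\<close> is 0 by convention.\<close>
  have orth: "T n (\<phi> m) = 0 \<and> ip (\<phi> m) (\<phi> n) = 0" if "m < n" for m n
    using that
  proof (induction n)
    case (Suc n)
    have "T (Suc n) (\<phi> m) = 0"
    proof (cases "m = n")
      case True
      then show ?thesis
        using norm1 [of n] \<phi>0 [of n] ev0 [of n] by (auto simp: TSx T\<phi>)
    next
      case False
      with Suc have "T n (\<phi> m) = 0" "ip (\<phi> m) (\<phi> n) = 0" by auto
      then show ?thesis by (simp add: TSx)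
    qed
    moreover from this have "ev (Suc n) * ip (\<phi> m) (\<phi> (Suc n)) = 0"
      using sym [of "Suc n" "\<phi> m" "\<phi> (Suc n)"] by (simp add: T\<phi> ip_simps)
    then have "ip (\<phi> m) (\<phi> (Suc n)) = 0" using \<phi>0 [of "Suc n"] by auto
    ultimately show ?case by blast
  qed simp
  show thesis
  proof (rule that [of ev \<phi>])
    show "0 \<le> ev n" for n by (rule ev0)
    show on: "ip (\<phi> n) (\<phi> m) = (if n = m \<and> 0 < ev n then 1 else 0)" for n m
      using orth [of n m] orth [of m n] norm1 [of n] ip_sym [of "\<phi> m" "\<phi> n"]
      by (cases n m rule: linorder_cases) auto
    show "A (\<phi> n) = ev n *\<^sub>R \<phi> n" for n
      using Tform [of n "\<phi> n"] by (simp add: T\<phi> on)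
    show "decseq ev"
    proof (rule decseq_SucI)
      fix n
      \<comment> \<open>\<open>\<phi> (Suc n)\<close> is orthogonal to \<open>\<phi> n\<close>, so
        \<open>T n\<close> and \<open>T (Suc n)\<close> have the same form on it, and it already
        competes in the maximum \<open>ev n\<close>.\<close>
      have "ev (Suc n) * ip (\<phi> (Suc n)) (\<phi> (Suc n)) = ip (T (Suc n) (\<phi> (Suc n))) (\<phi> (Suc n))"
        by (simp add: T\<phi> ip_simps)
      also have "\<dots> = ip (T n (\<phi> (Suc n))) (\<phi> (Suc n))" by (simp add: TSx ip_simps on)
      also have "\<dots> \<le> ev n * ip (\<phi> (Suc n)) (\<phi> (Suc n))" by (rule Tle)
      finally show "ev (Suc n) \<le> ev n" using ev0 [of n] ev0 [of "Suc n"] norm1 [of "Suc n"]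
        by (auto split: if_splits)
    qed
    show "ev n = 0 \<Longrightarrow> \<phi> n = 0" for n by (rule \<phi>0)
    show "ip (A x) x - (\<Sum>m<n. ev m * (ip x (\<phi> m))\<^sup>2) \<le> ev n * ip x x" for n x
    proof -
      have "ip (T n x) x = ip (A x) x - (\<Sum>m<n. ev m * (ip x (\<phi> m))\<^sup>2)"
        unfolding Tform ip_diff_left ip_sum_left ip_scale_left
        using ip_sym [of x] by (simp only: power2_eq_square mult.assoc)
      then show ?thesis using Tle [of n x] by simp
    qed
  qed
qed

lemma Bessel:
  assumes "finite W" and on: "\<And>n m. n \<in> W \<Longrightarrow> m \<in> W \<Longrightarrow> ip (\<phi> n) (\<phi> m) = (if n = m then 1 else 0)"
  shows "(\<Sum>n\<in>W. (ip x (\<phi> n))\<^sup>2) \<le> ip x x"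
proof -
  define p where "p = (\<Sum>n\<in>W. ip x (\<phi> n) *\<^sub>R \<phi> n)"
  have "ip p p = (\<Sum>n\<in>W. \<Sum>m\<in>W. ip x (\<phi> n) * (ip x (\<phi> m) * ip (\<phi> n) (\<phi> m)))"
    unfolding p_def ip_sum_left unfolding ip_sum_right ip_scale_left ip_scale_right
    by (simp only: mult.left_commute)
  also have "\<dots> = (\<Sum>n\<in>W. \<Sum>m\<in>W. if n = m then (ip x (\<phi> n))\<^sup>2 else 0)"
    by (intro sum.cong refl) (auto simp: on power2_eq_square)
  also have "\<dots> = (\<Sum>n\<in>W. (ip x (\<phi> n))\<^sup>2)"
    using assms(1) by (simp add: sum.delta)
  finally have pp: "ip p p = (\<Sum>n\<in>W. (ip x (\<phi> n))\<^sup>2)" .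
  have xp: "ip x p = (\<Sum>n\<in>W. (ip x (\<phi> n))\<^sup>2)"
    by (simp add: p_def ip_sum_right ip_simps power2_eq_square)
  show ?thesis
    using ip_nonneg [of "x - p"] pp xp ip_sym [of p x] by (simp add: ip_simps)
qed

end

section \<open>Orthogonal projections and best approximation\<close>

context semi_inner begin

definition orth_proj :: "nat \<Rightarrow> (nat \<Rightarrow> 'a) \<Rightarrow> 'a \<Rightarrow> 'a" where
  "orth_proj K q x = (\<Sum>j<K. ip x (q j) *\<^sub>R q j)"

lemma ip_orth_proj: "ip y (orth_proj K q x) = (\<Sum>j<K. ip x (q j) * ip y (q j))"
  by (simp add: orth_proj_def ip_sum_right ip_simps)

lemma ip_orth_proj_sym: "ip y (orth_proj K q x) = ip (orth_proj K q y) x"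
  by (subst (2) ip_sym) (simp add: ip_orth_proj mult.commute)

lemma ip_orth_proj_compl:
  assumes on: "\<And>i j. i < K \<Longrightarrow> j < K \<Longrightarrow> ip (q i) (q j) = (if i = j then 1 else 0)" and j: "j < K"
  shows "ip (x - orth_proj K q x) (q j) = 0"
proof -
  have "ip (orth_proj K q x) (q j) = (\<Sum>i<K. if j = i then ip x (q i) else 0)"
    unfolding orth_proj_def ip_sum_left by (intro sum.cong refl) (use on j in \<open>auto simp: ip_simps\<close>)
  also have "\<dots> = ip x (q j)" using j by (simp add: sum.delta')
  finally show ?thesis by (simp add: ip_diff_left)
qed

text \<open>Gram--Schmidt; since the form is only semidefinite, the span is recovered up to null vectors.\<close>

lemma orthonormal_basis_exists:
  "\<exists>K q. K \<le> k \<and> (\<forall>i<K. \<forall>j<K. ip (q i) (q j) = (if i = j then 1 else 0)) \<and>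
     (\<forall>i<k. ip (e i - orth_proj K q (e i)) (e i - orth_proj K q (e i)) = 0)"
proof (induction k)
  case 0
  show ?case by (intro exI[of _ 0]) auto
next
  case (Suc k)
  then obtain K q where K: "K \<le> k" and on: "\<And>i j. i < K \<Longrightarrow> j < K \<Longrightarrow> ip (q i) (q j) = (if i = j then 1 else 0)"
    and sp: "\<And>i. i < k \<Longrightarrow> ip (e i - orth_proj K q (e i)) (e i - orth_proj K q (e i)) = 0"
    by blast
  define r where "r = e k - orth_proj K q (e k)"
  show ?case
  proof (cases "ip r r = 0")
    case True
    then show ?thesis
      by (intro exI[of _ K] exI[of _ q]) (use K on sp in \<open>auto simp: less_Suc_eq r_def\<close>)
  next
    case False
    then have p: "0 < ip r r" using ip_nonneg [of r] by simp
    have rq: "ip r (q j) = 0" "ip (q j) r = 0" if "j < K" for j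
      using ip_orth_proj_compl [OF on that, of "e k"] ip_sym [of r "q j"] by (simp_all add: r_def)
    define q' where "q' = q(K := (1 / sqrt (ip r r)) *\<^sub>R r)"
    have on': "ip (q' i) (q' j) = (if i = j then 1 else 0)" if "i < Suc K" "j < Suc K" for i j
      using that on [of i j] rq p by (auto simp: q'_def less_Suc_eq ip_simps field_simps)
    have proj: "orth_proj (Suc K) q' x = orth_proj K q x + ip x (q' K) *\<^sub>R q' K" for x
      by (simp add: orth_proj_def q'_def)
    have "ip (e i - orth_proj (Suc K) q' (e i)) (e i - orth_proj (Suc K) q' (e i)) = 0" if i: "i < Suc k" for i
    proof (cases "i = k")
      case True
      have "ip (e k) r = ip r r"
      proof -
        have "ip (orth_proj K q (e k)) r = 0"
          by (subst ip_sym) (use rq in \<open>simp add: ip_orth_proj\<close>)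
        then show ?thesis using ip_diff_left [of "e k" "orth_proj K q (e k)" r] by (simp add: r_def)
      qed
      then have "ip (e k) (q' K) *\<^sub>R q' K = r" using p by (simp add: q'_def ip_simps field_simps)
      then show ?thesis using True by (simp add: proj r_def)
    next
      case False
      with i have "i < k" by simp
      define w where "w = e i - orth_proj K q (e i)"
      have w: "ip w y = 0" for y using sp [OF \<open>i < k\<close>] ip_eq_0_left unfolding w_def by blast
      have "ip (orth_proj K q (e i)) (q' K) = 0"
        unfolding orth_proj_def ip_sum_left by (rule sum.neutral) (auto simp: q'_def ip_simps rq)
      then have "ip (e i) (q' K) = 0" using w [of "q' K"] by (simp add: w_def ip_diff_left)
      then show ?thesis using sp [OF \<open>i < k\<close>] by (simp add: proj)
    qed
    with on' K show ?thesis by (intro exI[of _ "Suc K"] exI[of _ q']) auto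
  qed
qed

text \<open>The \<open>q j\<close> span the \<open>e i\<close> only up to null vectors, but null
  vectors are orthogonal to everything, so the residual of the projection is still orthogonal to
  every \<open>e i\<close>.\<close>

lemma orth_proj_best:
  assumes on: "\<And>i j. i < K \<Longrightarrow> j < K \<Longrightarrow> ip (q i) (q j) = (if i = j then 1 else 0)"
    and sp: "\<And>i. i < k \<Longrightarrow> ip (e i - orth_proj K q (e i)) (e i - orth_proj K q (e i)) = 0"
  shows "ip (x - orth_proj K q x) (x - orth_proj K q x) \<le> ip (x - (\<Sum>i<k. b i *\<^sub>R e i)) (x - (\<Sum>i<k. b i *\<^sub>R e i))"
proof -
  define P where "P = x - orth_proj K q x"
  define E where "E = (\<Sum>i<k. b i *\<^sub>R e i)"
  have Pproj: "ip P (orth_proj K q y) = 0" for y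
    unfolding ip_orth_proj using ip_orth_proj_compl [OF on] by (simp add: P_def)
  have "ip P (e i) = 0" if "i < k" for i
  proof -
    have "ip P (e i - orth_proj K q (e i)) = 0"
      by (subst ip_sym) (rule ip_eq_0_left [OF sp [OF that]])
    then show ?thesis by (simp add: ip_diff_right Pproj)
  qed
  then have "ip P E = 0" by (simp add: E_def ip_sum_right ip_simps)
  moreover have "ip P x = ip P P" using Pproj [of x] ip_diff_right [of P x "orth_proj K q x"] by (simp add: P_def)
  ultimately have "ip P (x - E) = ip P P" by (simp add: ip_diff_right)
  with Cauchy_Schwarz [of P "x - E"] have "ip P P * ip P P \<le> ip P P * ip (x - E) (x - E)"
    by (simp add: power2_eq_square)
  then have "ip P P \<le> ip (x - E) (x - E)"
    using ip_nonneg [of P] ip_nonneg [of "x - E"] by (cases "ip P P = 0") auto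
  then show ?thesis by (simp add: P_def E_def)
qed

end

section \<open>The sinc kernel\<close>

definition nsinc :: "real \<Rightarrow> real" where
  "nsinc v = sinc_kernel v 0"

lemma sinc_kernel_nsinc: "sinc_kernel x y = nsinc (x - y)"
  by (simp add: nsinc_def sinc_kernel_def)

lemma nsinc_0 [simp]: "nsinc 0 = 1"
  by (simp add: nsinc_def sinc_kernel_def)

lemma nsinc_neq: "v \<noteq> 0 \<Longrightarrow> nsinc v = sin (pi * v) / (pi * v)"
  by (simp add: nsinc_def sinc_kernel_def)

lemma nsinc_mult: "pi * v * nsinc v = sin (pi * v)"
  by (cases "v = 0") (simp_all add: nsinc_neq)

lemma nsinc_minus [simp]: "nsinc (- v) = nsinc v"
  by (cases "v = 0") (simp_all add: nsinc_neq)

lemma nsinc_commute: "nsinc (x - y) = nsinc (y - x)"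
  using nsinc_minus [of "x - y"] by simp

text \<open>The kernel as an average of cosines: the source of its bound, of its Lipschitz estimate
  and of the positivity of the operator.\<close>

lemma nsinc_cos_integral: "((\<lambda>t. cos (pi * v * t)) has_integral nsinc v) {0..1}"
proof (cases "v = 0")
  case True
  then show ?thesis using has_integral_const_real [of "1::real" 0 1] by simp
next
  case False
  have "((\<lambda>t. cos (pi * v * t)) has_integral
      sin (pi * v * 1) / (pi * v) - sin (pi * v * 0) / (pi * v)) {0..1}"
    by (rule fundamental_theorem_of_calculus)
       (auto intro!: derivative_eq_intros simp: False
             simp flip: has_real_derivative_iff_has_vector_derivative)
  then show ?thesis using False by (simp add: nsinc_neq)
qed

lemma nsinc_abs_le_1: "\<bar>nsinc v\<bar> \<le> 1"
proof -
  have "norm (nsinc v) \<le> 1 * Henstock_Kurzweil_Integration.content (cbox (0::real) 1)"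
    by (rule has_integral_bound [of 1 "\<lambda>t. cos (pi * v * t)"])
       (use nsinc_cos_integral [of v] in auto)
  then show ?thesis by simp
qed

lemma cos_diff_le: "\<bar>cos a - cos b\<bar> \<le> \<bar>a - b\<bar>" for a b :: real
proof -
  have "\<bar>sin ((a + b) / 2)\<bar> * \<bar>sin ((b - a) / 2)\<bar> \<le> 1 * \<bar>(b - a) / 2\<bar>"
    by (rule mult_mono) (use abs_sin_x_le_abs_x [of "(b - a) / 2"] in auto)
  then show ?thesis by (simp add: cos_diff_cos abs_mult abs_minus_commute)
qed

lemma nsinc_Lipschitz: "\<bar>nsinc v - nsinc w\<bar> \<le> pi * \<bar>v - w\<bar>"
proof -
  have "norm (nsinc v - nsinc w) \<le> (pi * \<bar>v - w\<bar>) * Henstock_Kurzweil_Integration.content (cbox (0::real) 1)"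
  proof (rule has_integral_bound)
    show "((\<lambda>t. cos (pi * v * t) - cos (pi * w * t)) has_integral nsinc v - nsinc w) (cbox 0 1)"
      using has_integral_diff [OF nsinc_cos_integral nsinc_cos_integral] by simp
    fix t :: real assume "t \<in> cbox 0 1"
    then have t: "0 \<le> t" "t \<le> 1" by auto
    have "norm (cos (pi * v * t) - cos (pi * w * t)) \<le> \<bar>pi * v * t - pi * w * t\<bar>"
      using cos_diff_le by simp
    also have "\<dots> = pi * \<bar>v - w\<bar> * t"
      using t by (simp add: abs_mult flip: right_diff_distrib left_diff_distrib)
    also have "\<dots> \<le> pi * \<bar>v - w\<bar> * 1" by (rule mult_left_mono) (use t in auto)
    finally show "norm (cos (pi * v * t) - cos (pi * w * t)) \<le> pi * \<bar>v - w\<bar>" by simp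
  qed simp
  then show ?thesis by simp
qed

lemma continuous_nsinc: "continuous_on A nsinc"
proof -
  have "pi-lipschitz_on A nsinc"
    by (rule lipschitz_onI) (auto simp: dist_real_def nsinc_Lipschitz)
  then show ?thesis by (rule lipschitz_on_continuous_on)
qed

lemma continuous_nsinc_comp [continuous_intros]:
  "continuous_on A f \<Longrightarrow> continuous_on A (\<lambda>x. nsinc (f x))"
  by (rule continuous_on_compose2 [OF continuous_nsinc [of UNIV]]) auto

lemma nsinc_abs_le: "\<bar>nsinc v\<bar> \<le> 1 / (pi * \<bar>v\<bar>)"  if "v \<noteq> 0"
  using that by (simp add: nsinc_neq abs_mult divide_simps)

text \<open>A majorant that is harmless at 0 and has the primitive \<open>2 * arctan v\<close>, so
  that integrals over arbitrary intervals are bounded uniformly.\<close>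

lemma nsinc_sq_le: "(nsinc v)\<^sup>2 \<le> 2 / (1 + v\<^sup>2)"
proof (cases "\<bar>v\<bar> \<le> 1")
  case True
  have "(nsinc v)\<^sup>2 \<le> 1" using nsinc_abs_le_1 abs_square_le_1 by blast
  moreover have "v\<^sup>2 \<le> 1" using True abs_square_le_1 by blast
  then have "1 \<le> 2 / (1 + v\<^sup>2)" by (simp add: divide_simps add_pos_nonneg)
  ultimately show ?thesis by linarith
next
  case False
  then have v: "v \<noteq> 0" "1 \<le> v\<^sup>2" using abs_square_le_1 [of v] by force+
  have "(nsinc v)\<^sup>2 = \<bar>nsinc v\<bar>\<^sup>2" by simp
  also have "\<dots> \<le> (1 / (pi * \<bar>v\<bar>))\<^sup>2" by (rule power_mono [OF nsinc_abs_le [OF v(1)]]) simp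
  also have "\<dots> = 1 / (pi\<^sup>2 * v\<^sup>2)" by (simp add: power_divide power_mult_distrib)
  also have "\<dots> \<le> 1 / (1 * v\<^sup>2)"
    using v pi_gt3 by (intro divide_left_mono mult_right_mono) (auto simp: one_le_power)
  also have "\<dots> \<le> 2 / (1 + v\<^sup>2)" using v by (simp add: divide_simps add_pos_nonneg)
  finally show ?thesis .
qed

lemma nsinc_sq_integral_le: "integral {a..b} (\<lambda>z. (nsinc (z - y))\<^sup>2) \<le> 2 * pi"
proof (cases "a \<le> b")
  case True
  have "((\<lambda>z. 2 / (1 + (z - y)\<^sup>2)) has_integral 2 * arctan (b - y) - 2 * arctan (a - y)) {a..b}"
    by (rule fundamental_theorem_of_calculus [OF True])
       (auto intro!: derivative_eq_intros simp: divide_simps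
             simp flip: has_real_derivative_iff_has_vector_derivative)
  then have "integral {a..b} (\<lambda>z. (nsinc (z - y))\<^sup>2) \<le> 2 * arctan (b - y) - 2 * arctan (a - y)"
    by (rule has_integral_le [rotated]) (auto intro!: integrable_integral integrable_continuous_interval continuous_intros nsinc_sq_le)
  then show ?thesis using arctan_bounded [of "b - y"] arctan_bounded [of "a - y"] by linarith
qed simp

lemma nsinc_cross_integral_le:
  "\<bar>integral {a..b} (\<lambda>z. nsinc (z - y) * nsinc (z - w))\<bar> \<le> 2 * pi"
proof -
  have "norm (integral {a..b} (\<lambda>z. nsinc (z - y) * nsinc (z - w)))
      \<le> integral {a..b} (\<lambda>z. 1/2 * (nsinc (z - y))\<^sup>2 + 1/2 * (nsinc (z - w))\<^sup>2)"
  proof (rule integral_norm_bound_integral)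
    show "norm (nsinc (z - y) * nsinc (z - w)) \<le> 1/2 * (nsinc (z - y))\<^sup>2 + 1/2 * (nsinc (z - w))\<^sup>2" for z
      using sum_squares_bound [of "\<bar>nsinc (z - y)\<bar>" "\<bar>nsinc (z - w)\<bar>"] by (simp add: abs_mult)
  qed (intro integrable_continuous_interval continuous_intros)+
  also have "\<dots> = 1/2 * integral {a..b} (\<lambda>z. (nsinc (z - y))\<^sup>2)
      + 1/2 * integral {a..b} (\<lambda>z. (nsinc (z - w))\<^sup>2)"
    by (subst integral_add) (auto intro!: integrable_continuous_interval continuous_intros)
  also have "\<dots> \<le> 1/2 * (2 * pi) + 1/2 * (2 * pi)"
    by (intro add_mono mult_left_mono nsinc_sq_integral_le) auto
  finally show ?thesis by simp
qed

lemma nsinc_double: "nsinc v * cos (pi * v) = nsinc (2 * v)"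
proof (cases "v = 0")
  case False
  have "sin (pi * (2 * v)) = 2 * sin (pi * v) * cos (pi * v)"
    using sin_double [of "pi * v"] by (simp add: mult_ac)
  then show ?thesis using False by (simp add: nsinc_neq)
qed simp

text \<open>Splitting \<open>1 / ((z - y) * (z - w))\<close> turns the product of two translates
  into terms centred at \<open>y\<close> or at \<open>w\<close>: odd functions, whose contribution
  vanishes in the limit, and dilated sincs, whose integral is known.\<close>

lemma nsinc_partial_fractions:
  "pi * (y - w) * (nsinc (z - y) * nsinc (z - w)) =
     cos (pi * (y - w)) * (nsinc (z - y) * sin (pi * (z - y)) - nsinc (z - w) * sin (pi * (z - w)))
     + sin (pi * (y - w)) * (nsinc (2 * (z - y)) + nsinc (2 * (z - w)))"
proof -
  have "pi * (y - w) * (nsinc (z - y) * nsinc (z - w)) =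
      (pi * (z - w) * nsinc (z - w)) * nsinc (z - y) - (pi * (z - y) * nsinc (z - y)) * nsinc (z - w)"
    by (simp add: algebra_simps)
  also have "\<dots> = sin (pi * (z - w)) * nsinc (z - y) - sin (pi * (z - y)) * nsinc (z - w)"
    by (simp only: nsinc_mult)
  also have "sin (pi * (z - w)) = sin (pi * (z - y)) * cos (pi * (y - w)) + cos (pi * (z - y)) * sin (pi * (y - w))"
    using sin_add [of "pi * (z - y)" "pi * (y - w)"] by (simp flip: distrib_left)
  also have "sin (pi * (z - y)) * nsinc (z - w) =
     (sin (pi * (z - w)) * cos (pi * (y - w)) - cos (pi * (z - w)) * sin (pi * (y - w))) * nsinc (z - w)"
    using sin_diff [of "pi * (z - w)" "pi * (y - w)"] by (simp flip: right_diff_distrib)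
  finally show ?thesis unfolding nsinc_double [symmetric] by (simp only: ring_distribs mult_ac)
qed

text \<open>The Dirichlet integral, through the limit of \<open>Si\<close> at infinity.\<close>

lemma nsinc_double_integral_tendsto:
  "(\<lambda>n. integral {- real n..real n} (\<lambda>z. nsinc (2 * (z - y)))) \<longlonglongrightarrow> 1 / 2"
proof -
  define P where "P t = Si (2 * pi * t) / (2 * pi)" for t
  have P: "(P has_real_derivative nsinc (2 * t)) (at t within A)" for t A
  proof -
    have "(P has_real_derivative sinc (2 * pi * t) * (2 * pi) / (2 * pi)) (at t)"
      unfolding P_def by (auto intro!: derivative_eq_intros DERIV_chain2 [OF DERIV_Si])
    moreover have "sinc (2 * pi * t) * (2 * pi) / (2 * pi) = nsinc (2 * t)"
      by (cases "t = 0") (simp_all add: nsinc_neq mult_ac)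
    ultimately show ?thesis by (simp add: has_field_derivative_at_within)
  qed
  have eq: "integral {- real n..real n} (\<lambda>z. nsinc (2 * (z - y))) = P (real n - y) + P (real n + y)"
    if "\<bar>y\<bar> \<le> real n" for n
  proof -
    have "((\<lambda>z. nsinc (2 * (z - y))) has_integral P (real n - y) - P (- real n - y)) {- real n..real n}"
    proof (rule fundamental_theorem_of_calculus)
      show "((\<lambda>z. P (z - y)) has_vector_derivative nsinc (2 * (z - y))) (at z within {- real n..real n})" for z
      proof -
        have "((\<lambda>z. z - y) has_real_derivative 1) (at z within {- real n..real n})"
          by (auto intro!: derivative_eq_intros)
        from DERIV_chain2 [OF P this] show ?thesis
          by (simp flip: has_real_derivative_iff_has_vector_derivative)
      qed
    qed simp
    moreover have "P (- real n - y) = - P (real n + y)"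
    proof -
      have "2 * pi * (- real n - y) = - (2 * pi * (real n + y))" by (simp add: algebra_simps)
      then show ?thesis
        using Si_neg [of "2 * pi * (real n + y)"] that unfolding P_def by (simp only: minus_divide_left) simp
    qed
    ultimately show ?thesis by (simp add: integral_unique)
  qed
  have lim: "((\<lambda>n. P (real n + r)) \<longlongrightarrow> 1 / 4) sequentially" for r
  proof -
    have "filterlim (\<lambda>n. 2 * pi * (real n + r)) at_top sequentially"
      by real_asymp
    from filterlim_compose [OF Si_at_top this]
    have "((\<lambda>n. Si (2 * pi * (real n + r)) / (2 * pi)) \<longlongrightarrow> pi / 2 / (2 * pi)) sequentially"
      by (intro tendsto_intros) auto
    then show ?thesis by (simp add: P_def)
  qed
  have "(\<lambda>n. P (real n - y) + P (real n + y)) \<longlonglongrightarrow> 1 / 4 + 1 / 4"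
    using tendsto_add [OF lim [of "- y"] lim [of y]] by simp
  moreover have "eventually (\<lambda>n. integral {- real n..real n} (\<lambda>z. nsinc (2 * (z - y)))
      = P (real n - y) + P (real n + y)) sequentially"
    using eventually_ge_at_top [of "nat \<lceil>\<bar>y\<bar>\<rceil>"] by eventually_elim (rule eq, linarith)
  ultimately show ?thesis by (simp add: tendsto_cong)
qed

text \<open>The integrand is odd about \<open>y\<close> but decays only like 1 / \<bar>z - y\<bar>,
  and the window is centred at 0. After cancellation there remains a piece of length
  \<open>2 * \<bar>y\<bar>\<close> at distance about \<open>n\<close>, where the integrand is
  small.\<close>

lemma nsinc_sin_integral_tendsto:
  "(\<lambda>n. integral {- real n..real n} (\<lambda>z. nsinc (z - y) * sin (pi * (z - y)))) \<longlonglongrightarrow> 0"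
proof -
  define q where "q v = nsinc v * sin (pi * v)" for v
  have qc: "continuous_on UNIV q" unfolding q_def by (intro continuous_intros)
  obtain Q where Q: "\<And>x. (Q has_vector_derivative q x) (at x)"
    using einterval_antiderivative [of "-\<infinity>" "\<infinity>" q] qc
    by (auto simp: continuous_on_eq_continuous_at)
  have Q': "(Q has_real_derivative q x) (at x within A)" for x A
    using Q [of x] by (simp add: has_real_derivative_iff_has_vector_derivative has_vector_derivative_at_within)
  have qodd: "q (- v) = - q v" for v by (simp add: q_def)
  have "((\<lambda>t. Q (- t) - Q t) has_real_derivative 0) (at t)" for t
    by (auto intro!: derivative_eq_intros DERIV_chain2 [OF Q'] simp: qodd)
  then have Qeven: "Q (- t) = Q t" for t
    using DERIV_isconst_all [of "\<lambda>t. Q (- t) - Q t" t 0] by simp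
  have qle: "\<bar>q v\<bar> \<le> 1 / T" if "0 < T" "T \<le> \<bar>v\<bar>" for v T
  proof -
    have "\<bar>q v\<bar> \<le> 1 / (pi * \<bar>v\<bar>) * 1"
      unfolding q_def abs_mult by (intro mult_mono nsinc_abs_le) (use that in auto)
    also have "\<dots> \<le> 1 / T"
      using that pi_gt3 mult_mono [of 1 pi T "\<bar>v\<bar>"] by (simp add: frac_le)
    finally show ?thesis .
  qed
  have bd: "\<bar>integral {- real n..real n} (\<lambda>z. q (z - y))\<bar> \<le> 2 * \<bar>y\<bar> / (real n - \<bar>y\<bar>)"
    if n: "\<bar>y\<bar> < real n" for n
  proof -
    have "((\<lambda>z. q (z - y)) has_integral Q (real n - y) - Q (- real n - y)) {- real n..real n}"
    proof (rule fundamental_theorem_of_calculus)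
      show "((\<lambda>z. Q (z - y)) has_vector_derivative q (z - y)) (at z within {- real n..real n})" for z
      proof -
        have "((\<lambda>z. z - y) has_real_derivative 1) (at z within {- real n..real n})"
          by (auto intro!: derivative_eq_intros)
        from DERIV_chain2 [OF Q' this] show ?thesis
          by (simp flip: has_real_derivative_iff_has_vector_derivative)
      qed
    qed simp
    moreover have "Q (- real n - y) = Q (real n + y)" using Qeven [of "real n + y"] by simp
    ultimately have eq: "integral {- real n..real n} (\<lambda>z. q (z - y)) = Q (real n - y) - Q (real n + y)"
      by (simp add: integral_unique)
    have "norm (Q (real n - y) - Q (real n + y)) \<le> 1 / (real n - \<bar>y\<bar>) * norm ((real n - y) - (real n + y))"
    proof (rule field_differentiable_bound [of "{real n - \<bar>y\<bar>..}"])
      show "(Q has_field_derivative q z) (at z within {real n - \<bar>y\<bar>..})" for z by (rule Q')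
      show "norm (q z) \<le> 1 / (real n - \<bar>y\<bar>)" if "z \<in> {real n - \<bar>y\<bar>..}" for z
        using qle [of "real n - \<bar>y\<bar>" z] n that by auto
    qed auto
    then show ?thesis by (simp add: eq)
  qed
  have "(\<lambda>n. 2 * \<bar>y\<bar> / (real n - \<bar>y\<bar>)) \<longlonglongrightarrow> 0" by real_asymp
  moreover have "eventually (\<lambda>n. norm (integral {- real n..real n} (\<lambda>z. q (z - y)))
      \<le> 2 * \<bar>y\<bar> / (real n - \<bar>y\<bar>)) sequentially"
    using eventually_gt_at_top [of "nat \<lceil>\<bar>y\<bar>\<rceil>"] by eventually_elim (simp only: real_norm_def, rule bd, linarith)
  ultimately show ?thesis unfolding q_def by (rule Lim_null_comparison [rotated])
qed

text \<open>On the whole line the kernel is that of the projection onto frequencies at most 1/2. The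
  identity comes out after division by \<open>pi * (y - w)\<close>, hence
  \<open>y \<noteq> w\<close>; in the later integrals the exceptional point is a null set.\<close>

lemma nsinc_reproducing:
  assumes "y \<noteq> w"
  shows "(\<lambda>n. integral {- real n..real n} (\<lambda>z. nsinc (z - y) * nsinc (z - w))) \<longlonglongrightarrow> nsinc (y - w)"
proof -
  define a where "a = y - w"
  have a: "a \<noteq> 0" using assms by (simp add: a_def)
  let ?q = "\<lambda>y n. integral {- real n..real n} (\<lambda>z. nsinc (z - y) * sin (pi * (z - y)))"
  let ?p = "\<lambda>y n. integral {- real n..real n} (\<lambda>z. nsinc (2 * (z - y)))"
  have eq: "integral {- real n..real n} (\<lambda>z. nsinc (z - y) * nsinc (z - w)) =
      (cos (pi * a) * (?q y n - ?q w n) + sin (pi * a) * (?p y n + ?p w n)) / (pi * a)" for n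
  proof -
    have "pi * a * integral {- real n..real n} (\<lambda>z. nsinc (z - y) * nsinc (z - w)) =
      integral {- real n..real n} (\<lambda>z. cos (pi * a) * (nsinc (z - y) * sin (pi * (z - y)) - nsinc (z - w) * sin (pi * (z - w)))
        + sin (pi * a) * (nsinc (2 * (z - y)) + nsinc (2 * (z - w))))"
      unfolding a_def nsinc_partial_fractions [symmetric] by (rule integral_mult_right [symmetric])
    also have "\<dots> = cos (pi * a) * (?q y n - ?q w n) + sin (pi * a) * (?p y n + ?p w n)"
      by (subst integral_add integral_diff integral_mult_right |
          (intro integrable_continuous_interval continuous_intros; fail))+ (rule refl)
    finally show ?thesis using a by (simp add: field_simps)
  qed
  have "(\<lambda>n. (cos (pi * a) * (?q y n - ?q w n) + sin (pi * a) * (?p y n + ?p w n)) / (pi * a))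
     \<longlonglongrightarrow> (cos (pi * a) * (0 - 0) + sin (pi * a) * (1 / 2 + 1 / 2)) / (pi * a)"
    by (intro tendsto_intros nsinc_sin_integral_tendsto nsinc_double_integral_tendsto) (use a in auto)
  then show ?thesis using a by (simp add: eq nsinc_neq flip: a_def)
qed

section \<open>The sinc operator\<close>

lemma integral_swap_real:
  fixes f :: "real \<Rightarrow> real \<Rightarrow> real"
  assumes "continuous_on ({a..b} \<times> {c..d}) (\<lambda>p. f (fst p) (snd p))"
  shows "integral {a..b} (\<lambda>x. integral {c..d} (\<lambda>y. f x y)) = integral {c..d} (\<lambda>y. integral {a..b} (\<lambda>x. f x y))"
  using integral_swap_continuous [of a c b d f] assms
  by (simp add: cbox_Pair_eq split_def)

lemma continuous_on_integral_param:
  fixes f :: "real \<Rightarrow> real \<Rightarrow> real"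
  assumes "continuous_on (U \<times> {a..b}) (\<lambda>p. f (fst p) (snd p))"
  shows "continuous_on U (\<lambda>x. integral {a..b} (\<lambda>y. f x y))"
  using integral_continuous_on_param [of U a b f] assms by (simp add: split_def)

lemma continuous_bcontfun_comp [continuous_intros]:
  "continuous_on A g \<Longrightarrow> continuous_on A (\<lambda>x. apply_bcontfun f (g x))"
  by (rule continuous_on_compose2 [OF continuous_on_apply_bcontfun [of UNIV]]) auto

lemma bcontfun_add [simp]: "apply_bcontfun (f + g) x = apply_bcontfun f x + apply_bcontfun g x"
  by (simp add: plus_bcontfun.rep_eq)

lemma bcontfun_scaleR [simp]: "apply_bcontfun (r *\<^sub>R f) x = r *\<^sub>R apply_bcontfun f x"
  by (simp add: scaleR_bcontfun.rep_eq)

lemma bcontfun_diff [simp]: "apply_bcontfun (f - g) x = apply_bcontfun f x - apply_bcontfun g x"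
  by (simp add: minus_bcontfun.rep_eq)

lemma bcontfun_zero [simp]: "apply_bcontfun 0 x = 0"
  by (simp add: zero_bcontfun.rep_eq)

lemma bcontfun_sum: "apply_bcontfun (sum f I) x = (\<Sum>i\<in>I. apply_bcontfun (f i) x)"
  by (induction I rule: infinite_finite_induct) auto

locale sinc_interval =
  fixes c :: real
  assumes c_pos: "0 < c"
begin

text \<open>
  Functions on the whole line under the form of \<open>L\<^sup>2(0,c)\<close>: eigenfunctions extend to the line by the
  eigenvalue equation, which is needed outside \<open>(0,c)\<close> below. The price is that the form is only
  semidefinite.
\<close>

definition ip :: "(real \<Rightarrow>\<^sub>C real) \<Rightarrow> (real \<Rightarrow>\<^sub>C real) \<Rightarrow> real" where
  "ip f g = integral {0..c} (\<lambda>y. apply_bcontfun f y * apply_bcontfun g y)"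

sublocale semi_inner ip
proof
  show "ip x y = ip y x" for x y by (simp add: ip_def mult.commute)
  show "ip (x + y) z = ip x z + ip y z" for x y z
    unfolding ip_def
    by (subst integral_add [symmetric])
       (auto intro!: integrable_continuous_interval continuous_intros simp: distrib_right)
  show "ip (r *\<^sub>R x) z = r * ip x z" for r x z
    by (simp add: ip_def mult.assoc)
  show "0 \<le> ip x x" for x
    unfolding ip_def by (rule integral_nonneg) (auto intro!: integrable_continuous_interval continuous_intros)
qed

definition kv :: "real \<Rightarrow> (real \<Rightarrow>\<^sub>C real)" where
  "kv x = Bcontfun (\<lambda>y. nsinc (x - y))"

lemma apply_kv [simp]: "apply_bcontfun (kv x) y = nsinc (x - y)"
  unfolding kv_def
  by (subst Bcontfun_inverse)
     (auto intro!: bcontfun_normI [of _ 1] continuous_intros simp: nsinc_abs_le_1)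

definition S :: "(real \<Rightarrow>\<^sub>C real) \<Rightarrow> (real \<Rightarrow>\<^sub>C real)" where
  "S f = Bcontfun (\<lambda>x. integral {0..c} (\<lambda>y. nsinc (x - y) * apply_bcontfun f y))"

lemma apply_S: "apply_bcontfun (S f) x = integral {0..c} (\<lambda>y. nsinc (x - y) * apply_bcontfun f y)"
proof -
  have "norm (integral {0..c} (\<lambda>y. nsinc (x - y) * apply_bcontfun f y)) \<le> norm f * (c - 0)" for x
  proof (rule integral_bound)
    fix y
    have "norm (nsinc (x - y) * apply_bcontfun f y) \<le> 1 * norm f"
      unfolding norm_mult by (intro mult_mono norm_bounded) (auto simp: nsinc_abs_le_1)
    then show "norm (nsinc (x - y) * apply_bcontfun f y) \<le> norm f" by simp
  qed (use c_pos in \<open>auto intro!: continuous_intros\<close>)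
  then show ?thesis
    unfolding S_def
    by (subst Bcontfun_inverse)
       (auto intro!: bcontfun_normI continuous_on_integral_param continuous_intros)
qed

lemma S_ip: "apply_bcontfun (S f) x = ip (kv x) f"
  by (simp add: apply_S ip_def)

lemma linear_S: "linear S"
  by (rule linearI; rule bcontfun_eqI) (simp_all add: S_ip ip_simps)

lemma S_scaleR: "S (r *\<^sub>R f) = r *\<^sub>R S f"
  and S_diff: "S (f - g) = S f - S g" and S_sum: "S (sum h I) = (\<Sum>i\<in>I. S (h i))"
  by (rule linear_scale [OF linear_S] linear_diff [OF linear_S] linear_sum [OF linear_S])+

lemma S_sym: "ip (S f) g = ip f (S g)"
proof -
  have "ip (S f) g = integral {0..c} (\<lambda>x. integral {0..c} (\<lambda>y. nsinc (x - y) * apply_bcontfun f y * apply_bcontfun g x))"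
    by (simp add: ip_def apply_S)
  also have "\<dots> = integral {0..c} (\<lambda>y. integral {0..c} (\<lambda>x. nsinc (x - y) * apply_bcontfun f y * apply_bcontfun g x))"
    by (rule integral_swap_real) (auto intro!: continuous_intros)
  also have "\<dots> = integral {0..c} (\<lambda>y. integral {0..c} (\<lambda>x. apply_bcontfun f y * (nsinc (y - x) * apply_bcontfun g x)))"
    by (intro integral_cong) (subst nsinc_commute, simp)
  also have "\<dots> = ip f (S g)"
    by (simp add: ip_def apply_S)
  finally show ?thesis .
qed

lemma kv_norm_le: "ip (kv x) (kv x) \<le> c"
proof -
  have "ip (kv x) (kv x) \<le> integral {0..c} (\<lambda>_. 1)"
    unfolding ip_def
  proof (rule integral_le)
    fix y show "apply_bcontfun (kv x) y * apply_bcontfun (kv x) y \<le> 1"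
      using abs_square_le_1 [of "nsinc (x - y)"] nsinc_abs_le_1 by (simp add: power2_eq_square)
  qed (auto intro!: integrable_continuous_interval continuous_intros)
  then show ?thesis using c_pos by simp
qed

lemma S_sup_le: "(apply_bcontfun (S f) x)\<^sup>2 \<le> c * ip f f"
  unfolding S_ip using Cauchy_Schwarz [of "kv x" f] mult_right_mono [OF kv_norm_le [of x] ip_nonneg [of f]]
  by linarith

lemma ip_le_sup:
  assumes "\<And>x. x \<in> {0..c} \<Longrightarrow> (apply_bcontfun f x)\<^sup>2 \<le> B"
  shows "ip f f \<le> c * B"
proof -
  have "ip f f \<le> integral {0..c} (\<lambda>_. B)"
    unfolding ip_def
    by (rule integral_le)
       (use assms in \<open>auto intro!: integrable_continuous_interval continuous_intros simp: power2_eq_square\<close>)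
  then show ?thesis using c_pos by (simp add: mult.commute)
qed

lemma S_bound: "ip (S f) (S f) \<le> c\<^sup>2 * ip f f"
  using ip_le_sup [of "S f" "c * ip f f"] S_sup_le by (simp add: power2_eq_square mult.assoc)

lemma S_null: "ip f f = 0 \<Longrightarrow> S f = 0"
  using S_sup_le [of f] by (intro bcontfun_eqI) simp

section \<open>Positivity on the Fourier side\<close>

definition cos_int :: "(real \<Rightarrow>\<^sub>C real) \<Rightarrow> real \<Rightarrow> real" where
  "cos_int f t = integral {0..c} (\<lambda>y. cos (pi * y * t) * apply_bcontfun f y)"

definition sin_int :: "(real \<Rightarrow>\<^sub>C real) \<Rightarrow> real \<Rightarrow> real" where
  "sin_int f t = integral {0..c} (\<lambda>y. sin (pi * y * t) * apply_bcontfun f y)"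

lemma continuous_cos_int: "continuous_on A (cos_int f)" and continuous_sin_int: "continuous_on A (sin_int f)"
  unfolding cos_int_def sin_int_def
  by (intro continuous_on_integral_param continuous_intros)+

lemma continuous_cos_int_comp [continuous_intros]:
  "continuous_on A g \<Longrightarrow> continuous_on A (\<lambda>x. cos_int f (g x))"
  by (rule continuous_on_compose2 [OF continuous_cos_int [of UNIV]]) auto

lemma continuous_sin_int_comp [continuous_intros]:
  "continuous_on A g \<Longrightarrow> continuous_on A (\<lambda>x. sin_int f (g x))"
  by (rule continuous_on_compose2 [OF continuous_sin_int [of UNIV]]) auto

lemma trig_cross: "integral {0..1} (\<lambda>t. cos (pi * x * t) * cos_int f t + sin (pi * x * t) * sin_int f t) = apply_bcontfun (S f) x"
proof -
  have 1: "cos (pi * x * t) * cos_int f t + sin (pi * x * t) * sin_int f t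
      = integral {0..c} (\<lambda>y. cos (pi * (x - y) * t) * apply_bcontfun f y)" for t
  proof -
    have "integral {0..c} (\<lambda>y. cos (pi * (x - y) * t) * apply_bcontfun f y) =
      integral {0..c} (\<lambda>y. cos (pi * x * t) * (cos (pi * y * t) * apply_bcontfun f y)
        + sin (pi * x * t) * (sin (pi * y * t) * apply_bcontfun f y))"
    proof (rule integral_cong)
      fix y
      have "cos (pi * (x - y) * t) = cos (pi * x * t) * cos (pi * y * t) + sin (pi * x * t) * sin (pi * y * t)"
        by (simp add: algebra_simps flip: cos_diff)
      then show "cos (pi * (x - y) * t) * apply_bcontfun f y = cos (pi * x * t) * (cos (pi * y * t) * apply_bcontfun f y)
        + sin (pi * x * t) * (sin (pi * y * t) * apply_bcontfun f y)"
        by (simp add: distrib_right)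
    qed
    also have "\<dots> = cos (pi * x * t) * cos_int f t + sin (pi * x * t) * sin_int f t"
      unfolding cos_int_def sin_int_def
      by (subst integral_add) (auto intro!: integrable_continuous_interval continuous_intros)
    finally show ?thesis by simp
  qed
  have "integral {0..1} (\<lambda>t. integral {0..c} (\<lambda>y. cos (pi * (x - y) * t) * apply_bcontfun f y)) =
      integral {0..c} (\<lambda>y. integral {0..1} (\<lambda>t. cos (pi * (x - y) * t) * apply_bcontfun f y))"
    by (rule integral_swap_real) (auto intro!: continuous_intros)
  also have "\<dots> = apply_bcontfun (S f) x"
    using integral_unique [OF nsinc_cos_integral] by (simp add: apply_S)
  finally show ?thesis by (simp add: 1)
qed

text \<open>Up to sign, \<open>cos_int f t\<close> and \<open>sin_int f t\<close> are the real and
  imaginary parts of the Fourier transform of \<open>f\<close> cut off to \<open>{0..c}\<close>, so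
  the form of \<open>S\<close> is an energy in a frequency band.\<close>

lemma trig_norm: "integral {0..1} (\<lambda>t. (cos_int f t)\<^sup>2 + (sin_int f t)\<^sup>2) = ip (S f) f"
proof -
  have 1: "(cos_int f t)\<^sup>2 + (sin_int f t)\<^sup>2 = integral {0..c} (\<lambda>y.
      (cos (pi * y * t) * cos_int f t + sin (pi * y * t) * sin_int f t) * apply_bcontfun f y)" for t
  proof -
    have "integral {0..c} (\<lambda>y. (cos (pi * y * t) * cos_int f t + sin (pi * y * t) * sin_int f t) * apply_bcontfun f y)
      = integral {0..c} (\<lambda>y. cos_int f t * (cos (pi * y * t) * apply_bcontfun f y)
        + sin_int f t * (sin (pi * y * t) * apply_bcontfun f y))"
      by (intro integral_cong) (simp add: algebra_simps)
    also have "\<dots> = cos_int f t * cos_int f t + sin_int f t * sin_int f t"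
      by (subst integral_add)
         (auto intro!: integrable_continuous_interval continuous_intros simp flip: cos_int_def sin_int_def)
    finally show ?thesis by (simp add: power2_eq_square)
  qed
  have "integral {0..1} (\<lambda>t. integral {0..c} (\<lambda>y.
      (cos (pi * y * t) * cos_int f t + sin (pi * y * t) * sin_int f t) * apply_bcontfun f y)) =
    integral {0..c} (\<lambda>y. integral {0..1} (\<lambda>t.
      (cos (pi * y * t) * cos_int f t + sin (pi * y * t) * sin_int f t) * apply_bcontfun f y))"
    by (rule integral_swap_real) (auto intro!: continuous_intros)
  also have "\<dots> = ip (S f) f"
    by (simp add: trig_cross ip_def)
  finally show ?thesis by (simp add: 1)
qed

text \<open>Positivity of the kernel as a form on measures \<open>a \<delta>\<^sub>x + f\<close>, which gives both the positivity
  of the operator and pointwise bounds.\<close>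

lemma point_form_nonneg: "0 \<le> a\<^sup>2 + 2 * a * apply_bcontfun (S f) x + ip (S f) f"
proof -
  have "0 \<le> integral {0..1} (\<lambda>t. (a * cos (pi * x * t) + cos_int f t)\<^sup>2 + (a * sin (pi * x * t) + sin_int f t)\<^sup>2)"
    by (rule integral_nonneg) (auto intro!: integrable_continuous_interval continuous_intros)
  also have "\<dots> = integral {0..1} (\<lambda>t. a\<^sup>2 + (2 * a * (cos (pi * x * t) * cos_int f t + sin (pi * x * t) * sin_int f t)
      + ((cos_int f t)\<^sup>2 + (sin_int f t)\<^sup>2)))"
  proof (rule integral_cong)
    fix t
    have "a\<^sup>2 * (cos (pi * x * t))\<^sup>2 + a\<^sup>2 * (sin (pi * x * t))\<^sup>2 = a\<^sup>2"
      by (simp flip: distrib_left)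
    then show "(a * cos (pi * x * t) + cos_int f t)\<^sup>2 + (a * sin (pi * x * t) + sin_int f t)\<^sup>2 =
      a\<^sup>2 + (2 * a * (cos (pi * x * t) * cos_int f t + sin (pi * x * t) * sin_int f t)
      + ((cos_int f t)\<^sup>2 + (sin_int f t)\<^sup>2))"
      by (simp add: power2_sum power_mult_distrib algebra_simps)
  qed
  also have "\<dots> = a\<^sup>2 + (2 * a * apply_bcontfun (S f) x + ip (S f) f)"
  proof (rule integral_unique)
    have "((\<lambda>t. cos (pi * x * t) * cos_int f t + sin (pi * x * t) * sin_int f t) has_integral apply_bcontfun (S f) x) {0..1}"
      unfolding trig_cross [symmetric]
      by (intro integrable_integral integrable_continuous_interval continuous_intros)
    moreover have "((\<lambda>t. (cos_int f t)\<^sup>2 + (sin_int f t)\<^sup>2) has_integral ip (S f) f) {0..1}"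
      unfolding trig_norm [symmetric]
      by (intro integrable_integral integrable_continuous_interval continuous_intros)
    moreover have "((\<lambda>t. a\<^sup>2) has_integral a\<^sup>2) {0..1::real}"
      using has_integral_const_real [of "a\<^sup>2" 0 1] by simp
    ultimately show "((\<lambda>t. a\<^sup>2 + (2 * a * (cos (pi * x * t) * cos_int f t + sin (pi * x * t) * sin_int f t)
      + ((cos_int f t)\<^sup>2 + (sin_int f t)\<^sup>2))) has_integral a\<^sup>2 + (2 * a * apply_bcontfun (S f) x + ip (S f) f)) {0..1}"
      by (intro has_integral_add has_integral_mult_right)
  qed
  finally show ?thesis by simp
qed

lemma S_pos: "0 \<le> ip (S f) f"
  using point_form_nonneg [of 0] by simp

text \<open>The value of \<open>a\<close> that minimizes the point form is minus the value of
  \<open>S f\<close> at \<open>x\<close>. The bound holds at every point of the line and upgrades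
  estimates in the form to uniform ones.\<close>

lemma S_point_le: "(apply_bcontfun (S f) x)\<^sup>2 \<le> ip (S f) f"
proof -
  have "0 \<le> (- apply_bcontfun (S f) x)\<^sup>2 + 2 * (- apply_bcontfun (S f) x) * apply_bcontfun (S f) x + ip (S f) f"
    by (rule point_form_nonneg)
  then show ?thesis by (simp add: power2_eq_square)
qed

lemma S_Lipschitz:
  "(apply_bcontfun (S f) x - apply_bcontfun (S f) x')\<^sup>2 \<le> c * (pi * \<bar>x - x'\<bar>)\<^sup>2 * ip f f"
proof -
  let ?d = "kv x - kv x'"
  have "ip ?d ?d \<le> c * (pi * \<bar>x - x'\<bar>)\<^sup>2"
  proof (rule ip_le_sup)
    fix y
    have "\<bar>apply_bcontfun ?d y\<bar> \<le> \<bar>pi * \<bar>x - x'\<bar>\<bar>"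
      using nsinc_Lipschitz [of "x - y" "x' - y"] by (simp add: abs_mult)
    then show "(apply_bcontfun ?d y)\<^sup>2 \<le> (pi * \<bar>x - x'\<bar>)\<^sup>2"
      unfolding abs_le_square_iff .
  qed
  then have "ip ?d ?d * ip f f \<le> c * (pi * \<bar>x - x'\<bar>)\<^sup>2 * ip f f"
    by (rule mult_right_mono) (rule ip_nonneg)
  with Cauchy_Schwarz [of ?d f] show ?thesis
    unfolding S_ip ip_diff_left by linarith
qed

text \<open>The images of the unit ball are uniformly bounded and share a Lipschitz constant, so
  Arzela--Ascoli applies.\<close>

lemma S_compact:
  assumes X: "\<And>n::nat. ip (X n) (X n) \<le> 1"
  shows "\<exists>k y. strict_mono k \<and> (\<lambda>n. ip (S (X (k n)) - y) (S (X (k n)) - y)) \<longlonglongrightarrow> 0"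
proof -
  define F where "F n x = apply_bcontfun (S (X n)) x" for n x
  have sup: "norm (F n x) \<le> sqrt c" for n x
  proof -
    have "(F n x)\<^sup>2 \<le> c * 1"
      unfolding F_def using S_sup_le mult_left_mono [OF X] c_pos by (meson order_trans less_imp_le)
    from real_sqrt_le_mono [OF this] show ?thesis by simp
  qed
  have lip: "norm (F n x - F n x') \<le> sqrt c * pi * \<bar>x - x'\<bar>" for n x x'
  proof -
    have "(F n x - F n x')\<^sup>2 \<le> c * (pi * \<bar>x - x'\<bar>)\<^sup>2 * 1"
      unfolding F_def using S_Lipschitz mult_left_mono [OF X] c_pos
      by (meson order_trans less_imp_le mult_nonneg_nonneg zero_le_power2)
    also have "\<dots> = (sqrt c * pi * \<bar>x - x'\<bar>)\<^sup>2"
      using c_pos by (simp add: power_mult_distrib)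
    finally show ?thesis
      using abs_le_square_iff [of "F n x - F n x'" "sqrt c * pi * \<bar>x - x'\<bar>"] c_pos by (simp add: abs_mult)
  qed
  obtain g k where g: "continuous_on {0..c} g" and k: "strict_mono (k :: nat \<Rightarrow> nat)"
    and unif: "\<And>e. 0 < e \<Longrightarrow> \<exists>N. \<forall>n x. n \<ge> N \<and> x \<in> {0..c} \<longrightarrow> norm (F (k n) x - g x) < e"
  proof (rule Arzela_Ascoli [of "{0..c}" F "sqrt c"])
    fix x e :: real assume "0 < e"
    define d where "d = e / (sqrt c * pi)"
    have "0 < d" using \<open>0 < e\<close> c_pos by (simp add: d_def)
    moreover have "norm (F n x - F n y) < e" if "norm (x - y) < d" for n y
    proof -
      have "sqrt c * pi * \<bar>x - y\<bar> < sqrt c * pi * d"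
        by (rule mult_strict_left_mono) (use that c_pos in auto)
      also have "\<dots> = e" using c_pos by (simp add: d_def)
      finally show ?thesis using lip [of n x y] by linarith
    qed
    ultimately show "\<exists>d>0. \<forall>n y. y \<in> {0..c} \<and> norm (x - y) < d \<longrightarrow> norm (F n x - F n y) < e" by blast
  qed (use sup in auto)
  \<comment> \<open>The limit is known on \<open>{0..c}\<close> only; clamping the argument extends
    it to a bounded continuous function on the line without affecting the form.\<close>
  define h where "h x = g (max 0 (min c x))" for x
  have hc: "continuous_on UNIV h"
    unfolding h_def
    by (rule continuous_on_compose2 [OF g]) (use c_pos in \<open>auto intro!: continuous_intros\<close>)
  have "bounded (g ` {0..c})"
    using compact_continuous_image [OF g] compact_imp_bounded by blast
  then obtain M where M: "\<And>x. x \<in> {0..c} \<Longrightarrow> norm (g x) \<le> M"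
    unfolding bounded_iff by blast
  have h: "h \<in> bcontfun"
    by (rule bcontfun_normI [OF hc, of M]) (use M c_pos in \<open>auto simp: h_def\<close>)
  have hg: "h x = g x" if "x \<in> {0..c}" for x using that by (auto simp: h_def)
  have "(\<lambda>n. ip (S (X (k n)) - Bcontfun h) (S (X (k n)) - Bcontfun h)) \<longlonglongrightarrow> 0"
  proof (rule LIMSEQ_I)
    fix r :: real assume r: "0 < r"
    define e where "e = sqrt (r / (2 * c))"
    have e: "0 < e" "e\<^sup>2 = r / (2 * c)" using r c_pos by (simp_all add: e_def)
    obtain N where N: "\<And>n x. n \<ge> N \<Longrightarrow> x \<in> {0..c} \<Longrightarrow> norm (F (k n) x - g x) < e"
      using unif [OF e(1)] by blast
    have "norm (ip (S (X (k n)) - Bcontfun h) (S (X (k n)) - Bcontfun h) - 0) < r" if n: "N \<le> n" for n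
    proof -
      have "ip (S (X (k n)) - Bcontfun h) (S (X (k n)) - Bcontfun h) \<le> c * e\<^sup>2"
      proof (rule ip_le_sup)
        fix x assume x: "x \<in> {0..c}"
        have "\<bar>apply_bcontfun (S (X (k n)) - Bcontfun h) x\<bar> \<le> \<bar>e\<bar>"
          using N [OF n x] x e(1) by (simp add: Bcontfun_inverse [OF h] hg F_def)
        then show "(apply_bcontfun (S (X (k n)) - Bcontfun h) x)\<^sup>2 \<le> e\<^sup>2"
          unfolding abs_le_square_iff .
      qed
      also have "\<dots> < r" using r c_pos by (simp add: e(2))
      finally show ?thesis using ip_nonneg [of "S (X (k n)) - Bcontfun h"] by simp
    qed
    then show "\<exists>no. \<forall>n\<ge>no. norm (ip (S (X (k n)) - Bcontfun h) (S (X (k n)) - Bcontfun h) - 0) < r"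
      by blast
  qed
  with k show ?thesis by blast
qed

lemma pos_compact_S: "pos_compact S"
  unfolding pos_compact_def
  using linear_S S_sym S_pos S_null S_bound S_compact by blast

end

section \<open>Mercer's theorem\<close>

context sinc_interval begin

text \<open>By \<open>nsinc_reproducing\<close>, integrating two translates of the kernel over the
  line gives the kernel back, so the energy of \<open>S f\<close> over the line is
  \<open>ip (S f) f\<close>. Both passages to the limit are dominated through the uniform bound
  \<open>2 * pi\<close> for \<open>J\<close>.\<close>

lemma S_sq_integral_tendsto:
  "(\<lambda>n. integral {- real n..real n} (\<lambda>z. (apply_bcontfun (S f) z)\<^sup>2)) \<longlonglongrightarrow> ip (S f) f"
proof -
  define J where "J n y w = integral {- real n..real n} (\<lambda>z. nsinc (z - y) * nsinc (z - w))" for n y w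
  define G where "G n y = integral {- real n..real n} (\<lambda>z. nsinc (z - y) * apply_bcontfun (S f) z)" for n y
  have Jle: "\<bar>J n y w\<bar> \<le> 2 * pi" for n y w
    unfolding J_def by (rule nsinc_cross_integral_le)
  have Jcont: "continuous_on A (\<lambda>w. J n y w)" for A n y
    unfolding J_def by (intro continuous_on_integral_param continuous_intros)
  have Gcont: "continuous_on A (\<lambda>y. G n y)" for A n
    unfolding G_def by (intro continuous_on_integral_param continuous_intros)
  have GJ: "G n y = integral {0..c} (\<lambda>w. apply_bcontfun f w * J n y w)" for n y
  proof -
    have "G n y = integral {- real n..real n} (\<lambda>z. integral {0..c} (\<lambda>w. nsinc (z - y) * (nsinc (z - w) * apply_bcontfun f w)))"
      by (simp add: G_def apply_S)
    also have "\<dots> = integral {0..c} (\<lambda>w. integral {- real n..real n} (\<lambda>z. nsinc (z - y) * (nsinc (z - w) * apply_bcontfun f w)))"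
      by (rule integral_swap_real) (intro continuous_intros)
    also have "\<dots> = integral {0..c} (\<lambda>w. integral {- real n..real n} (\<lambda>z. apply_bcontfun f w * (nsinc (z - y) * nsinc (z - w))))"
      by (simp only: mult_ac)
    also have "\<dots> = integral {0..c} (\<lambda>w. apply_bcontfun f w * J n y w)"
      by (simp add: J_def)
    finally show ?thesis .
  qed
  have bd: "\<bar>apply_bcontfun f w * J n y w\<bar> \<le> norm f * (2 * pi)" for n y w
    unfolding abs_mult using norm_bounded [of f w] by (intro mult_mono Jle) auto
  have Gle: "\<bar>G n y\<bar> \<le> norm f * (2 * pi) * (c - 0)" for n y
    unfolding GJ real_norm_def [symmetric]
    by (rule integral_bound)
       (use c_pos bd in \<open>auto intro!: continuous_intros Jcont\<close>)
  have Glim: "(\<lambda>n. G n y) \<longlonglongrightarrow> apply_bcontfun (S f) y" for y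
  proof -
    \<comment> \<open>The value 1 is \<open>nsinc 0\<close>, so that the pointwise limit holds at
      \<open>w = y\<close> too.\<close>
    define J' where "J' n w = (if w = y then 1 else J n y w)" for n w
    have eq: "integral {0..c} (\<lambda>w. apply_bcontfun f w * J' n w) = G n y" for n
      unfolding GJ by (rule integral_spike [of "{y}"]) (auto simp: J'_def)
    have int: "(\<lambda>w. apply_bcontfun f w * J' n w) integrable_on {0..c}" for n
    proof (rule integrable_spike [of _ _ "{y}"])
      show "(\<lambda>w. apply_bcontfun f w * J n y w) integrable_on {0..c}"
        by (intro integrable_continuous_interval continuous_intros Jcont)
    qed (auto simp: J'_def)
    have "(\<lambda>n. integral {0..c} (\<lambda>w. apply_bcontfun f w * J' n w))
        \<longlonglongrightarrow> integral {0..c} (\<lambda>w. apply_bcontfun f w * nsinc (y - w))"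
    proof (rule dominated_convergence(2) [OF int])
      show "(\<lambda>_. norm f * (2 * pi)) integrable_on {0..c}" by (rule integrable_const_ivl)
      show "norm (apply_bcontfun f w * J' n w) \<le> norm f * (2 * pi)" for n w
      proof (cases "w = y")
        case True
        then show ?thesis
          using norm_bounded [of f w] pi_gt3 mult_mono [of "\<bar>apply_bcontfun f w\<bar>" "norm f" 1 "2 * pi"]
          by (simp add: J'_def)
      next
        case False
        then show ?thesis using bd [of w n y] by (simp add: J'_def)
      qed
      show "(\<lambda>n. apply_bcontfun f w * J' n w) \<longlonglongrightarrow> apply_bcontfun f w * nsinc (y - w)" for w
      proof (cases "w = y")
        case False
        then show ?thesis
          using nsinc_reproducing [of y w] by (auto simp: J'_def J_def intro: tendsto_mult_left)
      qed (simp add: J'_def)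
    qed
    then show ?thesis by (simp add: eq apply_S mult.commute)
  qed
  have eq: "integral {- real n..real n} (\<lambda>z. (apply_bcontfun (S f) z)\<^sup>2) = integral {0..c} (\<lambda>y. apply_bcontfun f y * G n y)" for n
  proof -
    have "integral {- real n..real n} (\<lambda>z. (apply_bcontfun (S f) z)\<^sup>2) =
      integral {- real n..real n} (\<lambda>z. apply_bcontfun (S f) z * integral {0..c} (\<lambda>y. nsinc (z - y) * apply_bcontfun f y))"
      by (simp add: power2_eq_square flip: apply_S)
    also have "\<dots> = integral {- real n..real n} (\<lambda>z. integral {0..c} (\<lambda>y. apply_bcontfun (S f) z * (nsinc (z - y) * apply_bcontfun f y)))"
      by simp
    also have "\<dots> = integral {0..c} (\<lambda>y. integral {- real n..real n} (\<lambda>z. apply_bcontfun (S f) z * (nsinc (z - y) * apply_bcontfun f y)))"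
      by (rule integral_swap_real) (intro continuous_intros)
    also have "\<dots> = integral {0..c} (\<lambda>y. integral {- real n..real n} (\<lambda>z. apply_bcontfun f y * (nsinc (z - y) * apply_bcontfun (S f) z)))"
      by (simp only: mult_ac)
    also have "\<dots> = integral {0..c} (\<lambda>y. apply_bcontfun f y * G n y)"
      by (simp add: G_def)
    finally show ?thesis .
  qed
  have "(\<lambda>n. integral {0..c} (\<lambda>y. apply_bcontfun f y * G n y))
      \<longlonglongrightarrow> integral {0..c} (\<lambda>y. apply_bcontfun f y * apply_bcontfun (S f) y)"
  proof (rule dominated_convergence(2))
    show "(\<lambda>y. apply_bcontfun f y * G n y) integrable_on {0..c}" for n
      by (intro integrable_continuous_interval continuous_intros Gcont)
    show "(\<lambda>_. norm f * (norm f * (2 * pi) * (c - 0))) integrable_on {0..c}" by (rule integrable_const_ivl)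
    show "norm (apply_bcontfun f y * G n y) \<le> norm f * (norm f * (2 * pi) * (c - 0))" for n y
      unfolding norm_mult using norm_bounded [of f y] Gle [of n y] by (intro mult_mono) auto
    show "(\<lambda>n. apply_bcontfun f y * G n y) \<longlonglongrightarrow> apply_bcontfun f y * apply_bcontfun (S f) y" for y
      by (intro tendsto_mult_left Glim)
  qed
  then show ?thesis by (simp add: eq ip_def mult.commute)
qed

text \<open>The form of S - S^2 is the energy of \<open>S f\<close> outside the interval. This is
  the reason for letting the functions live on the whole line.\<close>

lemma S_outer_integral_tendsto:
  "(\<lambda>n. integral {- real n..0} (\<lambda>z. (apply_bcontfun (S f) z)\<^sup>2) + integral {c..real n} (\<lambda>z. (apply_bcontfun (S f) z)\<^sup>2))
     \<longlonglongrightarrow> ip (S f) f - ip (S f) (S f)"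
proof -
  let ?g = "\<lambda>z. (apply_bcontfun (S f) z)\<^sup>2"
  have int: "?g integrable_on {a..b}" for a b
    by (intro integrable_continuous_interval continuous_intros)
  have "integral {- real n..0} ?g + integral {c..real n} ?g = integral {- real n..real n} ?g - ip (S f) (S f)"
    if "c \<le> real n" for n
    using Henstock_Kurzweil_Integration.integral_combine [of "- real n" 0 "real n" ?g, OF _ _ int]
      Henstock_Kurzweil_Integration.integral_combine [of 0 c "real n" ?g, OF _ _ int] that c_pos
    by (simp add: ip_def power2_eq_square)
  then have ev: "eventually (\<lambda>n. integral {- real n..0} ?g + integral {c..real n} ?g
      = integral {- real n..real n} ?g - ip (S f) (S f)) sequentially"
    using eventually_ge_at_top [of "nat \<lceil>c\<rceil>"] by (rule eventually_mono [rotated]) linarith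
  show ?thesis
    unfolding tendsto_cong [OF ev] by (intro tendsto_intros S_sq_integral_tendsto)
qed

lemma S_contraction: "ip (S f) (S f) \<le> ip (S f) f"
proof -
  have "0 \<le> ip (S f) f - ip (S f) (S f)"
    by (rule LIMSEQ_le_const [OF S_outer_integral_tendsto])
       (auto intro!: add_nonneg_nonneg integral_nonneg integrable_continuous_interval continuous_intros)
  then show ?thesis by simp
qed

end

text \<open>Completeness in the sup norm, for the Cauchy criterion behind Mercer's series.\<close>

instance bcontfun :: (metric_space, banach) banach ..

locale sinc_spectrum = sinc_interval c for c :: real +
  fixes ev :: "nat \<Rightarrow> real" and \<phi> :: "nat \<Rightarrow> (real \<Rightarrow>\<^sub>C real)"
  assumes ev_nonneg: "0 \<le> ev n"
    and ev_decseq: "decseq ev"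
    and S_phi: "S (\<phi> n) = ev n *\<^sub>R \<phi> n"
    and phi_orthonormal: "ip (\<phi> n) (\<phi> m) = (if n = m \<and> 0 < ev n then 1 else 0)"
    and phi_zero: "ev n = 0 \<Longrightarrow> \<phi> n = 0"
    and ev_form: "ip (S f) f - (\<Sum>m<n. ev m * (ip f (\<phi> m))\<^sup>2) \<le> ev n * ip f f"

lemma (in sinc_interval) spectrum_exists: "\<exists>ev \<phi>. sinc_spectrum c ev \<phi>"
proof (rule spectral_pos_compact [OF pos_compact_S])
  fix ev \<phi>
  assume "\<And>n. 0 \<le> ev n" "decseq ev" "\<And>n. S (\<phi> n) = ev n *\<^sub>R \<phi> n"
    "\<And>n m. ip (\<phi> n) (\<phi> m) = (if n = m \<and> 0 < ev n then 1 else 0)"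
    "\<And>n. ev n = 0 \<Longrightarrow> \<phi> n = 0"
    "\<And>n x. ip (S x) x - (\<Sum>m<n. ev m * (ip x (\<phi> m))\<^sup>2) \<le> ev n * ip x x"
  then have "sinc_spectrum c ev \<phi>" by unfold_locales
  then show ?thesis by blast
qed

context sinc_spectrum begin

lemma apply_S_phi: "apply_bcontfun (S (\<phi> n)) x = ev n * apply_bcontfun (\<phi> n) x"
  by (simp add: S_phi)

lemma ip_kv_phi: "ip (kv x) (\<phi> n) = ev n * apply_bcontfun (\<phi> n) x"
  using apply_S_phi by (simp add: S_ip)

lemma ev_le_1: "ev n \<le> 1"
proof (cases "0 < ev n")
  case True
  then have "ev n * ev n \<le> ev n"
    using S_contraction [of "\<phi> n"] by (simp add: S_phi ip_simps phi_orthonormal)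
  with True show ?thesis by simp
qed simp

definition comb :: "nat \<Rightarrow> (nat \<Rightarrow> real) \<Rightarrow> (real \<Rightarrow>\<^sub>C real)" where
  "comb N a = (\<Sum>m<N. a m *\<^sub>R \<phi> m)"

lemma apply_comb: "apply_bcontfun (comb N a) x = (\<Sum>m<N. a m * apply_bcontfun (\<phi> m) x)"
  by (simp add: comb_def bcontfun_sum)

lemma S_comb: "S (comb N a) = comb N (\<lambda>m. a m * ev m)"
  by (simp add: comb_def S_sum S_scaleR S_phi)

lemma ip_comb_right: "ip f (comb N a) = (\<Sum>m<N. a m * ip f (\<phi> m))"
  by (simp add: comb_def ip_sum_right ip_simps)

lemma ip_comb_left: "ip (comb N a) f = (\<Sum>m<N. a m * ip f (\<phi> m))"
  by (subst ip_sym) (rule ip_comb_right)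

lemma ip_comb_phi: "m < N \<Longrightarrow> ip (comb N a) (\<phi> m) = (if 0 < ev m then a m else 0)"
  unfolding ip_comb_left
  by (subst sum.remove [of _ m]) (auto simp: phi_orthonormal intro!: sum.neutral)

lemma ip_S_comb: "ip (S (comb N a)) (comb N a) = (\<Sum>m<N. ev m * (a m)\<^sup>2)"
  unfolding S_comb ip_comb_left [of N "\<lambda>m. a m * ev m"]
  using ev_nonneg
  by (intro sum.cong refl)
     (auto simp: ip_comb_phi power2_eq_square le_less)

text \<open>If \<open>s\<close> is the sum, the point form with \<open>a = 1\<close> and this
  combination equals 1 - 2 s + s. It holds for every real \<open>x\<close>, also outside the
  interval.\<close>

lemma diag_sum_le: "(\<Sum>m<N. ev m * (apply_bcontfun (\<phi> m) x)\<^sup>2) \<le> 1"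
  using point_form_nonneg [of 1 "comb N (\<lambda>m. - apply_bcontfun (\<phi> m) x)" x]
  unfolding ip_S_comb
  by (simp add: S_comb apply_comb sum_negf power2_eq_square mult_ac)

lemma diag_summable: "summable (\<lambda>m. ev m * (apply_bcontfun (\<phi> m) x)\<^sup>2)"
  by (rule summableI_nonneg_bounded [of _ 1]) (auto simp: ev_nonneg diag_sum_le)

lemma ev_sum_integral: "(\<Sum>m<N. ev m) = integral {0..c} (\<lambda>x. \<Sum>m<N. ev m * (apply_bcontfun (\<phi> m) x)\<^sup>2)"
proof -
  have "integral {0..c} (\<lambda>x. \<Sum>m<N. ev m * (apply_bcontfun (\<phi> m) x)\<^sup>2) = (\<Sum>m<N. ev m * ip (\<phi> m) (\<phi> m))"
    by (subst integral_sum)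
       (auto intro!: integrable_continuous_interval continuous_intros simp: ip_def power2_eq_square)
  also have "\<dots> = (\<Sum>m<N. ev m)"
    using ev_nonneg by (intro sum.cong) (auto simp: phi_orthonormal le_less)
  finally show ?thesis ..
qed

lemma ev_sum_le: "(\<Sum>m<N. ev m) \<le> c"
proof -
  have "(\<Sum>m<N. ev m) \<le> integral {0..c} (\<lambda>_. 1)"
    unfolding ev_sum_integral
    by (rule integral_le) (auto intro!: integrable_continuous_interval continuous_intros diag_sum_le)
  then show ?thesis using c_pos by simp
qed

lemma ev_summable: "summable ev"
  by (rule summableI_nonneg_bounded [of _ c]) (auto simp: ev_nonneg ev_sum_le)

lemma ev_tendsto_0: "ev \<longlonglongrightarrow> 0"
  by (rule summable_LIMSEQ_zero [OF ev_summable])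

text \<open>\<open>S_point_le\<close> turns the remainder bound \<open>ev_form\<close> into
  smallness uniform in \<open>x\<close>.\<close>

lemma S_proj_le:
  "(apply_bcontfun (S (f - comb N (\<lambda>m. ip f (\<phi> m)))) x)\<^sup>2 \<le> ev N * ip f f"
proof -
  let ?p = "comb N (\<lambda>m. ip f (\<phi> m))"
  have "ip (S ?p) f = (\<Sum>m<N. ev m * (ip f (\<phi> m))\<^sup>2)"
    by (simp add: S_comb ip_comb_left power2_eq_square mult_ac)
  then have "ip (S (f - ?p)) (f - ?p) = ip (S f) f - (\<Sum>m<N. ev m * (ip f (\<phi> m))\<^sup>2)"
    using ip_S_comb [of N "\<lambda>m. ip f (\<phi> m)"] S_sym [of f ?p] ip_sym [of f "S ?p"]
    by (simp add: S_diff ip_simps)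
  then show ?thesis using S_point_le [of "f - ?p" x] ev_form [of f N] by linarith
qed

text \<open>Cauchy--Schwarz with \<open>ev k\<close> split evenly between the two points: the block
  of the diagonal series at \<open>x\<close> is small, and the factor at \<open>y\<close> is at most
  1 for all \<open>y\<close>. Hence the series is Cauchy in the sup norm.\<close>

lemma kernel_series_summable: "summable (\<lambda>m. (ev m * apply_bcontfun (\<phi> m) x) *\<^sub>R \<phi> m)"
  unfolding summable_Cauchy
proof (intro allI impI)
  fix e :: real assume e: "0 < e"
  then have "0 < (e / 2)\<^sup>2" by simp
  then obtain N where N: "\<And>m n. m \<ge> N \<Longrightarrow> norm (\<Sum>k=m..<n. ev k * (apply_bcontfun (\<phi> k) x)\<^sup>2) < (e / 2)\<^sup>2"
    using diag_summable [of x] unfolding summable_Cauchy by blast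
  have "norm (\<Sum>k=m..<n. (ev k * apply_bcontfun (\<phi> k) x) *\<^sub>R \<phi> k) < e" if m: "m \<ge> N" for m n
  proof -
    have "norm (\<Sum>k=m..<n. (ev k * apply_bcontfun (\<phi> k) x) *\<^sub>R \<phi> k) \<le> e / 2"
    proof (rule norm_bound)
      fix y
      let ?a = "\<lambda>k. sqrt (ev k) * apply_bcontfun (\<phi> k) x" and ?b = "\<lambda>k. sqrt (ev k) * apply_bcontfun (\<phi> k) y"
      have sq: "sqrt (ev k) * sqrt (ev k) = ev k" for k using ev_nonneg [of k] by simp
      have "(\<Sum>k=m..<n. ?a k * ?b k)\<^sup>2 \<le> (\<Sum>k=m..<n. (?a k)\<^sup>2) * (\<Sum>k=m..<n. (?b k)\<^sup>2)"
        by (rule Cauchy_Schwarz_ineq_sum)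
      also have "\<dots> \<le> (e / 2)\<^sup>2 * 1"
      proof (rule mult_mono)
        show "(\<Sum>k=m..<n. (?a k)\<^sup>2) \<le> (e / 2)\<^sup>2"
          using N [OF m, of n] ev_nonneg by (simp add: power_mult_distrib)
        have "(\<Sum>k=m..<n. (?b k)\<^sup>2) \<le> (\<Sum>k<n. (?b k)\<^sup>2)"
          by (rule sum_mono2) auto
        also have "\<dots> \<le> 1" using diag_sum_le [of y n] ev_nonneg by (simp add: power_mult_distrib)
        finally show "(\<Sum>k=m..<n. (?b k)\<^sup>2) \<le> 1" .
      qed (auto intro: sum_nonneg)
      finally have "\<bar>\<Sum>k=m..<n. ?a k * ?b k\<bar> \<le> \<bar>e / 2\<bar>" unfolding abs_le_square_iff by simp
      moreover have "?a k * ?b k = ev k * apply_bcontfun (\<phi> k) x * apply_bcontfun (\<phi> k) y" for k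
        using sq [of k] by (metis mult.assoc mult.left_commute)
      ultimately show "norm (apply_bcontfun (\<Sum>k=m..<n. (ev k * apply_bcontfun (\<phi> k) x) *\<^sub>R \<phi> k) y) \<le> e / 2"
        using e by (simp add: bcontfun_sum)
    qed
    then show ?thesis using e by simp
  qed
  then show "\<exists>N. \<forall>m\<ge>N. \<forall>n. norm (\<Sum>k=m..<n. (ev k * apply_bcontfun (\<phi> k) x) *\<^sub>R \<phi> k) < e" by blast
qed

text \<open>The series has a uniform limit \<open>l\<close>, which is the kernel because the partial
  sums also tend to \<open>kv x\<close> in the form. The form sees only \<open>{0..c}\<close>, hence
  the restriction on \<open>y\<close>, while \<open>x\<close> is an arbitrary real.\<close>

theorem mercer:
  assumes y: "y \<in> {0..c}"
  shows "(\<lambda>m. ev m * apply_bcontfun (\<phi> m) x * apply_bcontfun (\<phi> m) y) sums nsinc (x - y)"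
proof -
  obtain l where l: "(\<lambda>m. (ev m * apply_bcontfun (\<phi> m) x) *\<^sub>R \<phi> m) sums l"
    using kernel_series_summable unfolding summable_def by blast
  define R where "R N = comb N (\<lambda>m. ip (kv x) (\<phi> m))" for N
  have Rl: "R \<longlonglongrightarrow> l"
    using l by (simp add: sums_def R_def [abs_def] comb_def ip_kv_phi)
  have nRl: "(\<lambda>N. norm (R N - l)) \<longlonglongrightarrow> 0"
    using Rl by (simp only: tendsto_norm_zero_iff LIM_zero_iff)
  have "(\<lambda>N. c * (norm (R N - l))\<^sup>2) \<longlonglongrightarrow> c * 0\<^sup>2"
    by (intro tendsto_intros nRl)
  then have "(\<lambda>N. c * (norm (R N - l))\<^sup>2) \<longlonglongrightarrow> 0" by simp
  then have 1: "(\<lambda>N. ip (R N - l) (R N - l)) \<longlonglongrightarrow> 0"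
  proof (rule tendsto_sandwich [OF _ _ tendsto_const, rotated 2])
    show "eventually (\<lambda>N. ip (R N - l) (R N - l) \<le> c * (norm (R N - l))\<^sup>2) sequentially"
    proof (rule always_eventually, rule allI, rule ip_le_sup)
      fix N y
      have "\<bar>apply_bcontfun (R N - l) y\<bar> \<le> \<bar>norm (R N - l)\<bar>"
        using norm_bounded [of "R N - l" y] by simp
      then show "(apply_bcontfun (R N - l) y)\<^sup>2 \<le> (norm (R N - l))\<^sup>2" unfolding abs_le_square_iff .
    qed
  qed (simp_all add: ip_nonneg)
  have 2: "(\<lambda>N. ip (kv x - R N) (kv x - R N)) \<longlonglongrightarrow> 0"
  proof -
    \<comment> \<open>The remainder is orthogonal to \<open>R N\<close>, so its form is its inner
      product with \<open>kv x\<close>, that is, a value of \<open>S\<close>.\<close>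
    have eq: "ip (kv x - R N) (kv x - R N) = apply_bcontfun (S (kv x - R N)) x" for N
    proof -
      have "ip (R N) (kv x - R N) = 0"
        unfolding R_def ip_comb_left
      proof (intro sum.neutral ballI)
        fix m assume "m \<in> {..<N}"
        then show "ip (kv x) (\<phi> m) * ip (kv x - comb N (\<lambda>m. ip (kv x) (\<phi> m))) (\<phi> m) = 0"
          using phi_zero [of m] ev_nonneg [of m]
          by (cases "ev m = 0") (simp_all add: ip_diff_left ip_comb_phi)
      qed
      then show ?thesis by (simp add: ip_diff_left S_ip)
    qed
    have le: "(apply_bcontfun (S (kv x - R N)) x)\<^sup>2 \<le> ev N * ip (kv x) (kv x)" for N
      unfolding R_def by (rule S_proj_le)
    have lim: "(\<lambda>N. ev N * ip (kv x) (kv x)) \<longlonglongrightarrow> 0"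
      using tendsto_mult_right [OF ev_tendsto_0] by simp
    have "(\<lambda>N. (apply_bcontfun (S (kv x - R N)) x)\<^sup>2) \<longlonglongrightarrow> 0"
      by (rule tendsto_sandwich [OF _ _ tendsto_const lim]) (use le in simp_all)
    from tendsto_real_sqrt [OF this] have "(\<lambda>N. apply_bcontfun (S (kv x - R N)) x) \<longlonglongrightarrow> 0"
      by (simp add: tendsto_rabs_zero_iff)
    then show ?thesis by (simp only: eq)
  qed
  have "ip (R N - l) (R N - l) = ip (l - R N) (l - R N)" for N
    by (simp add: ip_diff_left ip_diff_right)
  with 1 have 3: "(\<lambda>N. ip (l - R N) (l - R N)) \<longlonglongrightarrow> 0" by simp
  have "(kv x - R N) - (l - R N) = kv x - l" for N by simp
  with ip_tendsto_0_diff [OF 2 3] have "(\<lambda>N::nat. ip (kv x - l) (kv x - l)) \<longlonglongrightarrow> 0" by simp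
  then have "ip (kv x - l) (kv x - l) = 0" by (simp only: LIMSEQ_const_iff)
  moreover have "(integral {0..c} (\<lambda>y. apply_bcontfun (kv x - l) y * apply_bcontfun (kv x - l) y) = 0) =
      (\<forall>y\<in>{0..c}. apply_bcontfun (kv x - l) y * apply_bcontfun (kv x - l) y = 0)"
    by (rule integral_eq_0_iff) (use c_pos in \<open>auto intro!: continuous_intros\<close>)
  ultimately have "apply_bcontfun (kv x - l) y * apply_bcontfun (kv x - l) y = 0"
    using y unfolding ip_def by blast
  then have "apply_bcontfun l y = nsinc (x - y)" by simp
  moreover have "(\<lambda>N. apply_bcontfun (R N) y) \<longlonglongrightarrow> apply_bcontfun l y"
  proof (rule LIM_zero_cancel, rule Lim_null_comparison)
    show "eventually (\<lambda>N. norm (apply_bcontfun (R N) y - apply_bcontfun l y) \<le> norm (R N - l)) sequentially"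
    proof (rule always_eventually, rule allI)
      show "norm (apply_bcontfun (R N) y - apply_bcontfun l y) \<le> norm (R N - l)" for N
        using norm_bounded [of "R N - l" y] by simp
    qed
    show "(\<lambda>N. norm (R N - l)) \<longlonglongrightarrow> 0"
      by (rule nRl)
  qed
  ultimately show ?thesis by (simp add: sums_def R_def apply_comb ip_kv_phi)
qed

theorem ev_sums: "ev sums c"
proof -
  have "(\<lambda>N. integral {0..c} (\<lambda>x. \<Sum>m<N. ev m * (apply_bcontfun (\<phi> m) x)\<^sup>2)) \<longlonglongrightarrow> integral {0..c} (\<lambda>x. 1)"
  proof (rule dominated_convergence(2))
    show "(\<lambda>x. \<Sum>m<N. ev m * (apply_bcontfun (\<phi> m) x)\<^sup>2) integrable_on {0..c}" for N
      by (intro integrable_continuous_interval continuous_intros)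
    show "(\<lambda>_. 1) integrable_on {0..c}" by (rule integrable_const_ivl)
    show "norm (\<Sum>m<N. ev m * (apply_bcontfun (\<phi> m) x)\<^sup>2) \<le> 1" for N x
      using diag_sum_le [of x N] by (simp add: sum_nonneg ev_nonneg)
    show "(\<lambda>N. \<Sum>m<N. ev m * (apply_bcontfun (\<phi> m) x)\<^sup>2) \<longlonglongrightarrow> 1" if "x \<in> {0..c}" for x
      using mercer [OF that, of x] by (simp add: sums_def power2_eq_square mult.assoc)
  qed
  then show ?thesis using c_pos by (simp add: sums_def flip: ev_sum_integral)
qed

end

section \<open>Concentration of the spectrum\<close>

lemma integral_translate:
  fixes f :: "real \<Rightarrow> real"
  assumes "continuous_on {a..b} f"
  shows "integral {a - d..b - d} (\<lambda>x. f (x + d)) = integral {a..b} f"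
proof -
  have "(f has_integral integral {a..b} f) (cbox a b)"
    using assms by (simp add: integrable_continuous_interval integrable_integral)
  from has_integral_affinity' [OF this, of 1 d] show ?thesis by (simp add: integral_unique)
qed

context sinc_spectrum begin

text \<open>Turns a finite-rank approximation into an eigenvalue estimate. Let \<open>m\<close> be
  the form of S - S^2 and \<open>g n\<close> the part of \<open>\<phi> n\<close> orthogonal to the
  span of the \<open>e i\<close>. Summed over \<open>n\<close>, \<open>m (g n) (g n)\<close> is an
  outer integral, which Bessel bounds by the squared distance of the kernel rows from the span:
  \<open>M\<close> for each side. Conversely \<open>m (g n) (g n)\<close> is at least
  \<open>ev n * (1 - ev n)\<close> up to a loss proportional to the projected mass of
  \<open>\<phi> n\<close>, and these masses sum to at most \<open>k\<close>.\<close>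

lemma outer_tail_bound:
  fixes e :: "nat \<Rightarrow> (real \<Rightarrow>\<^sub>C real)" and \<beta> :: "real \<Rightarrow> real"
  assumes W: "finite W" "\<And>n. n \<in> W \<Longrightarrow> ev n * (1 - ev n) \<le> d"
    and left: "\<And>r. 0 \<le> r \<Longrightarrow> \<exists>b. ip (kv (- r) - (\<Sum>i<k. b i *\<^sub>R e i)) (kv (- r) - (\<Sum>i<k. b i *\<^sub>R e i)) \<le> \<beta> r"
    and right: "\<And>r. 0 \<le> r \<Longrightarrow> \<exists>b. ip (kv (c + r) - (\<Sum>i<k. b i *\<^sub>R e i)) (kv (c + r) - (\<Sum>i<k. b i *\<^sub>R e i)) \<le> \<beta> r"
    and \<beta>: "\<And>N. N0 \<le> N \<Longrightarrow> \<exists>I\<le>M. (\<beta> has_integral I) {0..N}"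
    and d: "0 \<le> d"
  shows "(\<Sum>n\<in>W. ev n * (1 - ev n)) \<le> 2 * M + 2 * d * k"
proof -
  obtain K q where K: "K \<le> k"
    and on: "\<And>i j. i < K \<Longrightarrow> j < K \<Longrightarrow> ip (q i) (q j) = (if i = j then 1 else 0)"
    and sp: "\<And>i. i < k \<Longrightarrow> ip (e i - orth_proj K q (e i)) (e i - orth_proj K q (e i)) = 0"
    using orthonormal_basis_exists [of k e] by blast
  \<comment> \<open>For eigenvalue 0 the vector is the dummy 0; the others are orthonormal, and the
    terms left out vanish.\<close>
  define V where "V = {n \<in> W. 0 < ev n}"
  have V: "finite V" "V \<subseteq> W" using W(1) by (auto simp: V_def)
  have on\<phi>: "ip (\<phi> n) (\<phi> m) = (if n = m then 1 else 0)" if "n \<in> V" "m \<in> V" for n m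
    using that by (auto simp: V_def phi_orthonormal)
  define g where "g n = \<phi> n - orth_proj K q (\<phi> n)" for n
  define F where "F x = (\<Sum>n\<in>V. (apply_bcontfun (S (g n)) x)\<^sup>2)" for x
  have Fcont: "continuous_on A F" for A
    unfolding F_def by (intro continuous_intros)
  \<comment> \<open>The projection is moved from \<open>\<phi> n\<close> to the kernel row; Bessel
    then runs over \<open>n\<close>.\<close>
  have Fle: "F x \<le> ip (kv x - orth_proj K q (kv x)) (kv x - orth_proj K q (kv x))" for x
  proof -
    have "apply_bcontfun (S (g n)) x = ip (kv x - orth_proj K q (kv x)) (\<phi> n)" for n
      by (simp add: S_ip g_def ip_diff_left ip_diff_right ip_orth_proj_sym)
    then show ?thesis
      unfolding F_def using Bessel [OF V(1) on\<phi>] by simp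
  qed
  have Fl: "F (- r) \<le> \<beta> r" and Fr: "F (c + r) \<le> \<beta> r" if "0 \<le> r" for r
  proof -
    have Fb: "F x \<le> \<beta> r" if "\<exists>b. ip (kv x - (\<Sum>i<k. b i *\<^sub>R e i)) (kv x - (\<Sum>i<k. b i *\<^sub>R e i)) \<le> \<beta> r" for x
    proof -
      from that obtain b where b: "ip (kv x - (\<Sum>i<k. b i *\<^sub>R e i)) (kv x - (\<Sum>i<k. b i *\<^sub>R e i)) \<le> \<beta> r" ..
      have "ip (kv x - orth_proj K q (kv x)) (kv x - orth_proj K q (kv x))
          \<le> ip (kv x - (\<Sum>i<k. b i *\<^sub>R e i)) (kv x - (\<Sum>i<k. b i *\<^sub>R e i))"
        by (rule orth_proj_best [OF on sp])
      with Fle [of x] b show ?thesis by linarith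
    qed
    show "F (- r) \<le> \<beta> r" "F (c + r) \<le> \<beta> r"
      by (rule Fb [OF left [OF that]], rule Fb [OF right [OF that]])
  qed
  have half: "integral {0..N} (\<lambda>r. F (a * r + b)) \<le> M"
    if "N0 \<le> N" "\<And>r. 0 \<le> r \<Longrightarrow> F (a * r + b) \<le> \<beta> r" for N a b
  proof -
    obtain I where I: "I \<le> M" "(\<beta> has_integral I) {0..N}" using \<beta> [OF \<open>N0 \<le> N\<close>] by blast
    have "((\<lambda>r. F (a * r + b)) has_integral integral {0..N} (\<lambda>r. F (a * r + b))) {0..N}"
      by (intro integrable_integral integrable_continuous_interval continuous_on_compose2 [OF Fcont [of UNIV]] continuous_intros) auto
    moreover have "F (a * r + b) \<le> \<beta> r" if "r \<in> {0..N}" for r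
      using \<open>\<And>r. 0 \<le> r \<Longrightarrow> F (a * r + b) \<le> \<beta> r\<close> [of r] that by simp
    ultimately have "integral {0..N} (\<lambda>r. F (a * r + b)) \<le> I"
      by (rule has_integral_le [OF _ I(2)])
    with I(1) show ?thesis by linarith
  qed
  have outer: "integral {- real N..0} F + integral {c..real N} F \<le> 2 * M" if N: "N0 \<le> real N - c" for N
  proof -
    have "integral {- real N..0} F = integral {0..real N} (\<lambda>r. F (- 1 * r + 0))"
      using Henstock_Kurzweil_Integration.integral_reflect_real [of "real N" 0 "\<lambda>r. F (- r)"] by simp
    also have "\<dots> \<le> M" by (rule half) (use N c_pos Fl in auto)
    finally have 1: "integral {- real N..0} F \<le> M" .
    have "integral {c..real N} F = integral {0..real N - c} (\<lambda>r. F (1 * r + c))"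
      using integral_translate [OF Fcont [of "{c..real N}"], of c] by simp
    also have "\<dots> \<le> M" by (rule half) (use N Fr in \<open>auto simp: add.commute\<close>)
    finally show ?thesis using 1 by simp
  qed
  define m where "m f h = ip (S f) h - ip (S f) (S h)" for f h
  have "(\<lambda>N. \<Sum>n\<in>V. integral {- real N..0} (\<lambda>z. (apply_bcontfun (S (g n)) z)\<^sup>2) + integral {c..real N} (\<lambda>z. (apply_bcontfun (S (g n)) z)\<^sup>2))
      \<longlonglongrightarrow> (\<Sum>n\<in>V. m (g n) (g n))"
    unfolding m_def by (intro tendsto_sum S_outer_integral_tendsto)
  moreover have "(\<Sum>n\<in>V. integral {- real N..0} (\<lambda>z. (apply_bcontfun (S (g n)) z)\<^sup>2) + integral {c..real N} (\<lambda>z. (apply_bcontfun (S (g n)) z)\<^sup>2))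
      = integral {- real N..0} F + integral {c..real N} F" for N
  proof -
    have "integral {a..b} F = (\<Sum>n\<in>V. integral {a..b} (\<lambda>z. (apply_bcontfun (S (g n)) z)\<^sup>2))" for a b
      unfolding F_def by (rule integral_sum [OF V(1)]) (intro integrable_continuous_interval continuous_intros)
    then show ?thesis by (simp add: sum.distrib)
  qed
  ultimately have "(\<lambda>N. integral {- real N..0} F + integral {c..real N} F) \<longlonglongrightarrow> (\<Sum>n\<in>V. m (g n) (g n))" by simp
  then have "(\<Sum>n\<in>V. m (g n) (g n)) \<le> 2 * M"
    by (rule LIMSEQ_le_const2) (intro exI[of _ "nat \<lceil>N0 + c\<rceil>"] allI impI outer, linarith)
  \<comment> \<open>Expanding at \<phi> n minus its projection, the two cross terms give the factor
    2, because \<open>\<phi> n\<close> is an eigenvector, and the nonnegative \<open>m ?p ?p\<close>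
    is dropped.\<close>
  moreover have "ev n * (1 - ev n) * (1 - 2 * (\<Sum>j<K. (ip (q j) (\<phi> n))\<^sup>2)) \<le> m (g n) (g n)" if "n \<in> V" for n
  proof -
    have m\<phi>: "m (\<phi> n) h = ev n * (1 - ev n) * ip (\<phi> n) h" for h
      using S_sym [of "\<phi> n" h] by (simp add: m_def S_phi ip_simps algebra_simps)
    have msym: "m h f = m f h" for f h
      unfolding m_def using S_sym [of h f] ip_sym [of "S f" h] ip_sym [of "S f" "S h"] by simp
    let ?p = "orth_proj K q (\<phi> n)"
    have "m (g n) (g n) = m (\<phi> n) (\<phi> n) - 2 * m (\<phi> n) ?p + m ?p ?p"
      using msym [of "\<phi> n" ?p] by (simp add: g_def m_def S_diff ip_diff_left ip_diff_right)
    moreover have "0 \<le> m ?p ?p" using S_contraction [of ?p] by (simp add: m_def)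
    moreover have "ip (\<phi> n) ?p = (\<Sum>j<K. (ip (q j) (\<phi> n))\<^sup>2)"
      unfolding ip_orth_proj power2_eq_square using ip_sym [of "\<phi> n"] by simp
    moreover have "ip (\<phi> n) (\<phi> n) = 1" using on\<phi> [OF that that] by simp
    ultimately show ?thesis by (simp add: m\<phi> algebra_simps)
  qed
  then have "(\<Sum>n\<in>V. ev n * (1 - ev n) * (1 - 2 * (\<Sum>j<K. (ip (q j) (\<phi> n))\<^sup>2))) \<le> (\<Sum>n\<in>V. m (g n) (g n))"
    by (rule sum_mono)
  moreover have "(\<Sum>n\<in>V. ev n * (1 - ev n) * (1 - 2 * (\<Sum>j<K. (ip (q j) (\<phi> n))\<^sup>2))) =
      (\<Sum>n\<in>V. ev n * (1 - ev n)) - 2 * (\<Sum>n\<in>V. ev n * (1 - ev n) * (\<Sum>j<K. (ip (q j) (\<phi> n))\<^sup>2))"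
    by (simp add: right_diff_distrib sum_subtractf sum_distrib_left mult_ac)
  moreover have "(\<Sum>n\<in>V. ev n * (1 - ev n) * (\<Sum>j<K. (ip (q j) (\<phi> n))\<^sup>2)) \<le> d * k"
  proof -
    have "(\<Sum>n\<in>V. ev n * (1 - ev n) * (\<Sum>j<K. (ip (q j) (\<phi> n))\<^sup>2)) \<le> (\<Sum>n\<in>V. d * (\<Sum>j<K. (ip (q j) (\<phi> n))\<^sup>2))"
      by (intro sum_mono mult_right_mono sum_nonneg) (use W V in auto)
    also have "\<dots> = d * (\<Sum>j<K. \<Sum>n\<in>V. (ip (q j) (\<phi> n))\<^sup>2)"
      by (simp add: sum.swap [of _ V] flip: sum_distrib_left)
    also have "\<dots> \<le> d * (\<Sum>j<K. 1)"
    proof (intro mult_left_mono sum_mono d)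
      fix j assume "j \<in> {..<K}"
      then show "(\<Sum>n\<in>V. (ip (q j) (\<phi> n))\<^sup>2) \<le> 1"
        using Bessel [OF V(1) on\<phi>, of "q j"] on [of j j] by simp
    qed
    also have "\<dots> \<le> d * k" using K d by (simp add: mult_left_mono)
    finally show ?thesis .
  qed
  moreover have "(\<Sum>n\<in>W. ev n * (1 - ev n)) = (\<Sum>n\<in>V. ev n * (1 - ev n))"
    by (rule sum.mono_neutral_right) (use W(1) ev_nonneg in \<open>auto simp: V_def less_le\<close>)
  ultimately show ?thesis by simp
qed

end

text \<open>
  In \<open>sin (\<pi> (v + \<tau>)) / (\<pi> (v + \<tau>)) = (cos (\<pi> \<tau>) sin (\<pi> v) + sin (\<pi> \<tau>) cos (\<pi> v)) / (\<pi> (v + \<tau>))\<close> the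
  denominators are replaced by \<open>\<pi> v\<close> and by the nonsingular \<open>\<pi> (1 + \<bar>v\<bar>)\<close>.
\<close>

definition quad :: "real \<Rightarrow> real" where
  "quad v = cos (pi * v) / (pi * (1 + \<bar>v\<bar>))"

lemma continuous_quad_comp [continuous_intros]:
  fixes A :: "'a::t2_space set"
  assumes "continuous_on A f"
  shows "continuous_on A (\<lambda>x. quad (f x))"
proof -
  have "continuous_on A (\<lambda>x. cos (pi * f x))"
    by (rule continuous_on_cos) (intro continuous_intros assms)
  then show ?thesis
    unfolding quad_def
    by (rule continuous_on_divide) (auto intro!: continuous_intros assms simp: add_nonneg_eq_0_iff)
qed

lemma quad_abs_le: "\<bar>quad v\<bar> \<le> 1 / pi"
proof -
  have "\<bar>quad v\<bar> = \<bar>cos (pi * v)\<bar> / (pi * (1 + \<bar>v\<bar>))"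
    by (simp add: quad_def abs_mult)
  also have "\<dots> \<le> 1 / (pi * 1)"
    by (rule frac_le) auto
  finally show ?thesis by simp
qed

text \<open>For \<open>v < 1\<close>, three Lipschitz bounds add up to at most
  \<open>8 * \<tau>\<close>, and (1 + v)^2 \<le> 4 makes this 32. For \<open>v \<ge> 1\<close>, each
  replaced denominator costs \<tau> / v^2. The quadratic decay in \<open>v\<close> is what makes the
  squared error small far from the interval.\<close>

lemma nsinc_shift_error:
  assumes v: "0 \<le> v" and \<tau>: "0 \<le> \<tau>"
  shows "\<bar>nsinc (v + \<tau>) - cos (pi * \<tau>) * nsinc v - sin (pi * \<tau>) * quad v\<bar> \<le> 32 * \<tau> / (1 + v)\<^sup>2"
proof -
  have sin\<tau>: "\<bar>sin (pi * \<tau>)\<bar> \<le> pi * \<tau>" using abs_sin_x_le_abs_x [of "pi * \<tau>"] \<tau> by simp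
  show ?thesis
  proof (cases "v < 1")
    case True
    have "\<bar>nsinc (v + \<tau>) - nsinc v\<bar> \<le> pi * \<tau>"
      using nsinc_Lipschitz [of "v + \<tau>" v] \<tau> by simp
    moreover have "\<bar>(1 - cos (pi * \<tau>)) * nsinc v\<bar> \<le> pi * \<tau> * 1"
      unfolding abs_mult
      using cos_diff_le [of 0 "pi * \<tau>"] \<tau> by (intro mult_mono nsinc_abs_le_1) auto
    moreover have "\<bar>sin (pi * \<tau>) * quad v\<bar> \<le> pi * \<tau> * (1 / pi)"
      unfolding abs_mult by (intro mult_mono sin\<tau> quad_abs_le) (use \<tau> in auto)
    moreover have "nsinc (v + \<tau>) - cos (pi * \<tau>) * nsinc v - sin (pi * \<tau>) * quad v =
       (nsinc (v + \<tau>) - nsinc v) + (1 - cos (pi * \<tau>)) * nsinc v - sin (pi * \<tau>) * quad v"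
      by (simp add: algebra_simps)
    moreover have "pi * \<tau> * (1 / pi) = \<tau>" by simp
    ultimately have "\<bar>nsinc (v + \<tau>) - cos (pi * \<tau>) * nsinc v - sin (pi * \<tau>) * quad v\<bar> \<le> 2 * (pi * \<tau>) + \<tau>"
      by linarith
    also have "\<dots> \<le> 2 * (4 * \<tau>) - 1 * \<tau> + \<tau>"
      using mult_right_mono [of pi "7/2" \<tau>] pi_less_4 pi_approx \<tau> by simp
    also have "\<dots> = 8 * \<tau>" by simp
    also have "\<dots> \<le> 32 * \<tau> / (1 + v)\<^sup>2"
    proof -
      have "(1 + v)\<^sup>2 \<le> 2\<^sup>2" by (rule power_mono) (use v True in auto)
      then have "8 * \<tau> * (1 + v)\<^sup>2 \<le> 8 * \<tau> * 4" by (intro mult_left_mono) (use \<tau> in auto)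
      then show ?thesis using v by (simp add: pos_le_divide_eq)
    qed
    finally show ?thesis .
  next
    case False
    then have v1: "1 \<le> v" by simp
    have vt: "0 < v + \<tau>" using v1 \<tau> by simp
    let ?s = "sin (pi * v)" and ?c = "cos (pi * v)" and ?st = "sin (pi * \<tau>)" and ?ct = "cos (pi * \<tau>)"
    have "nsinc (v + \<tau>) = (?s * ?ct + ?c * ?st) / (pi * (v + \<tau>))"
      using vt by (simp add: nsinc_neq distrib_left sin_add)
    moreover have "nsinc v = ?s / (pi * v)" using v1 by (simp add: nsinc_neq)
    moreover have "quad v = ?c / (pi * (1 + v))" using v by (simp add: quad_def)
    ultimately have "nsinc (v + \<tau>) - ?ct * nsinc v - ?st * quad v
        = ?s * ?ct / pi * (1 / (v + \<tau>) - 1 / v) + ?c * ?st / pi * (1 / (v + \<tau>) - 1 / (1 + v))"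
      by (simp add: algebra_simps add_divide_distrib diff_divide_distrib)
    moreover have "\<bar>?s * ?ct / pi * (1 / (v + \<tau>) - 1 / v)\<bar> \<le> \<tau> / v\<^sup>2"
    proof -
      have "\<bar>1 / (v + \<tau>) - 1 / v\<bar> = \<tau> / (v * (v + \<tau>))"
        using v1 vt \<tau> by (simp add: divide_simps)
      also have "\<dots> \<le> \<tau> / v\<^sup>2"
        unfolding power2_eq_square by (rule divide_left_mono) (use v1 \<tau> vt in auto)
      finally have 1: "\<bar>1 / (v + \<tau>) - 1 / v\<bar> \<le> \<tau> / v\<^sup>2" .
      have "\<bar>?s\<bar> * \<bar>?ct\<bar> \<le> 1 * 1" by (rule mult_mono) auto
      then have "\<bar>?s * ?ct / pi\<bar> \<le> 1" using pi_gt3 by (simp add: abs_mult divide_simps)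
      from mult_mono [OF this 1] show ?thesis using \<tau> by (simp add: abs_mult)
    qed
    moreover have "\<bar>?c * ?st / pi * (1 / (v + \<tau>) - 1 / (1 + v))\<bar> \<le> \<tau> / v\<^sup>2"
    proof -
      \<comment> \<open>\<open>1 - \<tau>\<close> is the difference of the denominators
        \<open>1 + v\<close> and \<open>v + \<tau>\<close>. It is unbounded, so for large
        \<open>\<tau>\<close> the sine is bounded by 1 instead of
        \<open>pi * \<tau>\<close>.\<close>
      have "\<bar>?st\<bar> * \<bar>1 - \<tau>\<bar> \<le> pi * \<tau>"
      proof (cases "\<tau> \<le> 1")
        case True
        then have "\<bar>?st\<bar> * \<bar>1 - \<tau>\<bar> \<le> (pi * \<tau>) * 1" by (intro mult_mono sin\<tau>) (use \<tau> in auto)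
        then show ?thesis by simp
      next
        case False
        then have "\<bar>?st\<bar> * \<bar>1 - \<tau>\<bar> \<le> 1 * \<tau>" by (intro mult_mono) auto
        also have "\<dots> \<le> pi * \<tau>" using pi_gt3 \<tau> by (intro mult_right_mono) auto
        finally show ?thesis .
      qed
      then have "\<bar>?c\<bar> * (\<bar>?st\<bar> * \<bar>1 - \<tau>\<bar>) \<le> 1 * (pi * \<tau>)" by (rule mult_mono [OF abs_cos_le_one]) auto
      moreover have "1 / (v + \<tau>) - 1 / (1 + v) = (1 - \<tau>) / ((v + \<tau>) * (1 + v))"
        using v1 vt by (simp add: divide_simps)
      then have "\<bar>?c * ?st / pi * (1 / (v + \<tau>) - 1 / (1 + v))\<bar> = \<bar>?c\<bar> * (\<bar>?st\<bar> * \<bar>1 - \<tau>\<bar>) / (pi * ((v + \<tau>) * (1 + v)))"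
        using v1 vt by (simp add: abs_mult)
      moreover have "0 < pi * ((v + \<tau>) * (1 + v))" using v1 vt by simp
      ultimately have "\<bar>?c * ?st / pi * (1 / (v + \<tau>) - 1 / (1 + v))\<bar> \<le> (pi * \<tau>) / (pi * ((v + \<tau>) * (1 + v)))"
        by (simp only: mult_1) (rule divide_right_mono, simp_all)
      also have "\<dots> = \<tau> / ((v + \<tau>) * (1 + v))" by simp
      also have "\<dots> \<le> \<tau> / v\<^sup>2"
        unfolding power2_eq_square by (rule divide_left_mono) (use v1 \<tau> vt in \<open>auto intro: mult_mono\<close>)
      finally show ?thesis .
    qed
    ultimately have "\<bar>nsinc (v + \<tau>) - ?ct * nsinc v - ?st * quad v\<bar> \<le> 2 * (\<tau> / v\<^sup>2)" by linarith
    also have "\<dots> = 8 * \<tau> / (2 * v)\<^sup>2" by (simp add: power2_eq_square)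
    also have "\<dots> \<le> 8 * \<tau> / (1 + v)\<^sup>2"
      using power_mono [of "1 + v" "2 * v" 2] v1 \<tau> by (intro divide_left_mono) auto
    also have "\<dots> \<le> 32 * \<tau> / (1 + v)\<^sup>2" using \<tau> by (intro divide_right_mono) auto
    finally show ?thesis .
  qed
qed

section \<open>Approximation on cells in geometric progression\<close>

lemma has_integral_inverse_quartic:
  fixes s c :: real
  assumes "0 \<le> s" "0 \<le> c"
  shows "((\<lambda>y. 1 / (1 + (s + y)) ^ 4) has_integral 1 / (3 * (1 + s) ^ 3) - 1 / (3 * (1 + (s + c)) ^ 3)) {0..c}"
proof -
  have "((\<lambda>y. 1 / (1 + (s + y)) ^ 4) has_integral
      (- (1 / 3) * (inverse (1 + (s + c))) ^ 3) - (- (1 / 3) * (inverse (1 + (s + 0))) ^ 3)) {0..c}"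
  proof (rule fundamental_theorem_of_calculus [OF assms(2)])
    fix y assume y: "y \<in> {0..c}"
    define u where "u = inverse (1 + (s + y))"
    have "((\<lambda>y. 1 + (s + y)) has_real_derivative 1) (at y within {0..c})"
      by (auto intro!: derivative_eq_intros)
    from DERIV_inverse' [OF this]
    have "((\<lambda>y. inverse (1 + (s + y))) has_real_derivative - (u * 1 * u)) (at y within {0..c})"
      unfolding u_def using y assms by simp
    from DERIV_cmult [OF DERIV_power [OF this, of 3], of "- (1 / 3)"]
    have "((\<lambda>y. - (1 / 3) * (inverse (1 + (s + y))) ^ 3) has_real_derivative
        - (1 / 3) * (- (u * 1 * u) * (real 3 * u ^ (3 - Suc 0)))) (at y within {0..c})"
      unfolding u_def by (simp only: mult_ac)
    moreover have "- (1 / 3) * (- (u * 1 * u) * (real 3 * u ^ (3 - Suc 0))) = u ^ 4"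
      by (simp add: eval_nat_numeral)
    moreover have "1 / (1 + (s + y)) ^ 4 = u ^ 4"
      unfolding u_def by (simp only: power_inverse divide_inverse mult_1)
    ultimately show "((\<lambda>y. - (1 / 3) * (inverse (1 + (s + y))) ^ 3) has_vector_derivative 1 / (1 + (s + y)) ^ 4) (at y within {0..c})"
      unfolding has_real_derivative_iff_has_vector_derivative [symmetric] by (simp only:)
  qed
  moreover have w: "1 / (3 * w ^ 3) = 1 / 3 * (inverse w) ^ 3" for w :: real
    by (simp add: inverse_eq_divide power_divide)
  ultimately show ?thesis unfolding w by simp
qed

lemma geometric_cell:
  fixes x :: real
  assumes "1 \<le> x" "x \<le> (1 + h) ^ k" "0 < k" "0 \<le> h"
  shows "\<exists>i<k. (1 + h) ^ i \<le> x \<and> x \<le> (1 + h) ^ Suc i"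
  using assms
proof (induction k)
  case (Suc k)
  show ?case
  proof (cases "x \<le> (1 + h) ^ k \<and> 0 < k")
    case True
    then have "\<exists>i<k. (1 + h) ^ i \<le> x \<and> x \<le> (1 + h) ^ Suc i"
      using Suc.IH Suc.prems by simp
    then show ?thesis using less_SucI by blast
  next
    case False
    then have "(1 + h) ^ k \<le> x" using Suc.prems(1) by (cases "k = 0") simp_all
    with Suc.prems(2) have "(1 + h) ^ k \<le> x \<and> x \<le> (1 + h) ^ Suc k" by (rule conjI [rotated])
    then show ?thesis using lessI by blast
  qed
qed simp

context sinc_interval begin

definition quadv_left :: "real \<Rightarrow> (real \<Rightarrow>\<^sub>C real)" where
  "quadv_left s = Bcontfun (\<lambda>y. quad (s + y))"

definition quadv_right :: "real \<Rightarrow> (real \<Rightarrow>\<^sub>C real)" where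
  "quadv_right s = Bcontfun (\<lambda>y. quad (s + (c - y)))"

lemma apply_quadv [simp]:
  "apply_bcontfun (quadv_left s) y = quad (s + y)" "apply_bcontfun (quadv_right s) y = quad (s + (c - y))"
  unfolding quadv_left_def quadv_right_def
  by (subst Bcontfun_inverse, auto intro!: bcontfun_normI [of _ "1 / pi"] continuous_intros simp: quad_abs_le)+

text \<open>342 rounds up 32^2 / 3: the pointwise error is squared, and the inverse fourth power
  integrates to a third of the inverse cube.\<close>

lemma cell_error_integral:
  assumes s: "0 \<le> s" and \<tau>: "0 \<le> \<tau>"
  shows "integral {0..c} (\<lambda>y. (nsinc (s + y + \<tau>) - cos (pi * \<tau>) * nsinc (s + y) - sin (pi * \<tau>) * quad (s + y))\<^sup>2)
      \<le> 342 * \<tau>\<^sup>2 / (1 + s) ^ 3"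
proof -
  let ?E = "\<lambda>y. nsinc (s + y + \<tau>) - cos (pi * \<tau>) * nsinc (s + y) - sin (pi * \<tau>) * quad (s + y)"
  have "((\<lambda>y. (?E y)\<^sup>2) has_integral integral {0..c} (\<lambda>y. (?E y)\<^sup>2)) {0..c}"
    by (intro integrable_integral integrable_continuous_interval continuous_intros)
  moreover have "((\<lambda>y. 1024 * \<tau>\<^sup>2 * (1 / (1 + (s + y)) ^ 4)) has_integral
      1024 * \<tau>\<^sup>2 * (1 / (3 * (1 + s) ^ 3) - 1 / (3 * (1 + (s + c)) ^ 3))) {0..c}"
    by (intro has_integral_mult_right has_integral_inverse_quartic) (use s c_pos in auto)
  ultimately have "integral {0..c} (\<lambda>y. (?E y)\<^sup>2) \<le> 1024 * \<tau>\<^sup>2 * (1 / (3 * (1 + s) ^ 3) - 1 / (3 * (1 + (s + c)) ^ 3))"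
  proof (rule has_integral_le)
    fix y assume y: "y \<in> {0..c}"
    have "\<bar>?E y\<bar> \<le> 32 * \<tau> / (1 + (s + y))\<^sup>2"
      by (rule nsinc_shift_error) (use s y \<tau> in auto)
    then have "\<bar>?E y\<bar>\<^sup>2 \<le> (32 * \<tau> / (1 + (s + y))\<^sup>2)\<^sup>2"
      by (rule power_mono) simp
    also have "\<dots> = 1024 * \<tau>\<^sup>2 * (1 / (1 + (s + y)) ^ 4)"
      by (simp add: power_divide power_mult_distrib flip: power_mult)
    finally show "(?E y)\<^sup>2 \<le> 1024 * \<tau>\<^sup>2 * (1 / (1 + (s + y)) ^ 4)" by simp
  qed
  also have "\<dots> \<le> 1024 * \<tau>\<^sup>2 * (1 / (3 * (1 + s) ^ 3))"
    using s c_pos by (intro mult_left_mono) auto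
  also have "\<dots> = (1024 / 3) * \<tau>\<^sup>2 / (1 + s) ^ 3" by simp
  also have "\<dots> \<le> 342 * \<tau>\<^sup>2 / (1 + s) ^ 3"
    by (intro divide_right_mono mult_right_mono) (use s in auto)
  finally show ?thesis .
qed

lemma integral_reflect_interval:
  assumes "continuous_on {0..c} f"
  shows "integral {0..c} (\<lambda>y. f (c - y)) = integral {0..c} (f :: real \<Rightarrow> real)"
proof -
  have "integral {0..c} f = integral {- c..0} (\<lambda>y. f (y + c))"
    using integral_translate [OF assms, of c] by simp
  also have "\<dots> = integral {0..c} (\<lambda>y. f (c - y))"
    using Henstock_Kurzweil_Integration.integral_reflect_real [of 0 "- c" "\<lambda>y. f (y + c)"] by (simp add: add.commute)
  finally show ?thesis by simp
qed

lemma far_integral: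
  assumes r: "0 < r"
  shows "integral {0..c} (\<lambda>y. (nsinc (r + y))\<^sup>2) \<le> c / r\<^sup>2"
proof -
  have "integral {0..c} (\<lambda>y. (nsinc (r + y))\<^sup>2) \<le> integral {0..c} (\<lambda>_. 1 / r\<^sup>2)"
  proof (rule integral_le)
    fix y assume y: "y \<in> {0..c}"
    have "\<bar>nsinc (r + y)\<bar> \<le> 1 / (pi * \<bar>r + y\<bar>)" by (rule nsinc_abs_le) (use r y in auto)
    also have "\<dots> \<le> 1 / (1 * r)" using r y pi_gt3 by (intro divide_left_mono mult_mono) auto
    finally have "\<bar>nsinc (r + y)\<bar>\<^sup>2 \<le> (1 / r)\<^sup>2" by (intro power_mono) auto
    then show "(nsinc (r + y))\<^sup>2 \<le> 1 / r\<^sup>2" by (simp add: power_divide)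
  qed (intro integrable_continuous_interval continuous_intros)+
  then show ?thesis using c_pos by simp
qed

end

lemma sum_two_terms:
  fixes e :: "nat \<Rightarrow> 'a::real_vector"
  assumes "p < n" "q < n" "p \<noteq> q"
  shows "(\<Sum>j<n. (if j = p then x else if j = q then y else 0) *\<^sub>R e j) = x *\<^sub>R e p + y *\<^sub>R e q"
proof -
  have "(\<Sum>j<n. (if j = p then x else if j = q then y else 0) *\<^sub>R e j)
      = (\<Sum>j\<in>{p, q}. (if j = p then x else if j = q then y else 0) *\<^sub>R e j)"
    by (rule sum.mono_neutral_right) (use assms in auto)
  also have "\<dots> = x *\<^sub>R e p + y *\<^sub>R e q"
    using assms(3) by simp
  finally show ?thesis .
qed

context sinc_spectrum begin

text \<open>The left ends \<open>s i\<close> of the cells satisfy 1 + s i = (1 + 1/m)^i, so each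
  cell has length \<open>(1 + s i) / m\<close>. A cell needs two vectors on each side of the
  interval, \<open>4 * k\<close> in all, whence \<open>8 * d * k\<close>. Beyond \<open>R\<close>,
  which is at least c m^2, the kernel is approximated by 0.\<close>

lemma spectral_tail_bound_cells:
  fixes m k :: nat and d :: real
  assumes W: "finite W" "\<And>n. n \<in> W \<Longrightarrow> ev n * (1 - ev n) \<le> d" and d: "0 \<le> d"
    and m: "0 < m" and k: "0 < k" and mk: "1 + c * m\<^sup>2 \<le> (1 + 1 / m) ^ k"
  shows "(\<Sum>n\<in>W. ev n * (1 - ev n)) \<le> 1368 * k / m ^ 3 + 2 / m\<^sup>2 + 8 * d * k"
proof -
  define h where "h = 1 / real m"
  have h: "0 < h" "h \<le> 1" using m by (auto simp: h_def)
  define s where "s i = (1 + h) ^ i - 1" for i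
  have s0: "0 \<le> s i" for i using h by (simp add: s_def one_le_power)
  define R where "R = (1 + h) ^ k - 1"
  have Rc: "c * m\<^sup>2 \<le> R" using mk by (simp add: R_def h_def)
  have R: "0 < R" by (rule less_le_trans [OF _ Rc]) (use c_pos m in simp)
  \<comment> \<open>684 = 2 * 342: inside a cell \<open>1 + r \<le> 2 * (1 + s i)\<close>, because
    \<open>h \<le> 1\<close>.\<close>
  define A where "A = 684 * h\<^sup>2"
  define \<beta> where "\<beta> r = (if r \<le> R then A / (1 + r) else c / r\<^sup>2)" for r
  \<comment> \<open>Positions \<open>4 * i\<close> to \<open>4 * i + 3\<close> hold the vectors of
    cell \<open>i\<close>: two for the left side, then two for the right.\<close>
  define e where "e j = (if j mod 4 = 0 then kv (- s (j div 4)) else if j mod 4 = 1 then quadv_left (s (j div 4))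
     else if j mod 4 = 2 then kv (c + s (j div 4)) else quadv_right (s (j div 4)))" for j :: nat
  have dm: "(4 * i + j) div 4 = i" "(4 * i + j) mod 4 = j" if "j < 4" for i j :: nat
    using that by simp_all
  have e: "e (4 * i + 0) = kv (- s i)" "e (4 * i + 1) = quadv_left (s i)"
    "e (4 * i + 2) = kv (c + s i)" "e (4 * i + 3) = quadv_right (s i)" for i
    by (simp_all only: e_def dm, simp_all)
  have cell: "\<exists>i<k. s i \<le> r \<and> 342 * (r - s i)\<^sup>2 / (1 + s i) ^ 3 \<le> A / (1 + r)" if r: "0 \<le> r" "r \<le> R" for r
  proof -
    obtain i where i: "i < k" "(1 + h) ^ i \<le> 1 + r" "1 + r \<le> (1 + h) ^ Suc i"
      using geometric_cell [of "1 + r" h k] r h k by (auto simp: R_def)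
    have si: "1 + s i = (1 + h) ^ i" by (simp add: s_def)
    have \<tau>: "0 \<le> r - s i" "r - s i \<le> h * (1 + s i)"
      using i by (simp_all add: s_def algebra_simps)
    have "342 * (r - s i)\<^sup>2 / (1 + s i) ^ 3 \<le> 342 * (h * (1 + s i))\<^sup>2 / (1 + s i) ^ 3"
      using \<tau> s0 [of i] by (intro divide_right_mono mult_left_mono power_mono) auto
    also have "\<dots> = A / (2 * (1 + s i))"
    proof -
      have "342 * (h * u)\<^sup>2 / u ^ 3 = 684 * h\<^sup>2 / (2 * u)" if "0 < u" for u :: real
        using that by (simp add: field_simps power2_eq_square power3_eq_cube)
      from this [of "1 + s i"] show ?thesis using s0 [of i] by (simp add: A_def)
    qed
    also have "\<dots> \<le> A / (1 + r)"
    proof (rule divide_left_mono)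
      have "1 + r \<le> (1 + h) * (1 + s i)" using i(3) by (simp add: si)
      also have "\<dots> \<le> 2 * (1 + s i)" using h s0 [of i] by (intro mult_right_mono) auto
      finally show "1 + r \<le> 2 * (1 + s i)" .
    qed (use r s0 [of i] in \<open>auto simp: A_def\<close>)
    finally show ?thesis using i(1) \<tau>(1) by auto
  qed
  have "(\<Sum>n\<in>W. ev n * (1 - ev n)) \<le> 2 * (684 * k / m ^ 3 + 1 / m\<^sup>2) + 2 * d * real (4 * k)"
  proof (rule outer_tail_bound [where e = e and \<beta> = \<beta> and ?N0.0 = R])
    fix r :: real assume r: "0 \<le> r"
    show "\<exists>b. ip (kv (- r) - (\<Sum>i<4 * k. b i *\<^sub>R e i)) (kv (- r) - (\<Sum>i<4 * k. b i *\<^sub>R e i)) \<le> \<beta> r"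
    proof (cases "r \<le> R")
      case True
      from cell [OF r True] obtain i where i: "i < k" "s i \<le> r" "342 * (r - s i)\<^sup>2 / (1 + s i) ^ 3 \<le> A / (1 + r)"
        by blast
      define b where "b j = (if j = 4 * i + 0 then cos (pi * (r - s i)) else if j = 4 * i + 1 then sin (pi * (r - s i)) else 0)" for j :: nat
      have sum: "(\<Sum>j<4 * k. b j *\<^sub>R e j) = cos (pi * (r - s i)) *\<^sub>R kv (- s i) + sin (pi * (r - s i)) *\<^sub>R quadv_left (s i)"
        unfolding b_def e(1,2) [symmetric] by (rule sum_two_terms) (use i in auto)
      have "apply_bcontfun (kv (- r) - (\<Sum>j<4 * k. b j *\<^sub>R e j)) y =
          nsinc (s i + y + (r - s i)) - cos (pi * (r - s i)) * nsinc (s i + y) - sin (pi * (r - s i)) * quad (s i + y)" for y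
      proof -
        have "nsinc (- r - y) = nsinc (s i + y + (r - s i))"
          using nsinc_minus [of "r + y"] by (simp add: add.commute)
        moreover have "nsinc (- s i - y) = nsinc (s i + y)"
          using nsinc_minus [of "s i + y"] by simp
        ultimately show ?thesis
          by (simp only: bcontfun_diff bcontfun_add bcontfun_scaleR apply_kv apply_quadv real_scaleR_def sum)
      qed
      then have "ip (kv (- r) - (\<Sum>j<4 * k. b j *\<^sub>R e j)) (kv (- r) - (\<Sum>j<4 * k. b j *\<^sub>R e j))
          \<le> 342 * (r - s i)\<^sup>2 / (1 + s i) ^ 3"
        using cell_error_integral [OF s0 [of i], of "r - s i"] i(2) by (simp only: ip_def power2_eq_square)
      then show ?thesis using i(3) True by (intro exI [of _ b]) (simp add: \<beta>_def)
    next
      case False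
      have "ip (kv (- r)) (kv (- r)) \<le> c / r\<^sup>2"
        using far_integral [of r] False R nsinc_minus [of "r + _"] by (simp add: ip_def power2_eq_square)
      then show ?thesis using False by (intro exI [of _ "\<lambda>_. 0"]) (simp add: \<beta>_def)
    qed
    show "\<exists>b. ip (kv (c + r) - (\<Sum>i<4 * k. b i *\<^sub>R e i)) (kv (c + r) - (\<Sum>i<4 * k. b i *\<^sub>R e i)) \<le> \<beta> r"
    proof (cases "r \<le> R")
      case True
      from cell [OF r True] obtain i where i: "i < k" "s i \<le> r" "342 * (r - s i)\<^sup>2 / (1 + s i) ^ 3 \<le> A / (1 + r)"
        by blast
      define b where "b j = (if j = 4 * i + 2 then cos (pi * (r - s i)) else if j = 4 * i + 3 then sin (pi * (r - s i)) else 0)" for j :: nat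
      have sum: "(\<Sum>j<4 * k. b j *\<^sub>R e j) = cos (pi * (r - s i)) *\<^sub>R kv (c + s i) + sin (pi * (r - s i)) *\<^sub>R quadv_right (s i)"
        unfolding b_def e(3,4) [symmetric] by (rule sum_two_terms) (use i in auto)
      define E where "E y = nsinc (s i + y + (r - s i)) - cos (pi * (r - s i)) * nsinc (s i + y) - sin (pi * (r - s i)) * quad (s i + y)" for y
      have "apply_bcontfun (kv (c + r) - (\<Sum>j<4 * k. b j *\<^sub>R e j)) y = E (c - y)" for y
      proof -
        have "c + r - y = s i + (c - y) + (r - s i)" "c + s i - y = s i + (c - y)" by simp_all
        then show ?thesis
          by (simp only: bcontfun_diff bcontfun_add bcontfun_scaleR apply_kv apply_quadv real_scaleR_def sum E_def)
      qed
      then have "ip (kv (c + r) - (\<Sum>j<4 * k. b j *\<^sub>R e j)) (kv (c + r) - (\<Sum>j<4 * k. b j *\<^sub>R e j))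
          = integral {0..c} (\<lambda>y. (E (c - y))\<^sup>2)"
        by (simp only: ip_def power2_eq_square)
      also have "\<dots> = integral {0..c} (\<lambda>y. (E y)\<^sup>2)"
        by (rule integral_reflect_interval) (unfold E_def, intro continuous_intros)
      also have "\<dots> \<le> 342 * (r - s i)\<^sup>2 / (1 + s i) ^ 3"
        unfolding E_def by (rule cell_error_integral) (use s0 i in auto)
      finally show ?thesis using i(3) True by (intro exI [of _ b]) (simp add: \<beta>_def)
    next
      case False
      have "ip (kv (c + r)) (kv (c + r)) = integral {0..c} (\<lambda>y. (nsinc (r + (c - y)))\<^sup>2)"
        by (simp add: ip_def power2_eq_square algebra_simps)
      also have "\<dots> = integral {0..c} (\<lambda>y. (nsinc (r + y))\<^sup>2)"
        by (rule integral_reflect_interval) (intro continuous_intros)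
      also have "\<dots> \<le> c / r\<^sup>2" by (rule far_integral) (use False R in simp)
      finally show ?thesis using False by (intro exI [of _ "\<lambda>_. 0"]) (simp add: \<beta>_def)
    qed
  next
    fix N assume N: "R \<le> N"
    have "(\<beta> has_integral (A * ln (1 + R) - A * ln (1 + 0))) {0..R}"
    proof (rule has_integral_eq [rotated])
      show "((\<lambda>r. A / (1 + r)) has_integral (A * ln (1 + R) - A * ln (1 + 0))) {0..R}"
        by (rule fundamental_theorem_of_calculus)
           (use R in \<open>auto intro!: derivative_eq_intros simp: add_nonneg_eq_0_iff simp flip: has_real_derivative_iff_has_vector_derivative\<close>)
    qed (simp add: \<beta>_def)
    moreover have "(\<beta> has_integral (- c / N - (- c / R))) {R..N}"
    proof (rule has_integral_spike_finite [of "{R}"])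
      show "((\<lambda>r. c / r\<^sup>2) has_integral (- c / N - (- c / R))) {R..N}"
        by (rule fundamental_theorem_of_calculus [OF N])
           (use R in \<open>auto intro!: derivative_eq_intros simp: power2_eq_square simp flip: has_real_derivative_iff_has_vector_derivative\<close>)
    qed (auto simp: \<beta>_def)
    ultimately have I: "(\<beta> has_integral ((A * ln (1 + R) - A * ln (1 + 0)) + (- c / N - (- c / R)))) {0..N}"
      using R N by (intro has_integral_combine [of 0 R N]) auto
    \<comment> \<open>As \<open>1 + R\<close> is a power of \<open>1 + h\<close>, the integral of
      \<open>A / (1 + r)\<close> is at most \<open>A * (k * h)\<close>, which is of order k /
      m^3.\<close>
    have "ln (1 + R) = k * ln (1 + h)" using h by (simp add: R_def ln_realpow)
    also have "\<dots> \<le> k * h" using h by (intro mult_left_mono ln_add_one_self_le_self) auto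
    finally have "A * ln (1 + R) \<le> A * (k * h)" by (intro mult_left_mono) (auto simp: A_def)
    also have "\<dots> = 684 * k / m ^ 3" by (simp add: A_def h_def power2_eq_square power3_eq_cube)
    finally have 1: "A * ln (1 + R) \<le> 684 * k / m ^ 3" .
    have "c / R \<le> c / (c * m\<^sup>2)" using Rc R c_pos m by (intro divide_left_mono) auto
    also have "\<dots> = 1 / m\<^sup>2" using c_pos by simp
    finally have 2: "c / R \<le> 1 / m\<^sup>2" .
    have "0 \<le> c / N" using N R c_pos by simp
    then have "(A * ln (1 + R) - A * ln (1 + 0)) + (- c / N - (- c / R)) \<le> 684 * k / m ^ 3 + 1 / m\<^sup>2"
      using 1 2 by simp
    with I show "\<exists>I\<le>684 * k / m ^ 3 + 1 / m\<^sup>2. (\<beta> has_integral I) {0..N}" by blast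
  qed (use W d in auto)
  then show ?thesis by simp
qed

end

section \<open>Choice of the number of cells\<close>

lemma half_exp_le: "0 \<le> x \<Longrightarrow> x \<le> 1 \<Longrightarrow> exp (x / 2) \<le> 1 + x" for x :: real
proof -
  assume x: "0 \<le> x" "x \<le> 1"
  have "exp (x / 2) \<le> 1 + x / 2 + (x / 2)\<^sup>2" by (rule exp_bound) (use x in auto)
  also have "(x / 2)\<^sup>2 \<le> x / 2" using x mult_left_le [of "x / 2" "x / 2"] by (simp add: power2_eq_square)
  finally show ?thesis by simp
qed

lemma ln_ge_1: "3 \<le> c \<Longrightarrow> 1 \<le> ln c" for c :: real
  using exp_le by (simp add: ln_ge_iff)

text \<open>\<open>m\<close> rounds up \<delta>^(-1/2), hence is at most twice that, and about 2 m
  ln (1 + c m^2) steps of ratio 1 + 1/m reach 1 + c m^2. Since \<delta> is at least c^(-\<alpha>),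
  this logarithm is at most \<open>(3 + \<alpha>) * ln c\<close>; rounding \<open>k\<close> adds at
  most \<open>m * ln c\<close>, which gives \<open>7 + 2 * \<alpha>\<close>. Finally 1384 = 1368 +
  16, where 16 comes from \<open>8 * \<delta> * k\<close> and the factor 2 in the bound for
  \<open>m\<close>.\<close>

lemma cell_parameters:
  fixes c \<delta> \<alpha> :: real
  assumes c: "3 \<le> c" and \<alpha>: "0 \<le> \<alpha>" and \<delta>: "c powr - \<alpha> \<le> \<delta>" "\<delta> \<le> 1"
  obtains m k :: nat where "0 < m" "0 < k" "1 + c * m\<^sup>2 \<le> (1 + 1 / m) ^ k"
    "1368 * k / m ^ 3 + 2 / m\<^sup>2 + 8 * \<delta> * k \<le> (1384 * (7 + 2 * \<alpha>) + 2) * sqrt \<delta> * ln c"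
proof -
  have \<delta>0: "0 < \<delta>" using less_le_trans [OF _ \<delta>(1)] c by simp
  have lc: "1 \<le> ln c" by (rule ln_ge_1 [OF c])
  define x where "x = 1 / sqrt \<delta>"
  have x1: "1 \<le> x" using \<delta>0 \<delta>(2) by (simp add: x_def)
  have x2: "x\<^sup>2 = 1 / \<delta>" using \<delta>0 by (simp add: x_def power_divide)
  have \<delta>x: "\<delta> * x = sqrt \<delta>" using \<delta>0 by (simp add: x_def real_div_sqrt)
  define m where "m = nat \<lceil>x\<rceil>"
  have m: "x \<le> m" "m \<le> 2 * x" "0 < m" using x1 unfolding m_def by linarith+
  have m2: "1 / (real m)\<^sup>2 \<le> \<delta>"
  proof -
    have "x\<^sup>2 \<le> (real m)\<^sup>2" by (rule power_mono) (use m x1 in auto)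
    then have "1 / (real m)\<^sup>2 \<le> 1 / x\<^sup>2" using x1 by (intro divide_left_mono) auto
    then show ?thesis by (simp add: x2)
  qed
  define l where "l = ln (1 + c * (real m)\<^sup>2)"
  have l0: "0 < l" unfolding l_def using c m by (intro ln_gt_zero) auto
  have l: "l \<le> (3 + \<alpha>) * ln c"
  proof -
    have "(real m)\<^sup>2 \<le> (2 * x)\<^sup>2" by (rule power_mono) (use m in auto)
    also have "\<dots> = 4 * (1 / \<delta>)" by (simp add: power_mult_distrib x2)
    also have "1 / \<delta> \<le> c powr \<alpha>"
    proof -
      have "1 / \<delta> \<le> 1 / (c powr - \<alpha>)" using \<delta> \<delta>0 c by (intro divide_left_mono) auto
      then show ?thesis by (simp add: powr_minus_divide)
    qed
    finally have "(real m)\<^sup>2 \<le> 4 * c powr \<alpha>" by simp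
    then have "1 + c * (real m)\<^sup>2 \<le> 1 + c * (4 * c powr \<alpha>)" using c by (intro add_left_mono mult_left_mono) auto
    also have "\<dots> \<le> 1 * (c * c powr \<alpha>) + 4 * (c * c powr \<alpha>)"
    proof -
      have "1 * 1 \<le> c * c powr \<alpha>" by (rule mult_mono) (use c \<alpha> in \<open>auto simp: ge_one_powr_ge_zero\<close>)
      then show ?thesis by simp
    qed
    \<comment> \<open>5 is raised to 9 = 3^2, so that \<open>c \<ge> 3\<close> absorbs the constant
      into c^2.\<close>
    also have "\<dots> \<le> 9 * (c * c powr \<alpha>)" using c by simp
    also have "\<dots> \<le> c\<^sup>2 * (c * c powr \<alpha>)"
    proof (rule mult_right_mono)
      have "3\<^sup>2 \<le> c\<^sup>2" by (rule power_mono) (use c in auto)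
      then show "9 \<le> c\<^sup>2" by simp
    qed (use c in auto)
    finally have le: "1 + c * (real m)\<^sup>2 \<le> c\<^sup>2 * (c * c powr \<alpha>)" .
    have "l \<le> ln (c\<^sup>2 * (c * c powr \<alpha>))"
      unfolding l_def using le c by (subst ln_le_cancel_iff) (auto intro!: add_pos_nonneg)
    also have "\<dots> = (3 + \<alpha>) * ln c"
      using c by (simp add: ln_mult ln_realpow ln_powr distrib_right)
    finally show ?thesis .
  qed
  define k where "k = nat \<lceil>2 * m * l\<rceil>"
  have ml: "0 < 2 * real m * l" using l0 m by simp
  have k: "2 * m * l \<le> k" "k \<le> 2 * m * l + 1" "0 < k"
    using ml unfolding k_def by linarith+
  define a where "a = 7 + 2 * \<alpha>"
  have a: "0 \<le> a" using \<alpha> by (simp add: a_def)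
  have ka: "k \<le> m * (a * ln c)"
  proof -
    have "real k \<le> 2 * m * ((3 + \<alpha>) * ln c) + m * ln c"
    proof -
      have "1 * 1 \<le> real m * ln c" by (rule mult_mono) (use m lc in auto)
      moreover have "2 * m * l \<le> 2 * m * ((3 + \<alpha>) * ln c)" by (rule mult_left_mono [OF l]) simp
      ultimately show ?thesis using k(2) by linarith
    qed
    also have "\<dots> = m * (a * ln c)" by (simp add: a_def algebra_simps)
    finally show ?thesis .
  qed
  have "1 + c * (real m)\<^sup>2 \<le> (1 + 1 / m) ^ k"
  proof -
    have p: "0 < 1 + c * (real m)\<^sup>2" using c by (intro add_pos_nonneg) auto
    have "1 + c * (real m)\<^sup>2 = exp l" using p by (simp add: l_def)
    also have "\<dots> \<le> exp (k * (1 / m / 2))"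
    proof -
      have "l = 2 * m * l / (2 * m)" using m by simp
      also have "\<dots> \<le> k / (2 * m)" by (rule divide_right_mono [OF k(1)]) simp
      finally show ?thesis by simp
    qed
    also have "\<dots> = exp (1 / m / 2) ^ k" by (rule exp_of_nat_mult)
    \<comment> \<open>\<open>half_exp_le\<close> costs a factor 2 in the exponent, which is why
      \<open>k\<close> is about twice \<open>m * l\<close>.\<close>
    also have "\<dots> \<le> (1 + 1 / m) ^ k" by (intro power_mono half_exp_le) (use m in auto)
    finally show ?thesis .
  qed
  moreover have "1368 * k / m ^ 3 + 2 / m\<^sup>2 + 8 * \<delta> * k \<le> (1384 * a + 2) * sqrt \<delta> * ln c"
  proof -
    have s\<delta>: "\<delta> \<le> sqrt \<delta>" using \<delta>0 \<delta>(2) sqrt_le_D [of \<delta> \<delta>] mult_left_le [of \<delta> \<delta>]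
      by (intro real_le_rsqrt) (simp add: power2_eq_square)
    have alc: "0 \<le> a * ln c" using a lc by simp
    have "1368 * k / m ^ 3 \<le> 1368 * (m * (a * ln c)) / m ^ 3"
      using ka by (intro divide_right_mono mult_left_mono) auto
    also have "\<dots> = 1368 * (a * ln c) * (1 / (real m)\<^sup>2)" using m by (simp add: power2_eq_square power3_eq_cube)
    also have "\<dots> \<le> 1368 * (a * ln c) * sqrt \<delta>"
      using m2 s\<delta> alc by (intro mult_left_mono) auto
    finally have 1: "1368 * k / m ^ 3 \<le> 1368 * (a * ln c) * sqrt \<delta>" .
    have "2 / (real m)\<^sup>2 \<le> 2 * (sqrt \<delta> * 1)" using m2 s\<delta> by simp
    also have "\<dots> \<le> 2 * (sqrt \<delta> * ln c)" using lc \<delta>0 by (intro mult_left_mono) auto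
    finally have 2: "2 / (real m)\<^sup>2 \<le> 2 * (sqrt \<delta> * ln c)" .
    have "\<delta> * k \<le> \<delta> * (2 * x * (a * ln c))"
      using ka mult_right_mono [OF m(2) alc] \<delta>0 by (intro mult_left_mono) auto
    also have "\<dots> = 2 * (\<delta> * x) * (a * ln c)" by simp
    also have "\<dots> = 2 * sqrt \<delta> * (a * ln c)" by (simp only: \<delta>x)
    finally have "8 * \<delta> * k \<le> 16 * sqrt \<delta> * (a * ln c)" by linarith
    with 1 2 have "1368 * k / m ^ 3 + 2 / m\<^sup>2 + 8 * \<delta> * k
        \<le> 1368 * (a * ln c) * sqrt \<delta> + 2 * (sqrt \<delta> * ln c) + 16 * sqrt \<delta> * (a * ln c)"
      by (simp only: of_nat_power of_nat_mult of_nat_numeral)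
    also have "\<dots> = (1384 * a + 2) * sqrt \<delta> * ln c" by (simp add: algebra_simps)
    finally show ?thesis .
  qed
  ultimately show thesis
    by (intro that [OF m(3) k(3)]) (simp_all only: a_def of_nat_mult of_nat_power of_nat_numeral)
qed

text \<open>Applied with 1 in place of \<open>\<delta>\<close> to the eigenvalues above 1/2, where
  it gives O(ln c), and with the actual \<open>\<delta>\<close> to the small ones, where
  \<open>sqrt \<delta>\<close> is essential.\<close>

theorem (in sinc_spectrum) spectral_tail_bound:
  assumes "3 \<le> c" "0 \<le> \<alpha>" "c powr - \<alpha> \<le> \<delta>" "\<delta> \<le> 1"
    and W: "finite W" "\<And>n. n \<in> W \<Longrightarrow> ev n * (1 - ev n) \<le> \<delta>"
  shows "(\<Sum>n\<in>W. ev n * (1 - ev n)) \<le> (1384 * (7 + 2 * \<alpha>) + 2) * sqrt \<delta> * ln c"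
proof -
  obtain m k :: nat where mk: "0 < m" "0 < k" "1 + c * m\<^sup>2 \<le> (1 + 1 / m) ^ k"
    and le: "1368 * k / m ^ 3 + 2 / m\<^sup>2 + 8 * \<delta> * k \<le> (1384 * (7 + 2 * \<alpha>) + 2) * sqrt \<delta> * ln c"
    using cell_parameters [OF assms(1-4)] .
  have "0 \<le> \<delta>" using order_trans [OF powr_ge_zero assms(3)] .
  from spectral_tail_bound_cells [OF W this mk] le show ?thesis by linarith
qed

section \<open>The Fredholm determinant\<close>

lemma card_bijections:
  assumes "S \<subseteq> B" "finite B" "card S = n"
  shows "card {f \<in> {..<n} \<rightarrow>\<^sub>E B. inj_on f {..<n} \<and> f ` {..<n} = S} = fact n"
proof -
  have "finite S" using assms finite_subset by blast
  then obtain g where g: "bij_betw g {..<n} S"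
    using ex_bij_betw_nat_finite [of S] assms(3) unfolding atLeast0LessThan by blast
  let ?F = "{f \<in> {..<n} \<rightarrow>\<^sub>E B. inj_on f {..<n} \<and> f ` {..<n} = S}"
  have "bij_betw (\<lambda>p. restrict (g \<circ> p) {..<n}) {p. p permutes {..<n}} ?F"
  proof (rule bij_betwI')
    fix p q assume p: "p \<in> {p. p permutes {..<n}}" and q: "q \<in> {p. p permutes {..<n}}"
    show "(restrict (g \<circ> p) {..<n} = restrict (g \<circ> q) {..<n}) = (p = q)"
    proof
      assume eq: "restrict (g \<circ> p) {..<n} = restrict (g \<circ> q) {..<n}"
      show "p = q"
      proof
        fix i
        show "p i = q i"
        proof (cases "i < n")
          case True
          then have "g (p i) = g (q i)" using fun_cong [OF eq, of i] by simp
          moreover have "p i \<in> {..<n}" using p True permutes_in_image [of p "{..<n}" i] by simp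
          moreover have "q i \<in> {..<n}" using q True permutes_in_image [of q "{..<n}" i] by simp
          ultimately show ?thesis by (rule inj_onD [OF bij_betw_imp_inj_on [OF g]])
        next
          case False
          then show ?thesis using p q by (simp add: permutes_def)
        qed
      qed
    qed simp
  next
    fix p assume "p \<in> {p. p permutes {..<n}}"
    then have "bij_betw p {..<n} {..<n}" using permutes_imp_bij by blast
    then have b: "bij_betw (g \<circ> p) {..<n} S" using g by (rule bij_betw_trans)
    then have inj: "inj_on (restrict (g \<circ> p) {..<n}) {..<n}" and im: "restrict (g \<circ> p) {..<n} ` {..<n} = S"
      by (simp_all only: bij_betw_def inj_on_restrict_eq image_restrict_eq)
    have "restrict (g \<circ> p) {..<n} \<in> {..<n} \<rightarrow>\<^sub>E B"
      by (rule restrict_PiE_iff [THEN iffD2]) (use im assms(1) in auto)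
    with inj im show "restrict (g \<circ> p) {..<n} \<in> ?F" by simp
  next
    fix f assume f: "f \<in> ?F"
    define p where "p i = (if i < n then inv_into {..<n} g (f i) else i)" for i
    have fb: "bij_betw f {..<n} S" using f by (simp add: bij_betw_def)
    have "bij_betw (inv_into {..<n} g \<circ> f) {..<n} {..<n}"
      by (rule bij_betw_trans [OF fb bij_betw_inv_into [OF g]])
    then have "bij_betw p {..<n} {..<n}"
      using bij_betw_cong [of "{..<n}" "inv_into {..<n} g \<circ> f" p "{..<n}"] by (simp add: p_def)
    then have "p permutes {..<n}" by (rule bij_imp_permutes) (simp add: p_def)
    moreover have "f = restrict (g \<circ> p) {..<n}"
    proof
      fix i
      show "f i = restrict (g \<circ> p) {..<n} i"
      proof (cases "i < n")
        case True
        then have "f i \<in> f ` {..<n}" by blast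
        then have "f i \<in> g ` {..<n}"
          using bij_betw_imp_surj_on [OF fb] bij_betw_imp_surj_on [OF g] by simp
        then have "g (inv_into {..<n} g (f i)) = f i" by (rule f_inv_into_f)
        then show ?thesis using True by (simp add: p_def)
      next
        case False
        then show ?thesis using f PiE_arb [of f "{..<n}" "\<lambda>_. B" i] by simp
      qed
    qed
    ultimately show "\<exists>p\<in>{p. p permutes {..<n}}. f = restrict (g \<circ> p) {..<n}" by blast
  qed
  then have "card {p. p permutes {..<n}} = card ?F" by (rule bij_betw_same_card)
  then show ?thesis by (simp add: card_permutations [OF card_lessThan])
qed

text \<open>The sum on the right is the elementary symmetric function of degree \<open>n\<close>;
  each subset is enumerated \<open>fact n\<close> times.\<close>

lemma sum_inj_prod:
  fixes l :: "'b \<Rightarrow> real"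
  assumes "finite B"
  shows "(\<Sum>f\<in>{f \<in> {..<n} \<rightarrow>\<^sub>E B. inj_on f {..<n}}. \<Prod>i<n. l (f i))
    = fact n * (\<Sum>S\<in>{S. S \<subseteq> B \<and> card S = n}. prod l S)"
proof -
  let ?F = "{f \<in> {..<n} \<rightarrow>\<^sub>E B. inj_on f {..<n}}" and ?T = "{S. S \<subseteq> B \<and> card S = n}"
  have "finite ({..<n} \<rightarrow>\<^sub>E B)" by (rule finite_PiE) (simp_all add: assms)
  then have fF: "finite ?F" by (rule rev_finite_subset) blast
  have "finite (Pow B)" using assms by simp
  then have fT: "finite ?T" by (rule rev_finite_subset) blast
  have "(\<lambda>f. f ` {..<n}) ` ?F \<subseteq> ?T"
    using PiE_mem by (fastforce simp: card_image)
  then have "(\<Sum>f\<in>?F. \<Prod>i<n. l (f i)) = (\<Sum>S\<in>?T. \<Sum>f\<in>{f \<in> ?F. f ` {..<n} = S}. \<Prod>i<n. l (f i))"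
    by (rule sum.group [OF fF fT, symmetric])
  also have "\<dots> = (\<Sum>S\<in>?T. fact n * prod l S)"
  proof (rule sum.cong [OF refl])
    fix S assume S: "S \<in> ?T"
    have "(\<Sum>f\<in>{f \<in> ?F. f ` {..<n} = S}. \<Prod>i<n. l (f i)) = (\<Sum>f\<in>{f \<in> ?F. f ` {..<n} = S}. prod l S)"
    proof (rule sum.cong [OF refl])
      fix f assume "f \<in> {f \<in> ?F. f ` {..<n} = S}"
      then have "inj_on f {..<n}" "f ` {..<n} = S" by auto
      then show "(\<Prod>i<n. l (f i)) = prod l S" using prod.reindex [of f "{..<n}" l] by (simp add: o_def)
    qed
    also have "\<dots> = card {f \<in> {..<n} \<rightarrow>\<^sub>E B. inj_on f {..<n} \<and> f ` {..<n} = S} * prod l S"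
      by (simp add: conj_assoc)
    also have "\<dots> = fact n * prod l S" using S assms by (subst card_bijections) auto
    finally show "(\<Sum>f\<in>{f \<in> ?F. f ` {..<n} = S}. \<Prod>i<n. l (f i)) = fact n * prod l S" .
  qed
  finally show ?thesis by (simp add: sum_distrib_left)
qed

text \<open>The product in elementary symmetric functions, with coefficients written over injective
  tuples because the Fredholm integrals come out in that shape.\<close>

lemma prod_one_plus_sums:
  fixes l :: "'b \<Rightarrow> real"
  assumes B: "finite B"
  shows "(\<lambda>n. z ^ n / fact n * (\<Sum>f\<in>{f \<in> {..<n} \<rightarrow>\<^sub>E B. inj_on f {..<n}}. \<Prod>i<n. l (f i)))
    sums (\<Prod>m\<in>B. 1 + z * l m)"
proof -
  let ?T = "\<lambda>n. {S. S \<subseteq> B \<and> card S = n}"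
  have "(\<Prod>m\<in>B. 1 + z * l m) = (\<Prod>m\<in>B. z * l m + 1)" by (simp add: add.commute)
  also have "\<dots> = (\<Sum>S\<in>Pow B. \<Prod>m\<in>S. z * l m)"
    by (subst prod_add [OF B]) simp
  also have "\<dots> = (\<Sum>n\<le>card B. \<Sum>S\<in>{S \<in> Pow B. card S = n}. \<Prod>m\<in>S. z * l m)"
    by (rule sum.group [symmetric]) (use B card_mono [OF B] in \<open>auto simp: image_subset_iff\<close>)
  also have "\<dots> = (\<Sum>n\<le>card B. z ^ n * (\<Sum>S\<in>?T n. prod l S))"
    unfolding sum_distrib_left
    by (intro sum.cong refl) (auto simp: prod.distrib)
  finally have eq: "(\<Prod>m\<in>B. 1 + z * l m) = (\<Sum>n\<le>card B. z ^ n * (\<Sum>S\<in>?T n. prod l S))" .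
  have "(\<lambda>n. z ^ n * (\<Sum>S\<in>?T n. prod l S)) sums (\<Sum>n\<le>card B. z ^ n * (\<Sum>S\<in>?T n. prod l S))"
  proof (rule sums_finite)
    fix n assume "n \<notin> {..card B}"
    then have "?T n = {}" using card_mono [OF B] by fastforce
    then show "z ^ n * (\<Sum>S\<in>?T n. prod l S) = 0" by (simp only: sum.empty mult_zero_right)
  qed simp
  moreover have "z ^ n / fact n * (\<Sum>f\<in>{f \<in> {..<n} \<rightarrow>\<^sub>E B. inj_on f {..<n}}. \<Prod>i<n. l (f i))
      = z ^ n * (\<Sum>S\<in>?T n. prod l S)" for n
    unfolding sum_inj_prod [OF B] by simp
  ultimately show ?thesis by (simp add: eq)
qed

lemma det_mat_sum:
  "Determinant.det (mat n n A) = (\<Sum>p | p permutes {..<n}. of_int (sign p) * (\<Prod>i<n. A (i, p i)))"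
  unfolding Determinant.det_def' [OF mat_carrier] atLeast0LessThan
proof (intro sum.cong refl arg_cong2 [where f = "(*)"] prod.cong)
  fix p i assume "p \<in> {p. p permutes {..<n}}" "i \<in> {..<n}"
  then have "i < n" "p i < n" using permutes_in_image [of p "{..<n}" i] by auto
  then show "mat n n A $$ (i, p i) = A (i, p i)" by simp
qed

lemma det_mat_abs_le:
  fixes A :: "nat \<times> nat \<Rightarrow> real"
  assumes "\<And>i j. i < n \<Longrightarrow> j < n \<Longrightarrow> \<bar>A (i, j)\<bar> \<le> 1"
  shows "\<bar>Determinant.det (mat n n A)\<bar> \<le> fact n"
proof -
  have "\<bar>Determinant.det (mat n n A)\<bar> \<le> (\<Sum>p | p permutes {..<n}. \<bar>of_int (sign p) * (\<Prod>i<n. A (i, p i))\<bar>)"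
    unfolding det_mat_sum by (rule sum_abs)
  also have "\<dots> \<le> (\<Sum>p | p permutes {..<n}. 1)"
  proof (rule sum_mono)
    fix p assume p: "p \<in> {p. p permutes {..<n}}"
    have "(\<Prod>i<n. \<bar>A (i, p i)\<bar>) \<le> 1"
    proof (rule prod_le_1)
      fix i assume "i \<in> {..<n}"
      then show "0 \<le> \<bar>A (i, p i)\<bar> \<and> \<bar>A (i, p i)\<bar> \<le> 1"
        using p permutes_in_image [of p "{..<n}" i] assms by simp
    qed
    moreover have "\<bar>real_of_int (sign p)\<bar> = 1" by (simp add: sign_def)
    ultimately show "\<bar>of_int (sign p) * (\<Prod>i<n. A (i, p i))\<bar> \<le> 1"
      by (simp add: abs_mult abs_prod)
  qed
  also have "\<dots> = fact n" by (simp add: card_permutations [OF card_lessThan])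
  finally show ?thesis .
qed

section \<open>Fredholm series of a kernel with an orthonormal expansion\<close>

locale orthonormal_kernel = finite_measure M for M :: "'a measure" +
  fixes l :: "nat \<Rightarrow> real" and \<phi> :: "nat \<Rightarrow> 'a \<Rightarrow> real"
  assumes l_nonneg: "0 \<le> l m"
    and meas: "\<phi> m \<in> borel_measurable M"
    and bdd: "\<exists>B. \<forall>x. \<bar>\<phi> m x\<bar> \<le> B"
    and orth: "(LINT x|M. \<phi> m x * \<phi> k x) = (if m = k \<and> 0 < l m then 1 else 0)"
begin

definition part :: "nat \<Rightarrow> 'a \<Rightarrow> 'a \<Rightarrow> real" where
  "part N x y = (\<Sum>m<N. l m * \<phi> m x * \<phi> m y)"

sublocale P: product_sigma_finite "\<lambda>i::nat. M"
  by unfold_locales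

lemma integrable_pair: "integrable M (\<lambda>x. \<phi> m x * \<phi> k x)"
proof -
  obtain B where B: "\<And>x. \<bar>\<phi> m x\<bar> \<le> B" using bdd by blast
  obtain C where C: "\<And>x. \<bar>\<phi> k x\<bar> \<le> C" using bdd by blast
  show ?thesis
  proof (rule integrable_const_bound)
    have "norm (\<phi> m x * \<phi> k x) \<le> B * C" for x
      unfolding real_norm_def abs_mult
      by (rule mult_mono [OF B C order_trans [OF abs_ge_zero B] abs_ge_zero])
    then show "AE x in M. norm (\<phi> m x * \<phi> k x) \<le> B * C" by simp
  qed (intro borel_measurable_times meas)
qed

text \<open>Reindexing the second factors by the inverse of \<open>p\<close> gathers both factors in
  the variable \<open>x i\<close>, so the integral splits into \<open>n\<close> inner
  products.\<close>

lemma integral_permuted_prod: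
  fixes n :: nat
  assumes p: "p permutes {..<n}"
  shows "integrable (\<Pi>\<^sub>M i\<in>{..<n}. M) (\<lambda>x. \<Prod>i<n. \<phi> (f i) (x i) * \<phi> (f i) (x (p i)))"
    and "(LINT x|(\<Pi>\<^sub>M i\<in>{..<n}. M). (\<Prod>i<n. \<phi> (f i) (x i) * \<phi> (f i) (x (p i))))
      = (\<Prod>i<n. if f i = f (p i) \<and> 0 < l (f i) then 1 else 0)"
proof -
  have eq: "(\<Prod>i<n. \<phi> (f i) (x i) * \<phi> (f i) (x (p i))) = (\<Prod>i<n. \<phi> (f i) (x i) * \<phi> (f (inv_into UNIV p i)) (x i))" for x
  proof -
    have "(\<Prod>i<n. \<phi> (f (inv_into UNIV p i)) (x i)) = (\<Prod>i<n. \<phi> (f i) (x (p i)))"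
      using prod.permute [OF p, of "\<lambda>i. \<phi> (f (inv_into UNIV p i)) (x i)"] permutes_inverses [OF p] by (simp add: o_def)
    then show ?thesis by (simp add: prod.distrib)
  qed
  show "integrable (\<Pi>\<^sub>M i\<in>{..<n}. M) (\<lambda>x. \<Prod>i<n. \<phi> (f i) (x i) * \<phi> (f i) (x (p i)))"
    unfolding eq
    by (rule P.product_integrable_prod [of "{..<n}" "\<lambda>i y. \<phi> (f i) y * \<phi> (f (inv_into UNIV p i)) y"]) (auto intro: integrable_pair)
  have "(LINT x|(\<Pi>\<^sub>M i\<in>{..<n}. M). (\<Prod>i<n. \<phi> (f i) (x i) * \<phi> (f (inv_into UNIV p i)) (x i))) =
      (\<Prod>i<n. (LINT y|M. \<phi> (f i) y * \<phi> (f (inv_into UNIV p i)) y))"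
    by (rule P.product_integral_prod [of "{..<n}" "\<lambda>i y. \<phi> (f i) y * \<phi> (f (inv_into UNIV p i)) y"]) (auto intro: integrable_pair)
  also have "\<dots> = (\<Prod>i<n. if f i = f (inv_into UNIV p i) \<and> 0 < l (f i) then 1 else 0)" by (simp only: orth)
  also have "\<dots> = (\<Prod>i<n. if f i = f (p i) \<and> 0 < l (f i) then 1 else 0)"
    using prod.permute [OF p, of "\<lambda>i. if f i = f (inv_into UNIV p i) \<and> 0 < l (f i) then 1 else 0 :: real"] permutes_inverses [OF p]
    by (simp add: o_def) (intro prod.cong refl, auto)
  finally show "(LINT x|(\<Pi>\<^sub>M i\<in>{..<n}. M). (\<Prod>i<n. \<phi> (f i) (x i) * \<phi> (f i) (x (p i))))
      = (\<Prod>i<n. if f i = f (p i) \<and> 0 < l (f i) then 1 else 0)" unfolding eq .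
qed

text \<open>The signed sum is the determinant of the matrix with entry 1 where
  \<open>f i = f j\<close>: the identity for injective \<open>f\<close>, two equal rows otherwise.
  If some weight \<open>l (f i)\<close> is 0, the product in front makes both sides 0.\<close>

lemma det_kronecker_pattern:
  fixes n :: nat
  shows "(\<Prod>i<n. l (f i)) * (\<Sum>p | p permutes {..<n}. of_int (sign p) * (\<Prod>i<n. if f i = f (p i) \<and> 0 < l (f i) then 1 else 0))
    = (if inj_on f {..<n} then \<Prod>i<n. l (f i) else 0)"
proof (cases "\<exists>i<n. l (f i) = 0")
  case True
  then have "(\<Prod>i<n. l (f i)) = 0" by auto
  then show ?thesis by simp
next
  case False
  let ?A = "mat n n (\<lambda>(i, j). if f i = f j then 1 else 0) :: real mat"
  have A: "?A \<in> carrier_mat n n" by simp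
  have "(\<Prod>i<n. if f i = f (p i) \<and> 0 < l (f i) then 1 else 0) = (\<Prod>i = 0..<n. ?A $$ (i, p i))"
    if "p permutes {..<n}" for p
    unfolding atLeast0LessThan
  proof (rule prod.cong [OF refl])
    fix i assume i: "i \<in> {..<n}"
    then have "p i < n" using permutes_in_image [OF that, of i] by simp
    moreover have "0 < l (f i)" using False i l_nonneg [of "f i"] by (auto simp: less_le)
    ultimately show "(if f i = f (p i) \<and> 0 < l (f i) then 1 else 0) = ?A $$ (i, p i)" using i by simp
  qed
  then have "(\<Sum>p | p permutes {..<n}. of_int (sign p) * (\<Prod>i<n. if f i = f (p i) \<and> 0 < l (f i) then 1 else 0)) = Determinant.det ?A"
    unfolding Determinant.det_def' [OF A] atLeast0LessThan by (intro sum.cong refl) simp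
  also have "\<dots> = (if inj_on f {..<n} then 1 else 0)"
  proof (cases "inj_on f {..<n}")
    case True
    then have "?A = 1\<^sub>m n" by (intro eq_matI) (auto simp: inj_on_def)
    then show ?thesis using True by simp
  next
    case False
    then obtain i j where ij: "i < n" "j < n" "i \<noteq> j" "f i = f j" by (auto simp: inj_on_def)
    have "Matrix.row ?A i = Matrix.row ?A j" using ij by (intro eq_vecI) auto
    then have "Determinant.det ?A = 0"
      using Determinant.det_identical_rows [OF A ij(3) ij(1) ij(2)] by simp
    then show ?thesis using False by simp
  qed
  finally show ?thesis by simp
qed

lemma det_part_expand:
  "Determinant.det (mat n n (\<lambda>(i, j). part N (x i) (x j))) =
    (\<Sum>f\<in>{..<n} \<rightarrow>\<^sub>E {..<N}. \<Sum>p | p permutes {..<n}.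
       (\<Prod>i<n. l (f i)) * (of_int (sign p) * (\<Prod>i<n. \<phi> (f i) (x i) * \<phi> (f i) (x (p i)))))"
proof -
  have "Determinant.det (mat n n (\<lambda>(i, j). part N (x i) (x j))) =
      (\<Sum>p | p permutes {..<n}. of_int (sign p) * (\<Prod>i<n. part N (x i) (x (p i))))"
    unfolding det_mat_sum by simp
  also have "\<dots> = (\<Sum>p | p permutes {..<n}. \<Sum>f\<in>{..<n} \<rightarrow>\<^sub>E {..<N}.
       (\<Prod>i<n. l (f i)) * (of_int (sign p) * (\<Prod>i<n. \<phi> (f i) (x i) * \<phi> (f i) (x (p i)))))"
  proof (intro sum.cong refl)
    fix p
    have "(\<Prod>i<n. part N (x i) (x (p i))) = (\<Sum>f\<in>{..<n} \<rightarrow>\<^sub>E {..<N}. \<Prod>i<n. l (f i) * \<phi> (f i) (x i) * \<phi> (f i) (x (p i)))"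
      unfolding part_def by (rule prod_sum_PiE) auto
    then show "of_int (sign p) * (\<Prod>i<n. part N (x i) (x (p i))) = (\<Sum>f\<in>{..<n} \<rightarrow>\<^sub>E {..<N}.
       (\<Prod>i<n. l (f i)) * (of_int (sign p) * (\<Prod>i<n. \<phi> (f i) (x i) * \<phi> (f i) (x (p i)))))"
      by (simp add: prod.distrib sum_distrib_left mult_ac)
  qed
  also have "\<dots> = (\<Sum>f\<in>{..<n} \<rightarrow>\<^sub>E {..<N}. \<Sum>p | p permutes {..<n}.
       (\<Prod>i<n. l (f i)) * (of_int (sign p) * (\<Prod>i<n. \<phi> (f i) (x i) * \<phi> (f i) (x (p i)))))"
    by (rule sum.swap)
  finally show ?thesis .
qed

text \<open>An integrated form of the Cauchy--Binet formula: orthonormality leaves only injective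
  choices of indices.\<close>

lemma det_part_integral:
  "integrable (\<Pi>\<^sub>M i\<in>{..<n}. M) (\<lambda>x. Determinant.det (mat n n (\<lambda>(i, j). part N (x i) (x j))))"
  "(LINT x|(\<Pi>\<^sub>M i\<in>{..<n}. M). Determinant.det (mat n n (\<lambda>(i, j). part N (x i) (x j)))) =
    (\<Sum>f\<in>{f \<in> {..<n} \<rightarrow>\<^sub>E {..<N}. inj_on f {..<n}}. \<Prod>i<n. l (f i))"
proof -
  have int: "integrable (\<Pi>\<^sub>M i\<in>{..<n}. M) (\<lambda>x. (\<Prod>i<n. l (f i)) * (of_int (sign p) * (\<Prod>i<n. \<phi> (f i) (x i) * \<phi> (f i) (x (p i)))))"
    if "p \<in> {p. p permutes {..<n}}" for p f
    using integral_permuted_prod(1) [of p n f] that by (intro integrable_mult_right) auto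
  show "integrable (\<Pi>\<^sub>M i\<in>{..<n}. M) (\<lambda>x. Determinant.det (mat n n (\<lambda>(i, j). part N (x i) (x j))))"
    unfolding det_part_expand by (intro Bochner_Integration.integrable_sum int)
  have "(LINT x|(\<Pi>\<^sub>M i\<in>{..<n}. M). Determinant.det (mat n n (\<lambda>(i, j). part N (x i) (x j)))) =
    (\<Sum>f\<in>{..<n} \<rightarrow>\<^sub>E {..<N}. \<Sum>p | p permutes {..<n}.
      (LINT x|(\<Pi>\<^sub>M i\<in>{..<n}. M). (\<Prod>i<n. l (f i)) * (of_int (sign p) * (\<Prod>i<n. \<phi> (f i) (x i) * \<phi> (f i) (x (p i))))))"
    unfolding det_part_expand
    by (subst Bochner_Integration.integral_sum, intro Bochner_Integration.integrable_sum int, assumption)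
       (intro sum.cong refl Bochner_Integration.integral_sum int, assumption)
  also have "\<dots> = (\<Sum>f\<in>{..<n} \<rightarrow>\<^sub>E {..<N}. (\<Prod>i<n. l (f i)) * (\<Sum>p | p permutes {..<n}.
      of_int (sign p) * (\<Prod>i<n. if f i = f (p i) \<and> 0 < l (f i) then 1 else 0)))"
    unfolding sum_distrib_left [of "\<Prod>i<n. l (_ i)"]
    by (intro sum.cong refl) (simp only: integral_mult_right_zero integral_permuted_prod(2) mem_Collect_eq)
  also have "\<dots> = (\<Sum>f\<in>{..<n} \<rightarrow>\<^sub>E {..<N}. if inj_on f {..<n} then \<Prod>i<n. l (f i) else 0)"
    by (simp only: det_kronecker_pattern)
  also have "\<dots> = (\<Sum>f\<in>{f \<in> {..<n} \<rightarrow>\<^sub>E {..<N}. inj_on f {..<n}}. \<Prod>i<n. l (f i))"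
    by (rule sum.inter_filter [symmetric]) (intro finite_PiE, auto)
  finally show "(LINT x|(\<Pi>\<^sub>M i\<in>{..<n}. M). Determinant.det (mat n n (\<lambda>(i, j). part N (x i) (x j)))) =
    (\<Sum>f\<in>{f \<in> {..<n} \<rightarrow>\<^sub>E {..<N}. inj_on f {..<n}}. \<Prod>i<n. l (f i))" .
qed

text \<open>Two limits in succession. For fixed \<open>n\<close> the integrals converge by
  domination with the crude bound \<open>fact n\<close> for the determinant. In the series that
  bound would leave only a geometric majorant, so the exchange with the sum over \<open>n\<close>
  relies on \<open>E n N \<le> C ^ n\<close>, which comes from the bound on the trace.\<close>

theorem fredholm_det_limit:
  assumes z: "0 \<le> z"
    and lim: "\<And>x y. x \<in> space M \<Longrightarrow> y \<in> space M \<Longrightarrow> (\<lambda>N. part N x y) \<longlonglongrightarrow> k x y"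
    and bound: "\<And>N x y. x \<in> space M \<Longrightarrow> y \<in> space M \<Longrightarrow> \<bar>part N x y\<bar> \<le> 1"
    and C: "\<And>N. (\<Sum>m<N. l m) \<le> C"
  shows "(\<lambda>N. \<Prod>m<N. 1 + z * l m) \<longlonglongrightarrow> fredholm_det M k z"
proof -
  define E where "E n N = (\<Sum>f\<in>{f \<in> {..<n} \<rightarrow>\<^sub>E {..<N}. inj_on f {..<n}}. \<Prod>i<n. l (f i))" for n N :: nat
  define I where "I n = (LINT x|(\<Pi>\<^sub>M i\<in>{..<n}. M). Determinant.det (mat n n (\<lambda>(i, j). k (x i) (x j))))" for n :: nat
  have sp: "x i \<in> space M" if "x \<in> space (\<Pi>\<^sub>M i\<in>{..<n}. M)" "i < n" for x i n
    using that by (auto simp: space_PiM)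
  have EI: "(\<lambda>N. E n N) \<longlonglongrightarrow> I n" for n
  proof -
    have conv: "(\<lambda>N. Determinant.det (mat n n (\<lambda>(i, j). part N (x i) (x j)))) \<longlonglongrightarrow>
        Determinant.det (mat n n (\<lambda>(i, j). k (x i) (x j)))" if x: "x \<in> space (\<Pi>\<^sub>M i\<in>{..<n}. M)" for x
      unfolding det_mat_sum
    proof (intro tendsto_sum tendsto_mult_left tendsto_prod)
      fix p i assume "p \<in> {p. p permutes {..<n}}" "i \<in> {..<n}"
      then have "i < n" "p i < n" using permutes_in_image [of p "{..<n}" i] by simp_all
      then show "(\<lambda>N. case (i, p i) of (i, j) \<Rightarrow> part N (x i) (x j)) \<longlonglongrightarrow> (case (i, p i) of (i, j) \<Rightarrow> k (x i) (x j))"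
        using lim sp [OF x] by simp
    qed
    have meas: "(\<lambda>x. Determinant.det (mat n n (\<lambda>(i, j). part N (x i) (x j)))) \<in> borel_measurable (\<Pi>\<^sub>M i\<in>{..<n}. M)" for N
      using det_part_integral(1) by (rule borel_measurable_integrable)
    have "integrable (\<Pi>\<^sub>M i\<in>{..<n}. M) (\<lambda>x. \<Prod>i<n. (\<lambda>_ _. 1 :: real) i (x i))"
      by (rule P.product_integrable_prod) auto
    then have one: "integrable (\<Pi>\<^sub>M i\<in>{..<n}. M) (\<lambda>_. 1 :: real)" by simp
    have "(\<lambda>N. LINT x|(\<Pi>\<^sub>M i\<in>{..<n}. M). Determinant.det (mat n n (\<lambda>(i, j). part N (x i) (x j)))) \<longlonglongrightarrow> I n"
      unfolding I_def
    proof (rule integral_dominated_convergence)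
      show "(\<lambda>x. Determinant.det (mat n n (\<lambda>(i, j). k (x i) (x j)))) \<in> borel_measurable (\<Pi>\<^sub>M i\<in>{..<n}. M)"
        by (rule borel_measurable_LIMSEQ_real [OF conv meas])
      show "integrable (\<Pi>\<^sub>M i\<in>{..<n}. M) (\<lambda>_. fact n * 1 :: real)" by (rule integrable_mult_right [OF one])
      show "AE x in \<Pi>\<^sub>M i\<in>{..<n}. M. norm (Determinant.det (mat n n (\<lambda>(i, j). part N (x i) (x j)))) \<le> fact n * 1" for N
      proof (rule AE_I2)
        fix x assume x: "x \<in> space (\<Pi>\<^sub>M i\<in>{..<n}. M)"
        show "norm (Determinant.det (mat n n (\<lambda>(i, j). part N (x i) (x j)))) \<le> fact n * 1"
          unfolding real_norm_def mult_1_right by (rule det_mat_abs_le) (use bound sp [OF x] in auto)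
      qed
    qed (use conv meas in auto)
    then show ?thesis unfolding det_part_integral(2) E_def .
  qed
  have C0: "0 \<le> C" using C [of 0] by simp
  have Ele: "0 \<le> E n N \<and> E n N \<le> C ^ n" for n N
  proof
    show "0 \<le> E n N" unfolding E_def by (intro sum_nonneg prod_nonneg) (auto simp: l_nonneg)
    have "E n N \<le> (\<Sum>f\<in>{..<n} \<rightarrow>\<^sub>E {..<N}. \<Prod>i<n. l (f i))"
      unfolding E_def
    proof (rule sum_mono2)
      show "finite ({..<n} \<rightarrow>\<^sub>E {..<N})" by (rule finite_PiE) simp_all
    qed (use l_nonneg in \<open>auto intro: prod_nonneg\<close>)
    also have "\<dots> = (\<Prod>i<n. \<Sum>m<N. l m)"
      by (rule prod_sum_PiE [symmetric]) auto
    also have "\<dots> = (\<Sum>m<N. l m) ^ n" by simp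
    also have "\<dots> \<le> C ^ n" by (intro power_mono C sum_nonneg) (auto simp: l_nonneg)
    finally show "E n N \<le> C ^ n" .
  qed
  have "(\<lambda>N. \<Sum>n. z ^ n / fact n * E n N) \<longlonglongrightarrow> (\<Sum>n. z ^ n / fact n * I n)"
  proof (rule tannerys_theorem [THEN conjunct2, THEN conjunct2])
    show "(\<lambda>N. z ^ n / fact n * E n N) \<longlonglongrightarrow> z ^ n / fact n * I n" for n
      by (rule tendsto_mult_left [OF EI])
    show "summable (\<lambda>n. inverse (fact n) * (z * C) ^ n)" by (rule summable_exp)
    have "norm (z ^ n / fact n * E n N) \<le> inverse (fact n) * (z * C) ^ n" for n N
    proof -
      have "norm (z ^ n / fact n * E n N) = z ^ n / fact n * E n N" using Ele [of n N] z by simp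
      also have "\<dots> \<le> z ^ n / fact n * C ^ n" using Ele [of n N] z by (intro mult_left_mono) auto
      also have "\<dots> = inverse (fact n) * (z * C) ^ n" by (simp only: power_mult_distrib divide_inverse mult_ac)
      finally show ?thesis .
    qed
    then show "eventually (\<lambda>(n, N). norm (z ^ n / fact n * E n N) \<le> inverse (fact n) * (z * C) ^ n) (sequentially \<times>\<^sub>F sequentially)"
      by (intro always_eventually) auto
  qed simp
  moreover have "(\<Sum>n. z ^ n / fact n * E n N) = (\<Prod>m<N. 1 + z * l m)" for N
    unfolding E_def by (rule sums_unique [symmetric, OF prod_one_plus_sums]) simp
  ultimately show ?thesis unfolding fredholm_det_def I_def by simp
qed

end

section \<open>Identification of the eigenvalues\<close>

text \<open>There are more unknowns than equations. This bounds multiplicities from above for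
  eigenfunctions known only almost everywhere.\<close>

lemma homogeneous_system_nontrivial:
  fixes b :: "'i \<Rightarrow> 'm \<Rightarrow> 'a::field"
  assumes "finite M" "finite I" "card M < card I"
  shows "\<exists>a. (\<exists>i\<in>I. a i \<noteq> 0) \<and> (\<forall>m\<in>M. (\<Sum>i\<in>I. a i * b i m) = 0)"
  using assms
proof (induction M arbitrary: I b rule: finite_induct)
  case empty
  then have "I \<noteq> {}" by auto
  then show ?case by (intro exI [of _ "\<lambda>_. 1"]) auto
next
  case (insert m M)
  show ?case
  proof (cases "\<forall>i\<in>I. b i m = 0")
    case True
    have "card M < card I" using insert by simp
    from insert.IH [OF insert.prems(1) this, of b] obtain a
      where "\<exists>i\<in>I. a i \<noteq> 0" "\<forall>m\<in>M. (\<Sum>i\<in>I. a i * b i m) = 0" by blast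
    with True show ?thesis by (intro exI [of _ a]) (simp add: sum.neutral)
  next
    case False
    then obtain p where p: "p \<in> I" "b p m \<noteq> 0" by blast
    define J where "J = I - {p}"
    have J: "finite J" "I = insert p J" "p \<notin> J" using insert.prems(1) p by (auto simp: J_def)
    have "card M < card J" using insert J by simp
    \<comment> \<open>Gaussian elimination: the pivot \<open>p\<close> removes equation
      \<open>m\<close>, and its own unknown is recovered below as \<open>- s\<close>.\<close>
    from insert.IH [OF J(1) this, of "\<lambda>i m'. b i m' - b i m / b p m * b p m'"] obtain a
      where a: "\<exists>i\<in>J. a i \<noteq> 0" "\<And>m'. m' \<in> M \<Longrightarrow> (\<Sum>i\<in>J. a i * (b i m' - b i m / b p m * b p m')) = 0"
      by blast
    define s where "s = (\<Sum>i\<in>J. a i * b i m) / b p m"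
    define a' where "a' = a(p := - s)"
    have sum: "(\<Sum>i\<in>I. a' i * b i m') = - s * b p m' + (\<Sum>i\<in>J. a i * b i m')" for m'
    proof -
      have "(\<Sum>i\<in>J. a' i * b i m') = (\<Sum>i\<in>J. a i * b i m')"
        by (rule sum.cong) (use J(3) in \<open>auto simp: a'_def\<close>)
      then show ?thesis using J by (simp add: a'_def)
    qed
    have "(\<Sum>i\<in>I. a' i * b i m) = 0" unfolding sum using p(2) by (simp add: s_def)
    moreover have "(\<Sum>i\<in>I. a' i * b i m') = 0" if "m' \<in> M" for m'
    proof -
      have "(\<Sum>i\<in>J. a i * (b i m' - b i m / b p m * b p m')) =
          (\<Sum>i\<in>J. a i * b i m') - (\<Sum>i\<in>J. a i * b i m * (b p m' / b p m))"
        unfolding sum_subtractf [symmetric] by (intro sum.cong refl) (simp add: right_diff_distrib)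
      also have "\<dots> = (\<Sum>i\<in>J. a i * b i m') - s * b p m'"
        unfolding sum_distrib_right [symmetric] by (simp add: s_def)
      finally show ?thesis using a(2) [OF that] unfolding sum by simp
    qed
    moreover have "\<exists>i\<in>I. a' i \<noteq> 0" using a(1) J by (auto simp: a'_def)
    ultimately show ?thesis by (intro exI [of _ a']) simp
  qed
qed

section \<open>The operator on square-integrable functions\<close>

context sinc_interval begin

lemma space_lborel_ivl [simp]: "space (lborel_ivl c) = {0<..<c}"
  by (simp add: lborel_ivl_def space_restrict_space)

lemma finite_lborel_ivl: "finite_measure (lborel_ivl c)"
proof
  show "emeasure (lborel_ivl c) (space (lborel_ivl c)) \<noteq> \<infinity>"
    using c_pos by (simp add: lborel_ivl_def space_restrict_space emeasure_restrict_space)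
qed

sublocale L: finite_measure "lborel_ivl c" by (rule finite_lborel_ivl)

lemma measurable_lborel_ivl: "f \<in> borel_measurable borel \<Longrightarrow> f \<in> borel_measurable (lborel_ivl c)"
  unfolding lborel_ivl_def by (rule measurable_restrict_space1) simp

lemma measurable_bcontfun: "apply_bcontfun (f :: real \<Rightarrow>\<^sub>C real) \<in> borel_measurable (lborel_ivl c)"
  by (intro measurable_lborel_ivl borel_measurable_continuous_onI continuous_on_apply_bcontfun)

lemma LINT_continuous:
  fixes h :: "real \<Rightarrow> real"
  assumes "continuous_on UNIV h"
  shows "(LINT y|lborel_ivl c. h y) = integral {0..c} h"
proof -
  have "set_integrable lborel {0..c} h"
    by (rule borel_integrable_atLeastAtMost') (rule continuous_on_subset [OF assms], simp)
  then have si: "set_integrable lborel {0<..<c} h"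
    by (rule set_integrable_subset) auto
  have "(LINT y|lborel_ivl c. h y) = (LINT y:{0<..<c}|lborel. h y)"
    unfolding lborel_ivl_def set_lebesgue_integral_def by (rule integral_restrict_space) simp
  also have "\<dots> = integral {0<..<c} h" by (rule set_borel_integral_eq_integral [OF si])
  also have "\<dots> = integral {0..c} h" using integral_open_interval [of 0 c h] by simp
  finally show ?thesis .
qed

lemma LINT_ip: "(LINT y|lborel_ivl c. apply_bcontfun f y * apply_bcontfun g y) = ip f g"
  unfolding ip_def by (rule LINT_continuous) (intro continuous_intros)

lemma integrable_bounded_mult:
  fixes f :: "real \<Rightarrow> 'b::{banach, second_countable_topology, real_normed_field}"
  assumes "integrable (lborel_ivl c) f" "g \<in> borel_measurable borel" "\<And>x. norm (g x) \<le> B"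
  shows "integrable (lborel_ivl c) (\<lambda>y. g y * f y)"
proof (rule Bochner_Integration.integrable_bound [of _ "\<lambda>y. B *\<^sub>R norm (f y)"])
  show "integrable (lborel_ivl c) (\<lambda>y. B *\<^sub>R norm (f y))"
    using assms(1) by (intro integrable_scaleR_right integrable_norm)
  show "(\<lambda>y. g y * f y) \<in> borel_measurable (lborel_ivl c)"
    by (rule borel_measurable_times [OF measurable_lborel_ivl [OF assms(2)] borel_measurable_integrable [OF assms(1)]])
  have B: "0 \<le> B" using norm_ge_zero order_trans assms(3) by blast
  show "AE y in lborel_ivl c. norm (g y * f y) \<le> norm (B *\<^sub>R norm (f y))"
    using assms(3) B by (auto simp: norm_mult intro!: AE_I2 mult_right_mono)
qed

lemma L2_integrable: "f \<in> L2_ivl c \<Longrightarrow> integrable (lborel_ivl c) f"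
proof -
  assume f: "f \<in> L2_ivl c"
  show ?thesis
  proof (rule Bochner_Integration.integrable_bound)
    show "integrable (lborel_ivl c) (\<lambda>x. 1 + (cmod (f x))\<^sup>2)"
      using f by (intro Bochner_Integration.integrable_add L.integrable_const) (simp add: L2_ivl_def)
    have "norm (f x) \<le> norm (1 + (cmod (f x))\<^sup>2)" for x
      using sum_squares_bound [of 1 "cmod (f x)"] norm_ge_zero [of "f x"] by (simp, linarith)
    then show "AE x in lborel_ivl c. norm (f x) \<le> norm (1 + (cmod (f x))\<^sup>2)" by simp
  qed (use f in \<open>simp add: L2_ivl_def\<close>)
qed

lemma bounded_in_L2:
  assumes "f \<in> borel_measurable borel" "\<And>x. cmod (f x) \<le> B"
  shows "f \<in> L2_ivl c"
proof -
  have "integrable (lborel_ivl c) (\<lambda>x. (cmod (f x))\<^sup>2)"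
  proof (rule L.integrable_const_bound [of _ "B\<^sup>2"])
    show "AE x in lborel_ivl c. norm ((cmod (f x))\<^sup>2) \<le> B\<^sup>2"
      using assms(2) by (auto intro!: AE_I2 power_mono)
    have "(\<lambda>x. (cmod (f x))\<^sup>2) \<in> borel_measurable borel" using assms(1) by measurable
    then show "(\<lambda>x. (cmod (f x))\<^sup>2) \<in> borel_measurable (lborel_ivl c)" by (rule measurable_lborel_ivl)
  qed
  then show ?thesis using assms(1) by (simp add: L2_ivl_def measurable_lborel_ivl)
qed

text \<open>The operator on merely integrable functions, for eigenfunctions not yet known to be
  continuous.\<close>

definition S_int :: "(real \<Rightarrow> real) \<Rightarrow> real \<Rightarrow> real" where
  "S_int f x = (LINT y|lborel_ivl c. nsinc (x - y) * f y)"

lemma measurable_nsinc_shift: "(\<lambda>y. nsinc (x - y)) \<in> borel_measurable borel"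
  by (intro borel_measurable_continuous_onI continuous_intros)

lemma integrable_nsinc_mult:
  "integrable (lborel_ivl c) f \<Longrightarrow> integrable (lborel_ivl c) (\<lambda>y. nsinc (x - y) * f y)" for f :: "real \<Rightarrow> real"
  by (rule integrable_bounded_mult [OF _ measurable_nsinc_shift, of _ _ 1]) (simp_all add: nsinc_abs_le_1)

lemma S_int_bcontfun:
  assumes f: "integrable (lborel_ivl c) f"
  shows "S_int f \<in> bcontfun"
proof -
  have lip: "\<bar>S_int f x - S_int f x'\<bar> \<le> (pi * (LINT y|lborel_ivl c. \<bar>f y\<bar>)) * \<bar>x - x'\<bar>" for x x'
  proof -
    have "\<bar>S_int f x - S_int f x'\<bar> = norm (LINT y|lborel_ivl c. nsinc (x - y) * f y - nsinc (x' - y) * f y)"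
      unfolding S_int_def
      by (subst Bochner_Integration.integral_diff) (simp_all add: integrable_nsinc_mult f)
    also have "\<dots> \<le> (LINT y|lborel_ivl c. norm (nsinc (x - y) * f y - nsinc (x' - y) * f y))"
      by (rule integral_norm_bound)
    also have "\<dots> \<le> (LINT y|lborel_ivl c. (pi * \<bar>x - x'\<bar>) * \<bar>f y\<bar>)"
    proof (rule integral_mono)
      show "integrable (lborel_ivl c) (\<lambda>y. norm (nsinc (x - y) * f y - nsinc (x' - y) * f y))"
        by (intro integrable_norm Bochner_Integration.integrable_diff integrable_nsinc_mult f)
      show "integrable (lborel_ivl c) (\<lambda>y. (pi * \<bar>x - x'\<bar>) * \<bar>f y\<bar>)"
        by (intro integrable_mult_right integrable_abs f)
      show "norm (nsinc (x - y) * f y - nsinc (x' - y) * f y) \<le> (pi * \<bar>x - x'\<bar>) * \<bar>f y\<bar>" for y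
        using mult_right_mono [OF nsinc_Lipschitz [of "x - y" "x' - y"], of "\<bar>f y\<bar>"]
        by (simp flip: left_diff_distrib add: abs_mult)
    qed
    also have "\<dots> = (pi * (LINT y|lborel_ivl c. \<bar>f y\<bar>)) * \<bar>x - x'\<bar>" by simp
    finally show ?thesis .
  qed
  have bd: "norm (S_int f x) \<le> (LINT y|lborel_ivl c. \<bar>f y\<bar>)" for x
  proof -
    have "norm (S_int f x) \<le> (LINT y|lborel_ivl c. norm (nsinc (x - y) * f y))"
      unfolding S_int_def by (rule integral_norm_bound)
    also have "\<dots> \<le> (LINT y|lborel_ivl c. \<bar>f y\<bar>)"
    proof (rule integral_mono)
      show "norm (nsinc (x - y) * f y) \<le> \<bar>f y\<bar>" for y
        using mult_right_mono [OF nsinc_abs_le_1 [of "x - y"], of "\<bar>f y\<bar>"] by (simp add: abs_mult)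
    qed (intro integrable_norm integrable_abs integrable_nsinc_mult f)+
    finally show ?thesis .
  qed
  have "continuous_on UNIV (S_int f)"
  proof (rule lipschitz_on_continuous_on)
    show "(pi * (LINT y|lborel_ivl c. \<bar>f y\<bar>))-lipschitz_on UNIV (S_int f)"
      by (rule lipschitz_onI) (use lip in \<open>auto simp: dist_real_def intro!: mult_nonneg_nonneg integral_nonneg\<close>)
  qed
  then show ?thesis using bd by (rule bcontfun_normI)
qed

lemma S_int_apply: "S_int (apply_bcontfun g) x = apply_bcontfun (S g) x"
  unfolding S_int_def apply_S by (rule LINT_continuous) (intro continuous_intros)

lemma sinc_op_S_int:
  assumes "integrable (lborel_ivl c) f"
  shows "sinc_op c f x = Complex (S_int (\<lambda>y. Re (f y)) x) (S_int (\<lambda>y. Im (f y)) x)"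
proof -
  have "integrable (lborel_ivl c) (\<lambda>y. complex_of_real (nsinc (x - y)) * f y)"
    by (rule integrable_bounded_mult [OF assms, of _ 1])
       (auto intro!: borel_measurable_continuous_onI continuous_intros simp: nsinc_abs_le_1)
  from integral_Re [OF this] integral_Im [OF this] show ?thesis
    by (simp add: complex_eq_iff sinc_op_def S_int_def sinc_kernel_nsinc)
qed

text \<open>Since \<open>S_int f\<close> is bounded and continuous, \<open>S_int f / \<nu>\<close>
  is a continuous representative of \<open>f\<close>, and it satisfies the eigenvalue equation at
  every point of the line.\<close>

lemma real_eigenvector:
  assumes f: "integrable (lborel_ivl c) f" and \<nu>: "0 < \<nu>"
    and eig: "AE x in lborel_ivl c. S_int f x = \<nu> * f x"
  obtains g where "S g = \<nu> *\<^sub>R g" "AE x in lborel_ivl c. f x = apply_bcontfun g x"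
proof -
  define g where "g = (1 / \<nu>) *\<^sub>R Bcontfun (S_int f)"
  have g: "apply_bcontfun g x = S_int f x / \<nu>" for x
    by (simp add: g_def Bcontfun_inverse [OF S_int_bcontfun [OF f]])
  have ae: "AE x in lborel_ivl c. f x = apply_bcontfun g x"
    using eig by eventually_elim (use \<nu> in \<open>simp add: g\<close>)
  have "apply_bcontfun (S g) x = \<nu> * apply_bcontfun g x" for x
  proof -
    have "apply_bcontfun (S g) x = S_int f x"
      unfolding S_int_apply [symmetric] S_int_def
    proof (rule integral_cong_AE)
      show "(\<lambda>y. nsinc (x - y) * apply_bcontfun g y) \<in> borel_measurable (lborel_ivl c)"
        by (intro borel_measurable_times measurable_bcontfun measurable_lborel_ivl measurable_nsinc_shift)
      show "(\<lambda>y. nsinc (x - y) * f y) \<in> borel_measurable (lborel_ivl c)"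
        using integrable_nsinc_mult [OF f] by (rule borel_measurable_integrable)
      show "AE y in lborel_ivl c. nsinc (x - y) * apply_bcontfun g y = nsinc (x - y) * f y"
        using ae by eventually_elim simp
    qed
    then show ?thesis using \<nu> by (simp add: g)
  qed
  then have "S g = \<nu> *\<^sub>R g" by (intro bcontfun_eqI) simp
  with ae show thesis using that by blast
qed

end

section \<open>Multiplicities and the ordered list of eigenvalues\<close>

context sinc_spectrum begin

lemma finite_ev_ge: "0 < \<mu> \<Longrightarrow> finite {m. \<mu> \<le> ev m}"
proof -
  assume "0 < \<mu>"
  from order_tendstoD(2) [OF ev_tendsto_0 this] obtain N where N: "\<And>n. N \<le> n \<Longrightarrow> ev n < \<mu>"
    unfolding eventually_sequentially by blast
  have "{m. \<mu> \<le> ev m} \<subseteq> {..<N}"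
  proof
    fix m assume "m \<in> {m. \<mu> \<le> ev m}"
    then show "m \<in> {..<N}" using N [of m] by (cases "N \<le> m") auto
  qed
  then show ?thesis by (rule finite_subset) simp
qed

lemma finite_ev_eq: "0 < \<nu> \<Longrightarrow> finite {m. ev m = \<nu>}"
  by (rule finite_subset [OF _ finite_ev_ge [of \<nu>]]) auto

text \<open>The remainder \<open>h\<close> satisfies \<open>S h = 0\<close>, by
  \<open>S_proj_le\<close> and the decay of \<open>ev\<close>, and also
  \<open>S h = \<nu> *\<^sub>R h\<close>. Hence it is 0 as a function on the line, not merely a null
  vector.\<close>

lemma eigenvector_expansion:
  assumes g: "S g = \<nu> *\<^sub>R g" and \<nu>: "0 < \<nu>"
  shows "g = (\<Sum>m\<in>{m. ev m = \<nu>}. ip g (\<phi> m) *\<^sub>R \<phi> m)"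
proof -
  have z: "ip g (\<phi> m) = 0" if "ev m \<noteq> \<nu>" for m
    using S_sym [of g "\<phi> m"] that by (simp add: g S_phi ip_simps)
  define h where "h = g - (\<Sum>m\<in>{m. ev m = \<nu>}. ip g (\<phi> m) *\<^sub>R \<phi> m)"
  obtain N where N: "{m. ev m = \<nu>} \<subseteq> {..<N}"
    using finite_ev_eq [OF \<nu>] finite_nat_iff_bounded by blast
  have h: "h = g - comb n (\<lambda>m. ip g (\<phi> m))" if "N \<le> n" for n
  proof -
    have "comb n (\<lambda>m. ip g (\<phi> m)) = (\<Sum>m\<in>{m. ev m = \<nu>}. ip g (\<phi> m) *\<^sub>R \<phi> m)"
      unfolding comb_def by (rule sum.mono_neutral_right) (use N that z in auto)
    then show ?thesis by (simp add: h_def)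
  qed
  have "apply_bcontfun (S h) x = 0" for x
  proof -
    have "(\<lambda>n. ev n * ip g g) \<longlonglongrightarrow> 0" using tendsto_mult_right [OF ev_tendsto_0] by simp
    then have "(apply_bcontfun (S h) x)\<^sup>2 \<le> 0"
    proof (rule LIMSEQ_le_const)
      show "\<exists>N. \<forall>n\<ge>N. (apply_bcontfun (S h) x)\<^sup>2 \<le> ev n * ip g g"
        using S_proj_le [of g _ x] h by (intro exI [of _ N] allI impI) simp
    qed
    then show ?thesis by simp
  qed
  then have "S h = 0" by (intro bcontfun_eqI) simp
  moreover have "S h = \<nu> *\<^sub>R h"
  proof -
    have "S (\<Sum>m\<in>{m. ev m = \<nu>}. ip g (\<phi> m) *\<^sub>R \<phi> m) = (\<Sum>m\<in>{m. ev m = \<nu>}. \<nu> *\<^sub>R (ip g (\<phi> m) *\<^sub>R \<phi> m))"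
      unfolding S_sum by (intro sum.cong refl) (simp add: S_scaleR S_phi)
    then show ?thesis by (simp add: h_def S_diff g scaleR_diff_right scaleR_sum_right)
  qed
  ultimately have "h = 0" using \<nu> by simp
  then show ?thesis by (simp add: h_def)
qed

text \<open>The kernel is real, so real and imaginary parts are eigenfunctions separately, and their
  real coefficients combine into complex ones.\<close>

lemma eigenspace_expansion:
  assumes f: "f \<in> eigenspace c \<nu>" and \<nu>: "0 < \<nu>"
  shows "\<exists>b. AE x in lborel_ivl c. f x = (\<Sum>m\<in>{m. ev m = \<nu>}. b m * complex_of_real (apply_bcontfun (\<phi> m) x))"
proof -
  have int: "integrable (lborel_ivl c) f" using f L2_integrable by (simp add: eigenspace_def)
  have eig: "AE x in lborel_ivl c. sinc_op c f x = complex_of_real \<nu> * f x" using f by (simp add: eigenspace_def)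
  have "AE x in lborel_ivl c. S_int (\<lambda>y. Re (f y)) x = \<nu> * Re (f x)"
    using eig by eventually_elim (simp add: sinc_op_S_int [OF int] complex_eq_iff)
  then obtain g where g: "S g = \<nu> *\<^sub>R g" "AE x in lborel_ivl c. Re (f x) = apply_bcontfun g x"
    using real_eigenvector [OF integrable_Re [OF int] \<nu>] by blast
  have "AE x in lborel_ivl c. S_int (\<lambda>y. Im (f y)) x = \<nu> * Im (f x)"
    using eig by eventually_elim (simp add: sinc_op_S_int [OF int] complex_eq_iff)
  then obtain h where h: "S h = \<nu> *\<^sub>R h" "AE x in lborel_ivl c. Im (f x) = apply_bcontfun h x"
    using real_eigenvector [OF integrable_Im [OF int] \<nu>] by blast
  have G: "apply_bcontfun g x = (\<Sum>m\<in>{m. ev m = \<nu>}. ip g (\<phi> m) * apply_bcontfun (\<phi> m) x)" for x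
    by (subst eigenvector_expansion [OF g(1) \<nu>]) (simp add: bcontfun_sum)
  have H: "apply_bcontfun h x = (\<Sum>m\<in>{m. ev m = \<nu>}. ip h (\<phi> m) * apply_bcontfun (\<phi> m) x)" for x
    by (subst eigenvector_expansion [OF h(1) \<nu>]) (simp add: bcontfun_sum)
  have "AE x in lborel_ivl c. f x = (\<Sum>m\<in>{m. ev m = \<nu>}.
      Complex (ip g (\<phi> m)) (ip h (\<phi> m)) * complex_of_real (apply_bcontfun (\<phi> m) x))"
    using g(2) h(2) by eventually_elim (simp add: complex_eq_iff G H)
  then show ?thesis by (intro exI)
qed

lemma phi_eigenspace:
  assumes "ev m = \<nu>"
  shows "(\<lambda>x. complex_of_real (apply_bcontfun (\<phi> m) x)) \<in> eigenspace c \<nu>"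
proof -
  let ?f = "\<lambda>x. complex_of_real (apply_bcontfun (\<phi> m) x)"
  have L2: "?f \<in> L2_ivl c"
  proof (rule bounded_in_L2)
    show "?f \<in> borel_measurable borel"
      by (intro borel_measurable_continuous_onI continuous_intros)
    show "cmod (?f x) \<le> norm (\<phi> m)" for x using norm_bounded [of "\<phi> m" x] by simp
  qed
  have "sinc_op c ?f x = complex_of_real \<nu> * ?f x" for x
  proof -
    have "S_int (\<lambda>y. 0) x = 0" by (simp add: S_int_def)
    then show ?thesis
      using assms by (simp add: sinc_op_S_int [OF L2_integrable [OF L2]] S_int_apply apply_S_phi complex_eq_iff)
  qed
  with L2 show ?thesis by (simp add: eigenspace_def)
qed

lemma phi_independent:
  assumes I: "finite I" "\<And>m. m \<in> I \<Longrightarrow> 0 < ev m"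
    and z: "AE x in lborel_ivl c. (\<Sum>m\<in>I. a m * complex_of_real (apply_bcontfun (\<phi> m) x)) = 0" and j: "j \<in> I"
  shows "a j = 0"
proof -
  have real: "r j = 0" if "AE x in lborel_ivl c. (\<Sum>m\<in>I. r m * apply_bcontfun (\<phi> m) x) = 0" for r :: "nat \<Rightarrow> real"
  proof -
    let ?g = "\<Sum>m\<in>I. r m *\<^sub>R \<phi> m"
    have "ip ?g (\<phi> j) = (LINT y|lborel_ivl c. 0)"
      unfolding LINT_ip [symmetric]
    proof (rule integral_cong_AE)
      show "AE x in lborel_ivl c. apply_bcontfun ?g x * apply_bcontfun (\<phi> j) x = 0"
        using that by eventually_elim (simp add: bcontfun_sum)
    qed (intro borel_measurable_times measurable_bcontfun, simp)
    moreover have "ip ?g (\<phi> j) = (\<Sum>m\<in>I. if m = j then r m else 0)"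
      unfolding ip_sum_left by (intro sum.cong refl) (use I(2) in \<open>auto simp: ip_simps phi_orthonormal\<close>)
    ultimately show ?thesis using I(1) j by (simp add: sum.delta)
  qed
  have "AE x in lborel_ivl c. (\<Sum>m\<in>I. Re (a m) * apply_bcontfun (\<phi> m) x) = 0"
    using z by eventually_elim (simp add: complex_eq_iff)
  moreover have "AE x in lborel_ivl c. (\<Sum>m\<in>I. Im (a m) * apply_bcontfun (\<phi> m) x) = 0"
    using z by eventually_elim (simp add: complex_eq_iff)
  ultimately show ?thesis using real [of "\<lambda>m. Re (a m)"] real [of "\<lambda>m. Im (a m)"] by (simp add: complex_eq_iff)
qed

lemma is_eigenvalue_iff:
  assumes \<nu>: "0 < \<nu>"
  shows "is_eigenvalue c \<nu> \<longleftrightarrow> \<nu> \<in> range ev"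
proof
  assume "is_eigenvalue c \<nu>"
  then obtain f where f: "f \<in> eigenspace c \<nu>" "\<not> (AE x in lborel_ivl c. f x = 0)"
    unfolding is_eigenvalue_def by blast
  show "\<nu> \<in> range ev"
  proof (rule ccontr)
    assume "\<nu> \<notin> range ev"
    then have "{m. ev m = \<nu>} = {}" by auto
    with eigenspace_expansion [OF f(1) \<nu>] f(2) show False by simp
  qed
next
  assume "\<nu> \<in> range ev"
  then obtain m where m: "ev m = \<nu>" by auto
  have "\<not> (AE x in lborel_ivl c. complex_of_real (apply_bcontfun (\<phi> m) x) = 0)"
    using phi_independent [of "{m}" "\<lambda>_. 1" m] m \<nu> by auto
  then show "is_eigenvalue c \<nu>" unfolding is_eigenvalue_def
    by (rule bexI [where x = "\<lambda>x. complex_of_real (apply_bcontfun (\<phi> m) x)"]) (rule phi_eigenspace [OF m])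
qed

lemma eig_mult_eq:
  assumes \<nu>: "0 < \<nu>"
  shows "eig_mult c \<nu> = card {m. ev m = \<nu>}"
proof -
  let ?M = "{m. ev m = \<nu>}"
  let ?K = "{k. \<exists>f. (\<forall>i<k. f i \<in> eigenspace c \<nu>) \<and> L2_independent c k f}"
  have fin: "finite ?M" by (rule finite_ev_eq [OF \<nu>])
  obtain e where e: "bij_betw e {..<card ?M} ?M"
    using ex_bij_betw_nat_finite [OF fin] unfolding atLeast0LessThan by blast
  have "card ?M \<in> ?K"
  proof -
    let ?f = "\<lambda>i x. complex_of_real (apply_bcontfun (\<phi> (e i)) x)"
    have ei: "ev (e i) = \<nu>" if "i < card ?M" for i
      using bij_betw_apply [OF e, of i] that by simp
    have "L2_independent c (card ?M) ?f"
      unfolding L2_independent_def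
    proof (intro allI impI)
      fix a :: "nat \<Rightarrow> complex" and i
      assume z: "AE x in lborel_ivl c. (\<Sum>i<card ?M. a i * ?f i x) = 0" and i: "i < card ?M"
      define a' where "a' m = a (inv_into {..<card ?M} e m)" for m
      have a': "a' (e i) = a i" if "i < card ?M" for i
        using bij_betw_inv_into_left [OF e, of i] that by (simp add: a'_def)
      have "(\<Sum>m\<in>?M. a' m * complex_of_real (apply_bcontfun (\<phi> m) x)) = (\<Sum>i<card ?M. a i * ?f i x)" for x
        by (subst sum.reindex_bij_betw [OF e, symmetric]) (simp add: a')
      then have "a' (e i) = 0"
        using phi_independent [OF fin, of a' "e i"] z \<nu> ei [OF i] by simp
      then show "a i = 0" using a' [OF i] by simp
    qed
    moreover have "\<forall>i<card ?M. ?f i \<in> eigenspace c \<nu>" using phi_eigenspace [OF ei] by simp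
    ultimately show ?thesis by (intro CollectI exI [of _ ?f] conjI)
  qed
  moreover have "k \<le> card ?M" if "k \<in> ?K" for k
  proof (rule ccontr)
    assume k: "\<not> k \<le> card ?M"
    from that obtain f where f: "\<And>i. i < k \<Longrightarrow> f i \<in> eigenspace c \<nu>" and ind: "L2_independent c k f" by blast
    have "\<exists>b. \<forall>i<k. AE x in lborel_ivl c. f i x = (\<Sum>m\<in>?M. b i m * complex_of_real (apply_bcontfun (\<phi> m) x))"
      using eigenspace_expansion [OF f \<nu>] by (intro choice) blast
    then obtain b where b: "\<And>i. i < k \<Longrightarrow> AE x in lborel_ivl c. f i x = (\<Sum>m\<in>?M. b i m * complex_of_real (apply_bcontfun (\<phi> m) x))"
      by blast
    obtain a where a: "\<exists>i\<in>{..<k}. a i \<noteq> 0" "\<And>m. m \<in> ?M \<Longrightarrow> (\<Sum>i\<in>{..<k}. a i * b i m) = 0"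
      using homogeneous_system_nontrivial [OF fin finite_lessThan, of k b] k by auto
    have "AE x in lborel_ivl c. \<forall>i\<in>{..<k}. f i x = (\<Sum>m\<in>?M. b i m * complex_of_real (apply_bcontfun (\<phi> m) x))"
      by (rule AE_finite_allI) (use b in auto)
    then have "AE x in lborel_ivl c. (\<Sum>i<k. a i * f i x) = 0"
    proof eventually_elim
      case (elim x)
      have "(\<Sum>i<k. a i * f i x) = (\<Sum>i<k. \<Sum>m\<in>?M. a i * b i m * complex_of_real (apply_bcontfun (\<phi> m) x))"
        using elim by (intro sum.cong refl) (simp add: sum_distrib_left mult.assoc)
      also have "\<dots> = (\<Sum>m\<in>?M. (\<Sum>i<k. a i * b i m) * complex_of_real (apply_bcontfun (\<phi> m) x))"
        unfolding sum_distrib_right by (rule sum.swap)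
      also have "\<dots> = 0" using a(2) by (intro sum.neutral) simp
      finally show ?case .
    qed
    with ind a(1) show False unfolding L2_independent_def by blast
  qed
  ultimately show ?thesis unfolding eig_mult_def by (rule cSup_eq_maximum)
qed

lemma eig_count_eq:
  assumes \<mu>: "0 < \<mu>"
  shows "eig_count c \<mu> = card {m. \<mu> \<le> ev m}"
proof -
  have eq: "{\<nu>. is_eigenvalue c \<nu> \<and> \<mu> \<le> \<nu>} = ev ` {m. \<mu> \<le> ev m}"
    using is_eigenvalue_iff less_le_trans [OF \<mu>] by auto
  have fin: "finite {m. \<mu> \<le> ev m}" by (rule finite_ev_ge [OF \<mu>])
  have "eig_count c \<mu> = (\<Sum>\<nu>\<in>ev ` {m. \<mu> \<le> ev m}. card {m \<in> {m. \<mu> \<le> ev m}. ev m = \<nu>})"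
    unfolding eig_count_def eq
  proof (rule sum.cong [OF refl])
    fix \<nu> assume "\<nu> \<in> ev ` {m. \<mu> \<le> ev m}"
    then have "\<mu> \<le> \<nu>" by auto
    then have "{m \<in> {m. \<mu> \<le> ev m}. ev m = \<nu>} = {m. ev m = \<nu>}" by auto
    then show "eig_mult c \<nu> = card {m \<in> {m. \<mu> \<le> ev m}. ev m = \<nu>}"
      using eig_mult_eq [of \<nu>] \<mu> \<open>\<mu> \<le> \<nu>\<close> by simp
  qed
  also have "\<dots> = (\<Sum>\<nu>\<in>ev ` {m. \<mu> \<le> ev m}. \<Sum>m\<in>{m \<in> {m. \<mu> \<le> ev m}. ev m = \<nu>}. 1)" by simp
  also have "\<dots> = (\<Sum>m\<in>{m. \<mu> \<le> ev m}. 1)"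
    by (rule sum.group [OF fin]) (use fin in auto)
  finally show ?thesis by simp
qed

theorem eigval_eq: "eigval c n = ev n"
proof -
  \<comment> \<open>As \<open>ev\<close> decreases, the indices with \<open>\<mu> \<le> ev m\<close>
    form an initial segment, which has more than \<open>n\<close> elements iff it contains
    \<open>n\<close>.\<close>
  have iff: "n < eig_count c \<mu> \<longleftrightarrow> \<mu> \<le> ev n" if \<mu>: "0 < \<mu>" for \<mu>
  proof -
    let ?A = "{m. \<mu> \<le> ev m}"
    have fin: "finite ?A" by (rule finite_ev_ge [OF \<mu>])
    have down: "m \<in> ?A" if "k \<in> ?A" "m \<le> k" for m k
      using that decseqD [OF ev_decseq that(2)] by simp
    show ?thesis unfolding eig_count_eq [OF \<mu>]
    proof
      assume n: "n < card ?A"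
      show "\<mu> \<le> ev n"
      proof (rule ccontr)
        assume "\<not> \<mu> \<le> ev n"
        then have "?A \<subseteq> {..<n}" using down [of _ n] by (metis lessThan_iff mem_Collect_eq not_less subsetI)
        then have "card ?A \<le> n" using card_mono [of "{..<n}" ?A] by simp
        with n show False by simp
      qed
    next
      assume "\<mu> \<le> ev n"
      then have "{..n} \<subseteq> ?A" using down [of n] by auto
      then have "card {..n} \<le> card ?A" by (rule card_mono [OF fin])
      then show "n < card ?A" by simp
    qed
  qed
  \<comment> \<open>The inserted 0 closes the interval at its left end, so its supremum is
    \<open>ev n\<close> even when \<open>ev n = 0\<close>.\<close>
  have "insert 0 {\<mu>. 0 < \<mu> \<and> n < eig_count c \<mu>} = {0..ev n}"
  proof (intro equalityI subsetI)
    fix \<mu> assume "\<mu> \<in> {0..ev n}"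
    then show "\<mu> \<in> insert 0 {\<mu>. 0 < \<mu> \<and> n < eig_count c \<mu>}" using iff [of \<mu>] by (cases "\<mu> = 0") auto
  qed (use iff ev_nonneg [of n] in auto)
  then show ?thesis unfolding eigval_def using ev_nonneg [of n] by simp
qed

theorem sinc_det_limit:
  assumes z: "0 \<le> z"
  shows "(\<lambda>N. \<Prod>m<N. 1 + z * ev m) \<longlonglongrightarrow> sinc_det c z"
proof -
  interpret K: orthonormal_kernel "lborel_ivl c" ev "\<lambda>m. apply_bcontfun (\<phi> m)"
  proof
    show "\<exists>B. \<forall>x. \<bar>apply_bcontfun (\<phi> m) x\<bar> \<le> B" for m
      using norm_bounded [of "\<phi> m"] by (intro exI [of _ "norm (\<phi> m)"]) simp
  qed (simp_all add: ev_nonneg measurable_bcontfun LINT_ip phi_orthonormal)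
  show ?thesis unfolding sinc_det_def
  proof (rule K.fredholm_det_limit [OF z _ _ ev_sum_le])
    fix x y assume xy: "x \<in> space (lborel_ivl c)" "y \<in> space (lborel_ivl c)"
    show "(\<lambda>N. K.part N x y) \<longlonglongrightarrow> sinc_kernel x y"
      using mercer [of y x] xy by (simp add: sums_def K.part_def sinc_kernel_nsinc)
  next
    fix N x y
    let ?a = "\<lambda>k x. sqrt (ev k) * apply_bcontfun (\<phi> k) x"
    have "(\<Sum>k<N. ?a k x * ?a k y)\<^sup>2 \<le> (\<Sum>k<N. (?a k x)\<^sup>2) * (\<Sum>k<N. (?a k y)\<^sup>2)"
      by (rule Cauchy_Schwarz_ineq_sum)
    also have "\<dots> \<le> 1 * 1"
      using diag_sum_le [of _ N] ev_nonneg by (intro mult_mono) (simp_all add: power_mult_distrib sum_nonneg)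
    finally have "\<bar>\<Sum>k<N. ?a k x * ?a k y\<bar> \<le> 1" by (simp add: abs_square_le_1)
    moreover have "?a k x * ?a k y = ev k * apply_bcontfun (\<phi> k) x * apply_bcontfun (\<phi> k) y" for k
    proof -
      have "sqrt (ev k) * sqrt (ev k) = ev k" using ev_nonneg by simp
      then show ?thesis by (metis mult.assoc mult.left_commute)
    qed
    ultimately show "\<bar>K.part N x y\<bar> \<le> 1" by (simp add: K.part_def)
  qed
qed

end

section \<open>The equivalence\<close>

text \<open>The excess over the chord: summed over the eigenvalues it is \<open>ln det (I + (e\<^sup>u - 1) S\<^sub>c) - u c\<close>.\<close>

definition excess :: "real \<Rightarrow> real \<Rightarrow> real" where
  "excess u l = ln (1 + (exp u - 1) * l) - u * l"

lemma excess_arg_pos: "0 \<le> u \<Longrightarrow> 0 \<le> l \<Longrightarrow> 1 \<le> 1 + (exp u - 1) * l" for u l :: real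
  by simp

text \<open>Concavity of \<open>ln\<close>, from the tangent bound ln t \<le> t - 1 at
  \<open>1 / y\<close> and \<open>exp u / y\<close>: their mean with weights \<open>1 - l\<close>
  and \<open>l\<close> is 1.\<close>

lemma excess_nonneg:
  assumes u: "0 \<le> u" and l: "0 \<le> l" "l \<le> 1"
  shows "0 \<le> excess u l"
proof -
  define y where "y = 1 + (exp u - 1) * l"
  have y: "1 \<le> y" unfolding y_def by (rule excess_arg_pos [OF u l(1)])
  have "- ln y = ln (1 / y)" using y by (simp add: ln_div)
  also have "\<dots> \<le> 1 / y - 1" by (rule ln_le_minus_one) (use y in simp)
  finally have 1: "- ln y \<le> 1 / y - 1" .
  have "u - ln y = ln (exp u / y)" using y by (simp add: ln_div)
  also have "\<dots> \<le> exp u / y - 1" by (rule ln_le_minus_one) (use y in simp)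
  finally have 2: "u - ln y \<le> exp u / y - 1" .
  have "(1 - l) * (- ln y) + l * (u - ln y) \<le> (1 - l) * (1 / y - 1) + l * (exp u / y - 1)"
    by (intro add_mono mult_left_mono 1 2) (use l in auto)
  also have "\<dots> = ((1 - l) + l * exp u) / y - 1"
    by (simp add: algebra_simps add_divide_distrib diff_divide_distrib)
  also have "(1 - l) + l * exp u = y" by (simp add: y_def algebra_simps)
  also have "y / y - 1 = 0" using y by simp
  finally show ?thesis by (simp add: excess_def y_def algebra_simps)
qed

lemma ln_chord_le:
  fixes u l :: real
  assumes "0 \<le> u" "0 \<le> l" "l \<le> 1"
  shows "ln (1 + (exp u - 1) * l) \<le> u"
proof -
  have "1 + (exp u - 1) * l \<le> 1 + (exp u - 1) * 1"
    by (intro add_left_mono mult_left_mono) (use assms in auto)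
  then have "ln (1 + (exp u - 1) * l) \<le> ln (exp u)"
    using excess_arg_pos [OF assms(1,2)] by (subst ln_le_cancel_iff) auto
  then show ?thesis by simp
qed

text \<open>As the logarithm is at most \<open>u\<close>, the excess is at most
  \<open>u * (1 - l)\<close>; the factor 2 pays for inserting \<open>l\<close>, so that
  \<open>spectral_tail_bound\<close> becomes applicable.\<close>

lemma excess_le_near_1:
  assumes u: "0 \<le> u" and l: "1 / 2 \<le> l" "l \<le> 1"
  shows "excess u l \<le> 2 * u * (l * (1 - l))"
proof -
  have "excess u l \<le> u * (1 - l)"
    using ln_chord_le [of u l] u l by (simp add: excess_def algebra_simps)
  also have "\<dots> = 2 * u * (1 / 2 * (1 - l))" by simp
  also have "\<dots> \<le> 2 * u * (l * (1 - l))" by (intro mult_left_mono mult_right_mono) (use u l in auto)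
  finally show ?thesis .
qed

lemma excess_le: "0 \<le> u \<Longrightarrow> 0 \<le> l \<Longrightarrow> l \<le> 1 \<Longrightarrow> excess u l \<le> u"
  using ln_chord_le [of u l] mult_nonneg_nonneg [of u l] unfolding excess_def by linarith

lemma excess_le_near_0:
  assumes u: "0 \<le> u" and l: "0 \<le> l" "l \<le> 1 / 2"
  shows "excess u l \<le> 2 * exp u * (l * (1 - l))"
proof -
  have "ln (1 + (exp u - 1) * l) \<le> (exp u - 1) * l"
    by (rule ln_add_one_self_le_self) (use u l in auto)
  then have "excess u l \<le> (exp u - 1) * l" using mult_nonneg_nonneg [OF u l(1)] unfolding excess_def by linarith
  also have "\<dots> \<le> exp u * l" by (intro mult_right_mono) (use l in auto)
  also have "\<dots> = 2 * exp u * (l * (1 / 2))" by simp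
  also have "\<dots> \<le> 2 * exp u * (l * (1 - l))" by (intro mult_left_mono) (use l in auto)
  finally show ?thesis .
qed

text \<open>The argument of the logarithm is at least \<open>exp u * l\<close>, which leaves
  \<open>u + ln l - u * l\<close>. Up to \<open>l = 1 / 4\<close> the losses are at most
  \<open>u / 2\<close> and \<open>u / 4\<close>; beyond it they are at most
  \<open>2 * ln 2 \<le> 2\<close> and \<open>u / 2\<close>, and \<open>u / 2 - 2 \<ge> u / 4\<close>
  is the origin of \<open>8 \<le> u\<close>.\<close>

lemma excess_ge:
  assumes u: "8 \<le> u" and l: "exp (- (u / 2)) \<le> l" "l \<le> 1 / 2"
  shows "u / 4 \<le> excess u l"
proof -
  have l0: "0 < l" using less_le_trans [OF exp_gt_zero l(1)] .
  have "u + ln l = ln (exp u * l)" using l0 by (simp add: ln_mult)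
  also have "\<dots> \<le> ln (1 + (exp u - 1) * l)"
  proof (rule ln_mono)
    show "exp u * l \<le> 1 + (exp u - 1) * l" using l(2) by (simp add: algebra_simps)
  qed (use l0 in simp)
  finally have ge: "u + ln l - u * l \<le> excess u l" by (simp add: excess_def)
  show ?thesis
  proof (cases "l \<le> 1 / 4")
    case True
    have "ln (exp (- (u / 2))) \<le> ln l" using l(1) l0 by (subst ln_le_cancel_iff) auto
    then have "- (u / 2) \<le> ln l" by simp
    moreover have "u * l \<le> u * (1 / 4)" by (rule mult_left_mono [OF True]) (use u in simp)
    ultimately show ?thesis using ge by linarith
  next
    case False
    then have "ln (1 / 4) \<le> ln l" using l0 by (subst ln_le_cancel_iff) auto
    moreover have "ln (1 / 4 :: real) = - (2 * ln 2)"
      using ln_realpow [of 2 2] by (simp add: ln_div)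
    moreover have "ln (2 :: real) \<le> 2 - 1" by (rule ln_le_minus_one) simp
    moreover have "u * l \<le> u * (1 / 2)" by (rule mult_left_mono [OF l(2)]) (use u in simp)
    ultimately show ?thesis using ge u by linarith
  qed
qed

section \<open>Two-sided bounds for the determinant\<close>

context sinc_spectrum begin

lemma excess_sum_tendsto:
  assumes u: "0 \<le> u"
  shows "(\<lambda>N. \<Sum>m<N. excess u (ev m)) \<longlonglongrightarrow> ln (sinc_det c (exp u - 1)) - u * c"
proof -
  have pos: "1 \<le> 1 + (exp u - 1) * ev m" for m by (rule excess_arg_pos [OF u ev_nonneg])
  have pos0: "0 < 1 + (exp u - 1) * ev m" for m using pos [of m] by linarith
  have lim: "(\<lambda>N. \<Prod>m<N. 1 + (exp u - 1) * ev m) \<longlonglongrightarrow> sinc_det c (exp u - 1)"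
    by (rule sinc_det_limit) (use u in simp)
  have "1 \<le> sinc_det c (exp u - 1)"
    by (rule LIMSEQ_le_const [OF lim]) (use pos in \<open>auto intro!: prod_ge_1\<close>)
  then have "(\<lambda>N. ln (\<Prod>m<N. 1 + (exp u - 1) * ev m)) \<longlonglongrightarrow> ln (sinc_det c (exp u - 1))"
    by (intro tendsto_ln lim) simp
  moreover have "ln (\<Prod>m<N. 1 + (exp u - 1) * ev m) = (\<Sum>m<N. ln (1 + (exp u - 1) * ev m))" for N
    by (rule ln_prod) (simp_all add: less_imp_not_eq2 [OF pos0])
  ultimately have 1: "(\<lambda>N. \<Sum>m<N. ln (1 + (exp u - 1) * ev m)) \<longlonglongrightarrow> ln (sinc_det c (exp u - 1))" by simp
  have "(\<lambda>N. u * (\<Sum>m<N. ev m)) \<longlonglongrightarrow> u * c"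
    using ev_sums unfolding sums_def by (rule tendsto_mult_left)
  from tendsto_diff [OF 1 this] show ?thesis
    by (simp add: excess_def sum_subtractf sum_distrib_left)
qed

lemma D_count_eq: "D_count \<delta> c = card {n. \<delta> < ev n \<and> ev n \<le> 1 / 2}"
  by (simp add: D_count_def eigval_eq)

lemma finite_D: "0 < \<delta> \<Longrightarrow> finite {n. \<delta> < ev n \<and> ev n \<le> 1 / 2}"
  by (rule finite_subset [OF _ finite_ev_ge [of \<delta>]]) auto

lemma ln_det_upper:
  assumes c: "3 \<le> c" and \<alpha>: "0 \<le> \<alpha>" and \<delta>: "c powr - \<alpha> \<le> \<delta>" "\<delta> \<le> 1 / 2"
    and u: "u = ln (1 / \<delta>) / 2" and B: "B = 1384 * (7 + 2 * \<alpha>) + 2"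
  shows "ln (sinc_det c (exp u - 1)) - u * c \<le> u * D_count \<delta> c + 2 * u * B * ln c + 2 * B * ln c"
proof -
  have \<delta>0: "0 < \<delta>" using less_le_trans [OF _ \<delta>(1)] c by simp
  have u0: "0 \<le> u" using \<delta>0 \<delta>(2) by (simp add: u)
  have eu: "exp u * sqrt \<delta> = 1"
  proof -
    have "sqrt \<delta> = exp (ln (sqrt \<delta>))" using \<delta>0 by simp
    also have "ln (sqrt \<delta>) = - u" using \<delta>0 by (simp add: u ln_sqrt ln_div)
    finally show ?thesis by (simp flip: exp_add)
  qed
  let ?\<mu> = "\<lambda>n. ev n * (1 - ev n)"
  have \<mu>1: "?\<mu> n \<le> ev n" for n using ev_nonneg [of n] by (simp add: algebra_simps)
  have "(\<Sum>m<N. excess u (ev m)) \<le> u * D_count \<delta> c + 2 * u * B * ln c + 2 * B * ln c" for N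
  proof -
    let ?A1 = "{m. m < N \<and> 1 / 2 < ev m}" and ?A2 = "{m. m < N \<and> \<delta> < ev m \<and> ev m \<le> 1 / 2}"
      and ?A3 = "{m. m < N \<and> ev m \<le> \<delta>}"
    have split: "{..<N} = ?A1 \<union> (?A2 \<union> ?A3)" using \<delta>(2) by auto
    have "(\<Sum>m<N. excess u (ev m)) = (\<Sum>m\<in>?A1. excess u (ev m)) + ((\<Sum>m\<in>?A2. excess u (ev m)) + (\<Sum>m\<in>?A3. excess u (ev m)))"
      unfolding split using \<delta>(2) by (subst sum.union_disjoint; (subst sum.union_disjoint)?; force)
    also have "(\<Sum>m\<in>?A1. excess u (ev m)) \<le> 2 * u * (B * sqrt 1 * ln c)"
    proof -
      have "(\<Sum>m\<in>?A1. excess u (ev m)) \<le> (\<Sum>m\<in>?A1. 2 * u * ?\<mu> m)"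
        by (intro sum_mono excess_le_near_1 u0 ev_le_1) auto
      also have "\<dots> = 2 * u * (\<Sum>m\<in>?A1. ?\<mu> m)" by (simp add: sum_distrib_left)
      also have "\<dots> \<le> 2 * u * (B * sqrt 1 * ln c)"
        unfolding B
      proof (intro mult_left_mono spectral_tail_bound [OF c \<alpha>])
        show "c powr - \<alpha> \<le> 1" using \<delta> by simp
        show "?\<mu> n \<le> 1" for n using \<mu>1 [of n] ev_le_1 [of n] by linarith
      qed (use u0 in auto)
      finally show ?thesis .
    qed
    also have "(\<Sum>m\<in>?A2. excess u (ev m)) \<le> u * D_count \<delta> c"
    proof -
      have "(\<Sum>m\<in>?A2. excess u (ev m)) \<le> (\<Sum>m\<in>?A2. u)"
        by (intro sum_mono excess_le u0 ev_nonneg ev_le_1)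
      also have "\<dots> = u * card ?A2" by simp
      also have "\<dots> \<le> u * D_count \<delta> c"
        unfolding D_count_eq by (intro mult_left_mono of_nat_mono card_mono finite_D \<delta>0 u0) auto
      finally show ?thesis .
    qed
    also have "(\<Sum>m\<in>?A3. excess u (ev m)) \<le> 2 * exp u * (B * sqrt \<delta> * ln c)"
    proof -
      have "(\<Sum>m\<in>?A3. excess u (ev m)) \<le> (\<Sum>m\<in>?A3. 2 * exp u * ?\<mu> m)"
        by (intro sum_mono excess_le_near_0 u0 ev_nonneg) (use \<delta>(2) in auto)
      also have "\<dots> = 2 * exp u * (\<Sum>m\<in>?A3. ?\<mu> m)" by (simp add: sum_distrib_left)
      also have "\<dots> \<le> 2 * exp u * (B * sqrt \<delta> * ln c)"
        unfolding B
      proof (intro mult_left_mono spectral_tail_bound [OF c \<alpha> \<delta>(1)])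
        show "?\<mu> n \<le> \<delta>" if "n \<in> ?A3" for n using \<mu>1 [of n] that by simp
      qed (use \<delta>(2) in auto)
      finally show ?thesis .
    qed
    also have "2 * exp u * (B * sqrt \<delta> * ln c) = 2 * (exp u * sqrt \<delta>) * B * ln c" by simp
    finally show ?thesis unfolding eu by (simp add: algebra_simps)
  qed
  then show ?thesis by (intro LIMSEQ_le_const2 [OF excess_sum_tendsto [OF u0]]) auto
qed

lemma ln_det_lower:
  assumes u: "8 \<le> u"
  shows "u / 4 * D_count (exp (- (u / 2))) c \<le> ln (sinc_det c (exp u - 1)) - u * c"
proof -
  let ?A = "{n. exp (- (u / 2)) < ev n \<and> ev n \<le> 1 / 2}"
  have fin: "finite ?A" by (rule finite_D) simp
  then obtain N0 where N0: "?A \<subseteq> {..<N0}" using finite_nat_iff_bounded by blast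
  have u0: "0 \<le> u" using u by simp
  have "u / 4 * D_count (exp (- (u / 2))) c \<le> (\<Sum>m<N. excess u (ev m))" if "N0 \<le> N" for N
  proof -
    have "u / 4 * D_count (exp (- (u / 2))) c = (\<Sum>m\<in>?A. u / 4)" by (simp add: D_count_eq)
    also have "\<dots> \<le> (\<Sum>m\<in>?A. excess u (ev m))"
      by (intro sum_mono excess_ge u) auto
    also have "\<dots> \<le> (\<Sum>m<N. excess u (ev m))"
    proof (rule sum_mono2)
      show "?A \<subseteq> {..<N}" using N0 that by auto
    qed (use excess_nonneg [OF u0 ev_nonneg ev_le_1] in auto)
    finally show ?thesis .
  qed
  then show ?thesis by (intro LIMSEQ_le_const [OF excess_sum_tendsto [OF u0]]) blast
qed

end

text \<open>As \<open>u\<close> is half of \<open>L\<close>, the bound on \<open>\<delta>\<close>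
  says \<open>w \<le> u\<close>. The three parts of \<open>w\<close> make \<open>u\<close>
  admissible for \<open>T_with\<close>, fold the error \<open>2 * B * ln c\<close> into the one
  proportional to \<open>u\<close>, and keep the total error \<open>4 * B * ln c\<close> below half
  of \<open>\<kappa> * u * ln c\<close>. The condition \<open>\<alpha> \<le> c\<close> is for
  \<open>\<alpha> * c / L \<le> c * c\<close>.\<close>

lemma T_imp_BRIDGE:
  assumes \<alpha>: "4 \<le> \<alpha>" and T: "T_with \<alpha> \<kappa> L\<^sub>T c\<^sub>T"
    and B: "B = 1384 * (7 + 2 * \<alpha>) + 2" and w: "w = max (max L\<^sub>T 1) (8 * B / \<kappa>)"
  shows "BRIDGE_with \<alpha> (exp (- (2 * w))) (\<kappa> / 8) 0 (max c\<^sub>T (max 3 \<alpha>))"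
proof -
  have \<kappa>: "0 < \<kappa>" using T by (simp add: T_with_def)
  have w1: "1 \<le> w" "L\<^sub>T \<le> w" "8 * B / \<kappa> \<le> w" by (auto simp: w)
  have B0: "0 \<le> B" using \<alpha> by (simp add: B)
  have half: "exp (- (2 * w)) < 1 / 2"
  proof -
    have "exp (- (2 * w)) \<le> exp (- 1 - 1)" using w1 by simp
    also have "\<dots> < exp (- 1)" by simp
    also have "exp (- 1) \<le> (1 / 2 :: real)"
    proof -
      have "1 + 1 \<le> exp (1 :: real)" by (rule exp_ge_add_one_self)
      then have "1 / exp (1 :: real) \<le> 1 / 2" by (intro divide_left_mono) auto
      then show ?thesis by (simp add: exp_minus inverse_eq_divide)
    qed
    finally show ?thesis .
  qed
  have main: "\<kappa> / 8 * ln (1 / \<delta>) * ln (\<alpha> * c / ln (1 / \<delta>)) - 0 \<le> D_count \<delta> c"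
    if c: "0 < c" "max c\<^sub>T (max 3 \<alpha>) \<le> c" and \<delta>: "c powr - \<alpha> \<le> \<delta>" "\<delta> \<le> exp (- (2 * w))" for c \<delta>
  proof -
    have c': "c\<^sub>T \<le> c" "3 \<le> c" "\<alpha> \<le> c" using c(2) by auto
    interpret sinc_interval c by unfold_locales (rule c(1))
    obtain ev \<phi> where "sinc_spectrum c ev \<phi>" using spectrum_exists by blast
    then interpret sinc_spectrum c ev \<phi> .
    have \<delta>0: "0 < \<delta>" using less_le_trans [OF _ \<delta>(1)] c by simp
    define L where "L = ln (1 / \<delta>)"
    define u where "u = L / 2"
    have "ln \<delta> \<le> - (2 * w)" using \<delta>(2) \<delta>0 by (metis ln_exp ln_le_cancel_iff exp_gt_zero)
    then have uw: "w \<le> u" using \<delta>0 by (simp add: u_def L_def ln_div)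
    have "ln (c powr - \<alpha>) \<le> ln \<delta>" using \<delta>(1) \<delta>0 c(1) by (subst ln_le_cancel_iff) auto
    then have uL: "L \<le> \<alpha> * ln c" using \<delta>0 c(1) by (simp add: L_def ln_div ln_powr)
    have lc: "1 \<le> ln c" by (rule ln_ge_1 [OF c'(2)])
    have u\<alpha>: "u \<le> \<alpha> * ln c" using uL uw w1 by (simp add: u_def)
    have "u * c + \<kappa> * u\<^sup>2 * ln c \<le> ln (sinc_det c (exp u - 1))"
      using T c(1) c'(1) w1(2) uw u\<alpha> unfolding T_with_def by fastforce
    moreover have "ln (sinc_det c (exp u - 1)) - u * c \<le> u * D_count \<delta> c + 2 * u * B * ln c + 2 * B * ln c"
      by (rule ln_det_upper [OF c'(2) _ \<delta>(1) _ _ B]) (use \<alpha> \<delta>(2) half in \<open>auto simp: u_def L_def\<close>)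
    moreover have "2 * B * ln c * 1 \<le> 2 * B * ln c * u"
      using B0 lc uw w1 by (intro mult_left_mono) auto
    ultimately have "\<kappa> * u\<^sup>2 * ln c \<le> u * D_count \<delta> c + 2 * u * B * ln c + 2 * B * ln c * u" by linarith
    also have "\<dots> = u * (D_count \<delta> c + 4 * B * ln c)" by (simp add: algebra_simps)
    finally have "u * (\<kappa> * u * ln c) \<le> u * (D_count \<delta> c + 4 * B * ln c)"
      by (simp add: power2_eq_square mult_ac)
    then have 1: "\<kappa> * u * ln c \<le> D_count \<delta> c + 4 * B * ln c"
      using uw w1 by (simp add: mult_le_cancel_left_pos)
    have "8 * B \<le> \<kappa> * u"
    proof -
      have "8 * B / \<kappa> \<le> u" using uw w1 by linarith
      then show ?thesis using \<kappa> by (simp add: pos_divide_le_eq mult.commute)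
    qed
    then have "8 * B * ln c \<le> \<kappa> * u * ln c" using lc by (intro mult_right_mono) auto
    with 1 have 2: "\<kappa> * u * ln c / 2 \<le> D_count \<delta> c" by linarith
    have L2: "2 \<le> L" using uw w1 by (simp add: u_def)
    have "\<alpha> * c / L \<le> \<alpha> * c / 1" using L2 \<alpha> c(1) by (intro divide_left_mono) auto
    also have "\<dots> \<le> c * c" using c' c(1) by simp
    finally have "ln (\<alpha> * c / L) \<le> ln (c * c)"
      using L2 \<alpha> c(1) by (subst ln_le_cancel_iff) auto
    also have "\<dots> = 2 * ln c" using c(1) by (simp add: ln_mult)
    finally have "\<kappa> / 8 * L * ln (\<alpha> * c / L) \<le> \<kappa> / 8 * L * (2 * ln c)"
      using \<kappa> L2 by (intro mult_left_mono) auto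
    also have "\<dots> = \<kappa> * u * ln c / 2" by (simp add: u_def)
    finally show ?thesis using 2 by (simp add: L_def)
  qed
  show ?thesis
    unfolding BRIDGE_with_def Let_def using half \<kappa> main by auto
qed

text \<open>Three lower bounds for \<open>u\<close>: 8 for \<open>excess_ge\<close>,
  \<open>2 * ln (1 / \<delta>\<^sub>0)\<close> to bring \<open>exp (- (u / 2))\<close> below
  \<open>\<delta>\<^sub>0\<close>, and \<open>8 * \<bar>C\<bar> / \<kappa>\<close> so that
  \<open>C\<close> costs at most half of the gain.\<close>

lemma BRIDGE_imp_T:
  assumes \<alpha>: "4 \<le> \<alpha>" and Br: "BRIDGE_with \<alpha> \<delta>\<^sub>0 \<kappa> C c\<^sub>0"
  shows "T_with \<alpha> (\<kappa> / 32) (max (max 8 (2 * ln (1 / \<delta>\<^sub>0))) (8 * \<bar>C\<bar> / \<kappa>)) (max c\<^sub>0 3)"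
proof -
  have \<kappa>: "0 < \<kappa>" and \<delta>\<^sub>0: "0 < \<delta>\<^sub>0" using Br by (auto simp: BRIDGE_with_def)
  have main: "u * c + \<kappa> / 32 * u\<^sup>2 * ln c \<le> ln (sinc_det c (exp u - 1))"
    if c: "0 < c" "max c\<^sub>0 3 \<le> c" and u: "max (max 8 (2 * ln (1 / \<delta>\<^sub>0))) (8 * \<bar>C\<bar> / \<kappa>) \<le> u" "u \<le> \<alpha> * ln c" for c u
  proof -
    have c': "c\<^sub>0 \<le> c" "3 \<le> c" using c(2) by auto
    have u': "8 \<le> u" "2 * ln (1 / \<delta>\<^sub>0) \<le> u" "8 * \<bar>C\<bar> / \<kappa> \<le> u" using u(1) by auto
    interpret sinc_interval c by unfold_locales (rule c(1))
    obtain ev \<phi> where "sinc_spectrum c ev \<phi>" using spectrum_exists by blast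
    then interpret sinc_spectrum c ev \<phi> .
    define \<delta> where "\<delta> = exp (- (u / 2))"
    have L: "ln (1 / \<delta>) = u / 2" by (simp add: \<delta>_def ln_div)
    have lc: "1 \<le> ln c" by (rule ln_ge_1 [OF c'(2)])
    have 1: "c powr - \<alpha> \<le> \<delta>"
    proof -
      have "c powr - \<alpha> = exp (- \<alpha> * ln c)" using c(1) by (simp add: powr_def)
      also have "\<dots> \<le> \<delta>" using u(2) u'(1) by (simp add: \<delta>_def)
      finally show ?thesis .
    qed
    have 2: "\<delta> \<le> \<delta>\<^sub>0"
    proof -
      have "- (u / 2) \<le> ln \<delta>\<^sub>0" using u'(2) \<delta>\<^sub>0 by (simp add: ln_div)
      then have "\<delta> \<le> exp (ln \<delta>\<^sub>0)" by (simp add: \<delta>_def)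
      then show ?thesis using \<delta>\<^sub>0 by simp
    qed
    have D: "\<kappa> * (u / 2) * ln (\<alpha> * c / (u / 2)) - C \<le> D_count \<delta> c"
      using Br c(1) c'(1) 1 2 unfolding BRIDGE_with_def Let_def L [symmetric] by blast
    \<comment> \<open>Since \<open>u \<le> \<alpha> * ln c\<close> and
      \<open>ln c \<le> 2 * sqrt c\<close>, the argument of the logarithm stays above
      \<open>sqrt c\<close>.\<close>
    have "ln c / 2 \<le> ln (\<alpha> * c / (u / 2))"
    proof -
      have "ln c = 2 * ln (sqrt c)" using c(1) by (simp add: ln_sqrt)
      also have "\<dots> \<le> 2 * sqrt c"
        using ln_le_minus_one [of "sqrt c"] c(1) by simp
      finally have "ln c * sqrt c \<le> 2 * sqrt c * sqrt c" by (rule mult_right_mono) (use c(1) in simp)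
      then have lcs: "ln c * sqrt c \<le> 2 * c"
        using c(1) by (simp only: mult.assoc real_sqrt_mult_self abs_of_pos)
      have "u * sqrt c \<le> \<alpha> * ln c * sqrt c" by (rule mult_right_mono [OF u(2)]) (use c(1) in simp)
      also have "\<dots> \<le> \<alpha> * (2 * c)" using mult_left_mono [OF lcs, of \<alpha>] \<alpha> by (simp add: mult.assoc)
      finally have "sqrt c \<le> \<alpha> * c / (u / 2)" using u'(1) by (simp add: pos_le_divide_eq mult_ac)
      then have "ln (sqrt c) \<le> ln (\<alpha> * c / (u / 2))" using c(1) u'(1) \<alpha> by (subst ln_le_cancel_iff) auto
      then show ?thesis using c(1) by (simp add: ln_sqrt)
    qed
    then have "\<kappa> * (u / 2) * (ln c / 2) \<le> \<kappa> * (u / 2) * ln (\<alpha> * c / (u / 2))"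
      using \<kappa> u'(1) by (intro mult_left_mono) auto
    with D have "\<kappa> * (u / 2) * (ln c / 2) - \<bar>C\<bar> \<le> D_count \<delta> c" by linarith
    then have "u / 4 * (\<kappa> * (u / 2) * (ln c / 2) - \<bar>C\<bar>) \<le> u / 4 * D_count \<delta> c"
      using u'(1) by (intro mult_left_mono) auto
    also have "\<dots> \<le> ln (sinc_det c (exp u - 1)) - u * c"
      unfolding \<delta>_def by (rule ln_det_lower [OF u'(1)])
    finally have 3: "u / 4 * (\<kappa> * (u / 2) * (ln c / 2) - \<bar>C\<bar>) \<le> ln (sinc_det c (exp u - 1)) - u * c" .
    have "8 * \<bar>C\<bar> \<le> \<kappa> * u" using u'(3) \<kappa> by (simp add: pos_divide_le_eq mult.commute)
    also have "\<dots> \<le> \<kappa> * u * ln c" using mult_left_mono [OF lc, of "\<kappa> * u"] \<kappa> u'(1) by simp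
    finally have "u * (8 * \<bar>C\<bar>) \<le> u * (\<kappa> * u * ln c)" using u'(1) by (intro mult_left_mono) auto
    moreover have "u / 4 * (\<kappa> * (u / 2) * (ln c / 2) - \<bar>C\<bar>) = u * (\<kappa> * u * ln c) / 16 - u * (8 * \<bar>C\<bar>) / 32"
      by (simp add: algebra_simps)
    moreover have "\<kappa> / 32 * u\<^sup>2 * ln c = u * (\<kappa> * u * ln c) / 32" by (simp add: power2_eq_square)
    ultimately show ?thesis using 3 by linarith
  qed
  show ?thesis
    unfolding T_with_def using \<kappa> main by auto
qed

theorem theorem1p17:
  fixes \<alpha> :: real
  assumes "\<alpha> \<ge> 4"
  shows "(\<forall>\<kappa>\<^sub>T L\<^sub>T. \<exists>\<delta>\<^sub>0 c\<^sub>0. \<forall>c\<^sub>T. T_with \<alpha> \<kappa>\<^sub>T L\<^sub>T c\<^sub>T \<longrightarrow> BRIDGE_with \<alpha> \<delta>\<^sub>0 (\<kappa>\<^sub>T / 8) 0 c\<^sub>0)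
    \<and> (\<forall>\<delta>\<^sub>0 \<kappa> C c\<^sub>0. BRIDGE_with \<alpha> \<delta>\<^sub>0 \<kappa> C c\<^sub>0 \<longrightarrow> (\<exists>L\<^sub>T c\<^sub>T. T_with \<alpha> (\<kappa> / 32) L\<^sub>T c\<^sub>T))
    \<and> (BRIDGE_assertion \<alpha> \<longleftrightarrow> T_assertion \<alpha>)"
proof (intro conjI)
  show 1: "\<forall>\<kappa>\<^sub>T L\<^sub>T. \<exists>\<delta>\<^sub>0 c\<^sub>0. \<forall>c\<^sub>T. T_with \<alpha> \<kappa>\<^sub>T L\<^sub>T c\<^sub>T \<longrightarrow> BRIDGE_with \<alpha> \<delta>\<^sub>0 (\<kappa>\<^sub>T / 8) 0 c\<^sub>0"
  proof (intro allI)
    fix \<kappa>\<^sub>T L\<^sub>T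
    show "\<exists>\<delta>\<^sub>0 c\<^sub>0. \<forall>c\<^sub>T. T_with \<alpha> \<kappa>\<^sub>T L\<^sub>T c\<^sub>T \<longrightarrow> BRIDGE_with \<alpha> \<delta>\<^sub>0 (\<kappa>\<^sub>T / 8) 0 c\<^sub>0"
    \<comment> \<open>\<open>c\<^sub>0\<close> must be chosen before \<open>c\<^sub>T\<close>. If
      some \<open>c\<^sub>T\<close> is admissible for the given constants, the
      \<open>c\<^sub>0\<close> obtained from that one serves for all, as the conclusion does not
      mention \<open>c\<^sub>T\<close>; if none is, the implication is vacuous.\<close>
    proof (cases "\<exists>c\<^sub>T. T_with \<alpha> \<kappa>\<^sub>T L\<^sub>T c\<^sub>T")
      case True
      then obtain c\<^sub>T where "T_with \<alpha> \<kappa>\<^sub>T L\<^sub>T c\<^sub>T" by blast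
      from T_imp_BRIDGE [OF assms this refl refl] show ?thesis by blast
    qed blast
  qed
  show 2: "\<forall>\<delta>\<^sub>0 \<kappa> C c\<^sub>0. BRIDGE_with \<alpha> \<delta>\<^sub>0 \<kappa> C c\<^sub>0 \<longrightarrow> (\<exists>L\<^sub>T c\<^sub>T. T_with \<alpha> (\<kappa> / 32) L\<^sub>T c\<^sub>T)"
    using BRIDGE_imp_T [OF assms] by blast
  show "BRIDGE_assertion \<alpha> \<longleftrightarrow> T_assertion \<alpha>"
    unfolding BRIDGE_assertion_def T_assertion_def using 1 2 by blast
qed

end
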